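(* Let $n\ge 2$, let $a$ be a non-zero element of $\mathbb{C}^n$ (a row vector) and let $A=a^t a\in\mathbb{C}^{n\times n}$. Let $\phi_a:\mathbf{SU}(n)/\mathbf{SO}(n)\to\mathbb{C}$ be the complex-valued eigenfunction induced by its $\mathbf{SO}(n)$-invariant lift $\hat\phi_a:\mathbf{SU}(n)\to\mathbb{C}$ given by $$\hat\phi_a(z)=\operatorname{trace}(A\, z\, z^t).$$ Then the origin $0\in\mathbb{C}$ is a regular value of $\phi_a$, so the compact fibre $\phi_a^{-1}(\{0\})$ is a minimal submanifold of $\mathbf{SU}(n)/\mathbf{SO}(n)$ of codimension two.
   Context: Elements of $\mathbb{C}^n$ are written as row vectors and $z^t$ denotes the transpose (without conjugation). $\mathbf{SU}(n)=\{z\in\mathbb{C}^{n\times n}\mid z\bar z^t=I_n,\ \det z=1\}$, and $\mathbf{SO}(n)$ is its subgroup of real matrices. $\mathbf{SU}(n)$ carries the bi-invariant Riemannian metric induced by the inner product $g(Z,W)=\mathfrak{Re}\,\operatorname{trace}(Z\bar W^t)$ on its Lie algebra, and $\mathbf{SU}(n)/\mathbf{SO}(n)$ (the space of cosets $z\,\mathbf{SO}(n)$) carries the Riemannian symmetric metric for which the natural projection $\pi:\mathbf{SU}(n)\to\mathbf{SU}(n)/\mathbf{SO}(n)$ is a Riemannian submersion. Since $\hat\phi_a(zx)=\hat\phi_a(z)$ for all $x\in\mathbf{SO}(n)$, there is a unique function $\phi_a$ with $\hat\phi_a=\phi_a\circ\pi$; this is the function induced by $\hat\phi_a$. A complex-valued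 function $\phi$ on a Riemannian manifold $(M,g)$ is an eigenfunction if there exist $\lambda,\mu\in\mathbb{C}$ with $\tau(\phi)=\lambda\,\phi$ and $\kappa(\phi,\phi)=\mu\,\phi^2$, where $\tau(\phi)=\operatorname{div}(\nabla\phi)$ is the Laplace-Beltrami operator and $\kappa(\phi,\psi)=g(\nabla\phi,\nabla\psi)$, with $g$ extended complex bilinearly to the complexified tangent bundle. That $\phi_a$ is an eigenfunction is a previously known fact presupposed in the statement. A submanifold is minimal if its mean curvature vector field vanishes identically. Regular value is meant for $\phi_a$ as a smooth map into $\mathbb{C}\cong\mathbb{R}^2$. *)

theory Defs
  imports "HOL-Analysis.Analysis"
begin

section \<open>Smooth maps between Euclidean spaces\<close>

text \<open>These two notions are meant for open domains \<open>S\<close>; in finite dimension it suffices to iterate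
  directional derivatives.\<close>

fun Ck_on :: "nat \<Rightarrow> ('a::euclidean_space \<Rightarrow> 'b::real_normed_vector) \<Rightarrow> 'a set \<Rightarrow> bool" where
  "Ck_on 0 f S \<longleftrightarrow> continuous_on S f"
| "Ck_on (Suc k) f S \<longleftrightarrow>
     (\<forall>x\<in>S. f differentiable (at x)) \<and> (\<forall>v. Ck_on k (\<lambda>x. frechet_derivative f (at x) v) S)"

definition smooth_on :: "('a::euclidean_space \<Rightarrow> 'b::real_normed_vector) \<Rightarrow> 'a set \<Rightarrow> bool" where
  "smooth_on f S \<longleftrightarrow> (\<forall>k. Ck_on k f S)"

text \<open>Smoothness on a subset (here: of an embedded submanifold) of a Euclidean space, by local smooth
  extension to the ambient space.\<close>

definition locally_smooth_extendable_on ::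
    "('a::euclidean_space \<Rightarrow> 'b::real_normed_vector) \<Rightarrow> 'a set \<Rightarrow> bool" where
  "locally_smooth_extendable_on f S \<longleftrightarrow>
     (\<forall>x\<in>S. \<exists>V F. open V \<and> x \<in> V \<and> smooth_on F V \<and> (\<forall>y\<in>V \<inter> S. F y = f y))"


section \<open>Smooth and Riemannian manifolds\<close>

text \<open>A chart is a pair of a domain and a coordinate map; the values of the coordinate map outside
  the domain are irrelevant.\<close>

type_synonym ('p, 'e) chart = "'p set \<times> ('p \<Rightarrow> 'e)"

definition chart_image :: "('p, 'e) chart \<Rightarrow> 'e set" where
  "chart_image C = snd C ` fst C"

definition chart_inv :: "('p, 'e) chart \<Rightarrow> 'e \<Rightarrow> 'p" where
  "chart_inv C = inv_into (fst C) (snd C)"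

definition topological_chart :: "'p topology \<Rightarrow> ('p, 'e::euclidean_space) chart \<Rightarrow> bool" where
  "topological_chart T C \<longleftrightarrow>
     openin T (fst C) \<and> open (chart_image C) \<and>
     homeomorphic_map (subtopology T (fst C)) (top_of_set (chart_image C)) (snd C)"

definition transition :: "('p, 'e) chart \<Rightarrow> ('p, 'e) chart \<Rightarrow> 'e \<Rightarrow> 'e" where
  "transition C C' = snd C' \<circ> chart_inv C"

definition overlap :: "('p, 'e) chart \<Rightarrow> ('p, 'e) chart \<Rightarrow> 'e set" where
  "overlap C C' = snd C ` (fst C \<inter> fst C')"

definition smoothly_compatible ::
    "('p, 'e::euclidean_space) chart \<Rightarrow> ('p, 'e) chart \<Rightarrow> bool" where
  "smoothly_compatible C C' \<longleftrightarrow>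
     smooth_on (transition C C') (overlap C C') \<and> smooth_on (transition C' C) (overlap C' C)"

text \<open>The manifold has dimension \<open>DIM('e)\<close>; \<open>\<A>\<close> is its maximal smooth atlas.\<close>

locale smooth_manifold =
  fixes T :: "'p topology" and \<A> :: "('p, 'e::euclidean_space) chart set"
  assumes hausdorff: "Hausdorff_space T"
    and second_countable: "second_countable T"
    and charts: "C \<in> \<A> \<Longrightarrow> topological_chart T C"
    and cover: "(\<Union>C\<in>\<A>. fst C) = topspace T"
    and compatible: "C \<in> \<A> \<Longrightarrow> C' \<in> \<A> \<Longrightarrow> smoothly_compatible C C'"
    and maximal: "topological_chart T C' \<Longrightarrow> (\<And>C. C \<in> \<A> \<Longrightarrow> smoothly_compatible C C') \<Longrightarrow> C' \<in> \<A>"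

text \<open>Tangent vectors are represented by their components in a chart: \<open>g C x v w\<close> is the inner product,
  at the point with coordinates \<open>x\<close>, of the tangent vectors with components \<open>v\<close> and \<open>w\<close> in \<open>C\<close>.\<close>

type_synonym ('p, 'e) metric = "('p, 'e) chart \<Rightarrow> 'e \<Rightarrow> 'e \<Rightarrow> 'e \<Rightarrow> real"

definition inner_product :: "('e::euclidean_space \<Rightarrow> 'e \<Rightarrow> real) \<Rightarrow> bool" where
  "inner_product \<beta> \<longleftrightarrow>
     bilinear \<beta> \<and> (\<forall>v w. \<beta> v w = \<beta> w v) \<and> (\<forall>v. v \<noteq> 0 \<longrightarrow> \<beta> v v > 0)"

locale riemannian_manifold = smooth_manifold T \<A>
  for T :: "'p topology" and \<A> :: "('p, 'e::euclidean_space) chart set" +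
  fixes g :: "('p, 'e) metric"
  assumes metric_inner_product: "C \<in> \<A> \<Longrightarrow> x \<in> chart_image C \<Longrightarrow> inner_product (g C x)"
    and metric_smooth: "C \<in> \<A> \<Longrightarrow> smooth_on (\<lambda>x. g C x v w) (chart_image C)"
    and metric_transition: "C \<in> \<A> \<Longrightarrow> C' \<in> \<A> \<Longrightarrow> x \<in> overlap C C' \<Longrightarrow>
      g C x v w =
        g C' (transition C C' x) (frechet_derivative (transition C C') (at x) v)
                                 (frechet_derivative (transition C C') (at x) w)"


section \<open>Smooth functions, regular values, embedded submanifolds\<close>

definition smooth_function ::
    "('p, 'e::euclidean_space) chart set \<Rightarrow> ('p \<Rightarrow> 'b::real_normed_vector) \<Rightarrow> bool" where
  "smooth_function \<A> \<phi> \<longleftrightarrow> (\<forall>C\<in>\<A>. smooth_on (\<phi> \<circ> chart_inv C) (chart_image C))"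

definition regular_value ::
    "('p, 'e::euclidean_space) chart set \<Rightarrow> ('p \<Rightarrow> 'b::real_normed_vector) \<Rightarrow> 'b \<Rightarrow> bool" where
  "regular_value \<A> \<phi> y \<longleftrightarrow>
     smooth_function \<A> \<phi> \<and>
     (\<forall>C\<in>\<A>. \<forall>p\<in>fst C. \<phi> p = y \<longrightarrow>
        (\<exists>D. ((\<phi> \<circ> chart_inv C) has_derivative D) (at (snd C p)) \<and> surj D))"

definition slice_chart ::
    "('p, 'e::euclidean_space) chart set \<Rightarrow> nat \<Rightarrow> 'p set \<Rightarrow> ('p, 'e) chart \<Rightarrow> 'e set \<Rightarrow> bool" where
  "slice_chart \<A> k F C W \<longleftrightarrow>
     C \<in> \<A> \<and> subspace W \<and> dim W + k = DIM('e) \<and> snd C ` (fst C \<inter> F) = chart_image C \<inter> W"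

definition submanifold_of_codim ::
    "('p, 'e::euclidean_space) chart set \<Rightarrow> nat \<Rightarrow> 'p set \<Rightarrow> bool" where
  "submanifold_of_codim \<A> k F \<longleftrightarrow> (\<forall>p\<in>F. \<exists>C W. slice_chart \<A> k F C W \<and> p \<in> fst C)"


section \<open>Levi-Civita connection, gradient, divergence\<close>

text \<open>In this section \<open>G\<close> is the metric expressed in the coordinates of one chart, i.e. \<open>G = g C\<close>, and vector
  fields and functions are likewise given in coordinates. \<open>christoffel G x u v\<close> is the vector
  \<open>\<Sum>i j k. \<Gamma>\<^sup>k\<^sub>i\<^sub>j u\<^sub>i v\<^sub>j e\<^sub>k\<close>, determined by the Koszul formula for constant coordinate fields.\<close>

definition christoffel ::
    "('e::euclidean_space \<Rightarrow> 'e \<Rightarrow> 'e \<Rightarrow> real) \<Rightarrow> 'e \<Rightarrow> 'e \<Rightarrow> 'e \<Rightarrow> 'e" where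
  "christoffel G x u v = (THE \<gamma>. \<forall>w. 2 * G x \<gamma> w =
      frechet_derivative (\<lambda>y. G y v w) (at x) u
    + frechet_derivative (\<lambda>y. G y u w) (at x) v
    - frechet_derivative (\<lambda>y. G y u v) (at x) w)"

definition covariant_derivative ::
    "('e::euclidean_space \<Rightarrow> 'e \<Rightarrow> 'e \<Rightarrow> real) \<Rightarrow> ('e \<Rightarrow> 'e) \<Rightarrow> 'e \<Rightarrow> 'e \<Rightarrow> 'e" where
  "covariant_derivative G X x u = frechet_derivative X (at x) u + christoffel G x u (X x)"

definition gradient ::
    "('e::euclidean_space \<Rightarrow> 'e \<Rightarrow> 'e \<Rightarrow> real) \<Rightarrow> ('e \<Rightarrow> real) \<Rightarrow> 'e \<Rightarrow> 'e" where
  "gradient G f x = (THE \<xi>. \<forall>w. G x \<xi> w = frechet_derivative f (at x) w)"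

text \<open>The divergence is the trace of \<open>u \<mapsto> \<nabla>\<^sub>u X\<close>; a trace may be computed in any basis, here in the
  standard one of the coordinate space.\<close>

definition divergence ::
    "('e::euclidean_space \<Rightarrow> 'e \<Rightarrow> 'e \<Rightarrow> real) \<Rightarrow> ('e \<Rightarrow> 'e) \<Rightarrow> 'e \<Rightarrow> real" where
  "divergence G X x = (\<Sum>b\<in>Basis. covariant_derivative G X x b \<bullet> b)"


section \<open>Complex-valued eigenfunctions\<close>

definition laplace_beltrami ::
    "('e::euclidean_space \<Rightarrow> 'e \<Rightarrow> 'e \<Rightarrow> real) \<Rightarrow> ('e \<Rightarrow> complex) \<Rightarrow> 'e \<Rightarrow> complex" where
  "laplace_beltrami G h x =
     Complex (divergence G (gradient G (Re \<circ> h)) x) (divergence G (gradient G (Im \<circ> h)) x)"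

text \<open>\<open>g(\<nabla>\<phi>, \<nabla>\<psi>)\<close> for the complex bilinear extension of the metric, with
  \<open>\<nabla>\<phi> = \<nabla>(Re \<phi>) + i \<nabla>(Im \<phi>)\<close>.\<close>

definition kappa ::
    "('e::euclidean_space \<Rightarrow> 'e \<Rightarrow> 'e \<Rightarrow> real) \<Rightarrow> ('e \<Rightarrow> complex) \<Rightarrow> ('e \<Rightarrow> complex) \<Rightarrow> 'e \<Rightarrow> complex" where
  "kappa G h k x =
     Complex (G x (gradient G (Re \<circ> h) x) (gradient G (Re \<circ> k) x)
            - G x (gradient G (Im \<circ> h) x) (gradient G (Im \<circ> k) x))
             (G x (gradient G (Re \<circ> h) x) (gradient G (Im \<circ> k) x)
            + G x (gradient G (Im \<circ> h) x) (gradient G (Re \<circ> k) x))"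

definition eigenfunction ::
    "('p, 'e::euclidean_space) chart set \<Rightarrow> ('p, 'e) metric \<Rightarrow> ('p \<Rightarrow> complex) \<Rightarrow> bool" where
  "eigenfunction \<A> g \<phi> \<longleftrightarrow>
     smooth_function \<A> \<phi> \<and>
     (\<exists>l m. \<forall>C\<in>\<A>. \<forall>p\<in>fst C.
        laplace_beltrami (g C) (\<phi> \<circ> chart_inv C) (snd C p) = l * \<phi> p \<and>
        kappa (g C) (\<phi> \<circ> chart_inv C) (\<phi> \<circ> chart_inv C) (snd C p) = m * (\<phi> p)\<^sup>2)"


section \<open>Mean curvature and minimal submanifolds\<close>

definition normal_part :: "('e::euclidean_space \<Rightarrow> 'e \<Rightarrow> real) \<Rightarrow> 'e set \<Rightarrow> 'e \<Rightarrow> 'e" where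
  "normal_part \<beta> W \<xi> = (THE \<nu>. (\<forall>w\<in>W. \<beta> \<nu> w = 0) \<and> \<xi> - \<nu> \<in> W)"

text \<open>In a slice chart the tangent space of the submanifold is \<open>W\<close>, and a tangent vector \<open>v \<in> W\<close> extends
  to the constant coordinate field \<open>v\<close>, which is tangent to the submanifold along it. Hence the
  second fundamental form \<open>(\<nabla>\<^sub>u V)\<^sup>\<bottom>\<close>, which does not depend on the tangent extension \<open>V\<close> of \<open>v\<close>, may be
  computed with this extension.\<close>

definition second_fundamental_form ::
    "('e::euclidean_space \<Rightarrow> 'e \<Rightarrow> 'e \<Rightarrow> real) \<Rightarrow> 'e set \<Rightarrow> 'e \<Rightarrow> 'e \<Rightarrow> 'e \<Rightarrow> 'e" where
  "second_fundamental_form G W x u v =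
     normal_part (G x) W (covariant_derivative G (\<lambda>_. v) x u)"

definition orthonormal_basis_of :: "('e::euclidean_space \<Rightarrow> 'e \<Rightarrow> real) \<Rightarrow> 'e set \<Rightarrow> 'e set \<Rightarrow> bool" where
  "orthonormal_basis_of \<beta> W B \<longleftrightarrow>
     finite B \<and> B \<subseteq> W \<and> span B = W \<and> (\<forall>b\<in>B. \<forall>b'\<in>B. \<beta> b b' = (if b = b' then 1 else 0))"

definition mean_curvature ::
    "('e::euclidean_space \<Rightarrow> 'e \<Rightarrow> 'e \<Rightarrow> real) \<Rightarrow> 'e set \<Rightarrow> 'e \<Rightarrow> 'e" where
  "mean_curvature G W x =
     (\<Sum>e\<in>(SOME B. orthonormal_basis_of (G x) W B). second_fundamental_form G W x e e)
       /\<^sub>R real (dim W)"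

definition minimal_submanifold_of_codim ::
    "('p, 'e::euclidean_space) chart set \<Rightarrow> ('p, 'e) metric \<Rightarrow> nat \<Rightarrow> 'p set \<Rightarrow> bool" where
  "minimal_submanifold_of_codim \<A> g k F \<longleftrightarrow>
     submanifold_of_codim \<A> k F \<and>
     (\<forall>C W. slice_chart \<A> k F C W \<longrightarrow> (\<forall>p\<in>fst C \<inter> F. mean_curvature (g C) W (snd C p) = 0))"


section \<open>Riemannian submersions from a submanifold of a Euclidean space\<close>

text \<open>\<open>S\<close> is a submanifold of a Euclidean space, \<open>Tan z\<close> its tangent space at \<open>z\<close> (a subspace of the ambient
  space) and \<open>h z\<close> its metric. The ambient linear map \<open>D\<close> below is not unique, but its restriction to
  \<open>Tan z\<close> is: it is the differential of \<open>f\<close> at \<open>z\<close> in the chart \<open>C\<close>.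
  Being a Riemannian submersion with given \<open>f\<close>, \<open>S\<close> and \<open>h\<close> determines the maximal atlas \<open>\<A>\<close> and (on its
  charts) the metric \<open>g\<close> uniquely.\<close>

definition horizontal_space ::
    "('s::euclidean_space \<Rightarrow> 's \<Rightarrow> real) \<Rightarrow> 's set \<Rightarrow> ('s \<Rightarrow> 'e::euclidean_space) \<Rightarrow> 's set" where
  "horizontal_space \<beta> V D = {X\<in>V. \<forall>Y\<in>V. D Y = 0 \<longrightarrow> \<beta> X Y = 0}"

definition riemannian_submersion ::
    "'s::euclidean_space set \<Rightarrow> ('s \<Rightarrow> 's set) \<Rightarrow> ('s \<Rightarrow> 's \<Rightarrow> 's \<Rightarrow> real) \<Rightarrow>
     ('p, 'e::euclidean_space) chart set \<Rightarrow> ('p, 'e) metric \<Rightarrow> ('s \<Rightarrow> 'p) \<Rightarrow> bool" where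
  "riemannian_submersion S Tan h \<A> g f \<longleftrightarrow>
     f ` S = (\<Union>C\<in>\<A>. fst C) \<and>
     (\<forall>C\<in>\<A>.
        openin (top_of_set S) {z\<in>S. f z \<in> fst C} \<and>
        locally_smooth_extendable_on (snd C \<circ> f) {z\<in>S. f z \<in> fst C} \<and>
        (\<forall>z\<in>S. f z \<in> fst C \<longrightarrow>
           (\<exists>D. ((snd C \<circ> f) has_derivative D) (at z within S) \<and>
                D ` Tan z = UNIV \<and>
                (\<forall>X\<in>horizontal_space (h z) (Tan z) D. \<forall>Y\<in>horizontal_space (h z) (Tan z) D.
                   g C (snd C (f z)) (D X) (D Y) = h z X Y))))"


section \<open>The symmetric space \<open>SU(n)/SO(n)\<close>\<close>

definition conj_transpose :: "complex^'n^'m \<Rightarrow> complex^'m^'n" where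
  "conj_transpose z = transpose (map_matrix cnj z)"

definition SU :: "(complex^'n^'n) set" where
  "SU = {z. z ** conj_transpose z = mat 1 \<and> det z = 1}"

definition SO :: "(complex^'n^'n) set" where
  "SO = {z\<in>SU. \<forall>i j. z $ i $ j \<in> \<real>}"

definition su :: "(complex^'n^'n) set" where
  "su = {Z. Z + conj_transpose Z = 0 \<and> trace Z = 0}"

text \<open>Tangent spaces and the bi-invariant metric of \<open>SU(n)\<close> are obtained by left translation from the Lie
  algebra.\<close>

definition tangent_SU :: "complex^'n^'n \<Rightarrow> (complex^'n^'n) set" where
  "tangent_SU z = (\<lambda>Z. z ** Z) ` su"

definition metric_SU :: "complex^'n^'n \<Rightarrow> complex^'n^'n \<Rightarrow> complex^'n^'n \<Rightarrow> real" where
  "metric_SU z X Y = Re (trace ((matrix_inv z ** X) ** conj_transpose (matrix_inv z ** Y)))"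

definition proj :: "complex^'n^'n \<Rightarrow> (complex^'n^'n) set" where
  "proj z = (\<lambda>x. z ** x) ` SO"

definition SU_mod_SO :: "(complex^'n^'n) set set" where
  "SU_mod_SO = proj ` SU"

definition quotient_topology :: "(complex^'n^'n) set topology" where
  "quotient_topology =
     topology (\<lambda>U. U \<subseteq> SU_mod_SO \<and> openin (top_of_set SU) {z\<in>SU. proj z \<in> U})"

definition phi_hat :: "complex^'n \<Rightarrow> complex^'n^'n \<Rightarrow> complex" where
  "phi_hat a z =
     (let A = transpose (rowvector a :: complex^'n^1) ** (rowvector a :: complex^'n^1)
      in trace (A ** z ** transpose z))"

text \<open>A point of \<open>SU(n)/SO(n)\<close> is a coset, on which \<open>phi_hat a\<close> is constant.\<close>

definition phi :: "complex^'n \<Rightarrow> (complex^'n^'n) set \<Rightarrow> complex" where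
  "phi a q = the_elem (phi_hat a ` q)"

lemma istopology_quotient:
  "istopology (\<lambda>U. U \<subseteq> SU_mod_SO \<and>
     openin (top_of_set SU) {z\<in>(SU :: (complex^'n^'n) set). proj z \<in> U})"
  (is "istopology (\<lambda>U. U \<subseteq> SU_mod_SO \<and> ?op U)")
proof -
  have Int: "?op (U \<inter> V)" if "?op U" "?op V" for U V
  proof -
    have "{z\<in>(SU :: (complex^'n^'n) set). proj z \<in> U \<inter> V} =
          {z\<in>SU. proj z \<in> U} \<inter> {z\<in>SU. proj z \<in> V}"
      by blast
    then show ?thesis
      using openin_Int[OF that] by simp
  qed
  have Union: "?op (\<Union>K)" if "\<And>U. U \<in> K \<Longrightarrow> ?op U" for K
  proof -
    have "{z\<in>(SU :: (complex^'n^'n) set). proj z \<in> \<Union>K} = (\<Union>U\<in>K. {z\<in>SU. proj z \<in> U})"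
      by blast
    moreover have "openin (top_of_set SU) (\<Union>U\<in>K. {z\<in>(SU :: (complex^'n^'n) set). proj z \<in> U})"
      by (rule openin_Union) (use that in blast)
    ultimately show ?thesis
      by simp
  qed
  show ?thesis
    unfolding istopology_def
  proof (intro conjI allI impI)
    fix U V assume "U \<subseteq> SU_mod_SO \<and> ?op U" "V \<subseteq> SU_mod_SO \<and> ?op V"
    then show "U \<inter> V \<subseteq> SU_mod_SO" "?op (U \<inter> V)"
      using Int[of U V] by (blast, simp)
  next
    fix K assume K: "\<forall>U\<in>K. U \<subseteq> SU_mod_SO \<and> ?op U"
    then show "\<Union>K \<subseteq> SU_mod_SO"
      by blast
    show "?op (\<Union>K)"
      by (rule Union) (use K in simp)
  qed
qed

lemma openin_quotient_topology:
  "openin quotient_topology U \<longleftrightarrow>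
     U \<subseteq> SU_mod_SO \<and> openin (top_of_set SU) {z\<in>(SU :: (complex^'n^'n) set). proj z \<in> U}"
  unfolding quotient_topology_def topology_inverse'[OF istopology_quotient] by (rule refl)

end

theory Submission
  imports Defs
begin

text \<open>Put \<open>w = a z\<close>, so that \<open>phi_hat a z = w w\<^sup>t\<close>. The horizontal vectors at \<open>z\<close> are \<open>z X\<close> with \<open>X\<close> in the Lie
  algebra and symmetric, and they project to geodesics \<open>z exp (t X)\<close>, along which \<open>phi a\<close> is \<open>w exp (2 t X) w\<^sup>t\<close>.
  Hence \<open>d\<phi>(X) = 2 w X w\<^sup>t\<close> and \<open>Hess \<phi>(X, X) = 4 w X\<^sup>2 w\<^sup>t\<close>, and tracing these over an orthonormal basis gives
  the two eigenvalue equations. Where \<open>w w\<^sup>t = 0\<close>, the real and imaginary parts of \<open>w\<close> are orthogonal of equal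
  length; this makes \<open>d\<phi>\<close> surjective and \<open>Hess \<phi>\<close> zero on both gradient directions. As the full trace of the
  Hessian, a multiple of \<open>\<phi>\<close>, vanishes there too, so does its trace over the tangent space of the fibre,
  and this trace is the mean curvature up to sign and an injective linear map.\<close>

section \<open>Calculus of smooth maps\<close>

text \<open>\<open>SU\<close> carries no charts here: it is only a subset of the matrix space, and
  the hypothesis on \<open>proj\<close> supplies ambient smooth extensions of
  \<open>snd C \<circ> proj\<close>. Calculus therefore takes place in the matrix space and returns
  to the group by one principle: a differentiable function that is constant on \<open>SU\<close>
  near z has derivative zero along \<open>z ** X\<close> for X in \<open>su\<close>. Its source is a
  supply of curves in \<open>SU\<close>, explicit in sine and cosine for generators of the Lie
  algebra; products of such curves take the place of the matrix exponential. They also yield local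
  sections of \<open>proj\<close>, hence smoothness of \<open>phi a\<close>. Atlas and metric are
  arbitrary data subject to the submersion condition, so the Christoffel symbol cannot be computed
  from a formula for the metric; it is extracted from inner products that are known along
  \<open>SU\<close>. The factor n/2 + 1/2 - 1/n in the Laplace eigenvalue is, up to sign, the scalar
  by which the sum of \<open>X ** X\<close> over an orthonormal basis of the symmetric elements
  acts; in the other eigenvalue, 1 - 1/n comes from the removal of the trace.\<close>

abbreviation fderiv :: "('a::real_normed_vector \<Rightarrow> 'b::real_normed_vector) \<Rightarrow> 'a \<Rightarrow> 'a \<Rightarrow> 'b" where
  "fderiv f x \<equiv> frechet_derivative f (at x)"

lemma fderiv_eq:
  "(f has_derivative f') (at x) \<Longrightarrow> fderiv f x = f'"
  using frechet_derivative_at by metis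

lemma Ck_on_imp_continuous_on: "Ck_on k f S \<Longrightarrow> continuous_on S f"
  by (cases k) (simp_all, meson continuous_at_imp_continuous_on differentiable_imp_continuous_within)

lemma Ck_on_SucD: "Ck_on (Suc k) f S \<Longrightarrow> Ck_on k f S"
proof (induction k arbitrary: f)
  case 0
  then show ?case
    by (metis Ck_on_imp_continuous_on Ck_on.simps(1))
next
  case (Suc k)
  then show ?case
    by (metis Ck_on.simps(2))
qed

lemma Ck_on_subset: "Ck_on k f S \<Longrightarrow> T \<subseteq> S \<Longrightarrow> Ck_on k f T"
  by (induction k arbitrary: f) (auto intro: continuous_on_subset)

lemma Ck_on_cong:
  assumes "open S" "\<And>x. x \<in> S \<Longrightarrow> f x = g x" "Ck_on k f S"
  shows "Ck_on k g S"
  using assms(2,3)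
proof (induction k arbitrary: f g)
  case 0
  then show ?case
    by (metis Ck_on.simps(1) continuous_on_cong)
next
  case (Suc k)
  have d: "(g has_derivative fderiv f x) (at x)" if "x \<in> S" for x
  proof (rule has_derivative_transform_within_open[of f, OF _ assms(1) that])
    show "(f has_derivative fderiv f x) (at x)"
      using Suc.prems(2) that frechet_derivative_works by auto
  qed (use Suc.prems in auto)
  have "Ck_on k (\<lambda>x. fderiv g x v) S" for v
    by (rule Suc.IH[of "\<lambda>x. fderiv f x v"])
      (use Suc.prems d fderiv_eq in \<open>fastforce+\<close>)
  with d show ?case
    by (auto simp: differentiable_def)
qed

lemma Ck_on_local:
  assumes "\<And>x. x \<in> S \<Longrightarrow> \<exists>V. open V \<and> x \<in> V \<and> Ck_on k f V"
  shows "Ck_on k f S"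
  using assms
proof (induction k arbitrary: f)
  case 0
  then show ?case
    by (simp, meson continuous_at_imp_continuous_on continuous_on_eq_continuous_at)
next
  case (Suc k)
  have "Ck_on k (\<lambda>x. fderiv f x v) S" for v
    by (rule Suc.IH) (use Suc.prems in \<open>fastforce\<close>)
  with Suc.prems show ?case
    by fastforce
qed

lemma Ck_on_SucI:
  assumes "open S" "\<And>x. x \<in> S \<Longrightarrow> (f has_derivative f' x) (at x)"
    and "\<And>v. Ck_on k (\<lambda>x. f' x v) S"
  shows "Ck_on (Suc k) f S"
proof -
  have "Ck_on k (\<lambda>x. fderiv f x v) S" for v
    by (rule Ck_on_cong[OF assms(1) _ assms(3)]) (simp add: fderiv_eq[OF assms(2)])
  then show ?thesis
    using assms(2) by (auto simp: differentiable_def)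
qed

lemma Ck_on_Suc_deriv:
  "Ck_on (Suc k) f S \<Longrightarrow> x \<in> S \<Longrightarrow> (f has_derivative fderiv f x) (at x)"
  using frechet_derivative_works by auto

lemma Ck_on_const [simp]: "Ck_on k (\<lambda>x. c) S"
  by (induction k arbitrary: c) (auto simp: frechet_derivative_const)

lemma Ck_on_bounded_linear:
  assumes "bounded_linear f"
  shows "Ck_on k f S"
proof (cases k)
  case 0
  then show ?thesis
    using assms by (simp add: linear_continuous_on)
next
  case (Suc l)
  have "fderiv f x = f" for x
    by (rule fderiv_eq) (rule bounded_linear_imp_has_derivative[OF assms])
  with Suc show ?thesis
    using assms by (auto simp: bounded_linear_imp_differentiable)
qed

lemma Ck_on_bounded_linear_compose:
  assumes "open S" "bounded_linear L" "Ck_on k f S"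
  shows "Ck_on k (\<lambda>x. L (f x)) S"
  using assms(3)
proof (induction k arbitrary: f)
  case 0
  then show ?case
    using assms(2) by (simp add: bounded_linear.continuous_on)
next
  case (Suc k)
  show ?case
  proof (rule Ck_on_SucI[OF assms(1)])
    fix x assume "x \<in> S"
    show "((\<lambda>x. L (f x)) has_derivative (\<lambda>v. L (fderiv f x v))) (at x)"
      by (rule bounded_linear.has_derivative[OF assms(2)])
        (rule Ck_on_Suc_deriv[OF Suc.prems \<open>x \<in> S\<close>])
  qed (use Suc in auto)
qed

lemma Ck_on_add:
  assumes "open S" "Ck_on k f S" "Ck_on k g S"
  shows "Ck_on k (\<lambda>x. f x + g x) S"
  using assms(2,3)
proof (induction k arbitrary: f g)
  case 0
  then show ?case
    by (simp add: continuous_on_add)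
next
  case (Suc k)
  show ?case
  proof (rule Ck_on_SucI[OF assms(1)])
    fix x assume "x \<in> S"
    show "((\<lambda>x. f x + g x) has_derivative
        (\<lambda>v. fderiv f x v + fderiv g x v)) (at x)"
      by (intro has_derivative_add Ck_on_Suc_deriv[OF Suc.prems(1) \<open>x \<in> S\<close>]
          Ck_on_Suc_deriv[OF Suc.prems(2) \<open>x \<in> S\<close>])
  qed (use Suc in auto)
qed

lemma Ck_on_sum:
  assumes "open S" "\<And>i. i \<in> I \<Longrightarrow> Ck_on k (f i) S"
  shows "Ck_on k (\<lambda>x. \<Sum>i\<in>I. f i x) S"
  using assms(2) by (induction I rule: infinite_finite_induct) (auto intro: Ck_on_add[OF assms(1)])

lemma Ck_on_bilinear:
  assumes "open S" "bounded_bilinear B" "Ck_on k f S" "Ck_on k g S"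
  shows "Ck_on k (\<lambda>x. B (f x) (g x)) S"
  using assms(3,4)
proof (induction k arbitrary: f g)
  case 0
  then show ?case
    using assms(2) by (simp add: bounded_bilinear.continuous_on)
next
  case (Suc k)
  show ?case
  proof (rule Ck_on_SucI[OF assms(1)])
    fix x assume "x \<in> S"
    show "((\<lambda>x. B (f x) (g x)) has_derivative
        (\<lambda>v. B (f x) (fderiv g x v) + B (fderiv f x v) (g x))) (at x)"
      by (intro bounded_bilinear.FDERIV[OF assms(2)] Ck_on_Suc_deriv[OF Suc.prems(1) \<open>x \<in> S\<close>]
          Ck_on_Suc_deriv[OF Suc.prems(2) \<open>x \<in> S\<close>])
  next
    fix v
    have "Ck_on k f S" "Ck_on k g S"
      using Suc.prems Ck_on_SucD by blast+
    then show "Ck_on k (\<lambda>x. B (f x) (fderiv g x v) + B (fderiv f x v) (g x)) S"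
      using Suc.prems by (intro Ck_on_add[OF assms(1)] Suc.IH) auto
  qed
qed

lemma linear_eq_sum_Basis:
  fixes f :: "'a::euclidean_space \<Rightarrow> 'b::real_vector"
  assumes "linear f"
  shows "f v = (\<Sum>b\<in>Basis. (v \<bullet> b) *\<^sub>R f b)"
proof -
  have "f v = f (\<Sum>b\<in>Basis. (v \<bullet> b) *\<^sub>R b)"
    by (simp add: euclidean_representation)
  then show ?thesis
    by (simp add: linear_sum[OF assms] linear_scale[OF assms])
qed

text \<open>In the derivative \<open>f' (g x) (g' x v)\<close> both the base point and the direction
  vary with x. Expanding the direction in \<open>Basis\<close> leaves products of a coefficient of
  \<open>g'\<close> with \<open>f' (g x) b\<close> for fixed b, which is again a composition to
  which the induction applies.\<close>

lemma Ck_on_compose: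
  fixes g :: "'a::euclidean_space \<Rightarrow> 'c::euclidean_space"
  assumes S: "open S" and gS: "g ` S \<subseteq> T" and g: "Ck_on k g S" and f: "Ck_on k f T"
  shows "Ck_on k (\<lambda>x. f (g x)) S"
  using g f
proof (induction k arbitrary: f)
  case 0
  then show ?case
    using gS by (simp, metis continuous_on_compose2)
next
  case (Suc k)
  let ?g' = "\<lambda>x. fderiv g x" and ?f' = "\<lambda>y. fderiv f y"
  note fd = Ck_on_Suc_deriv[OF Suc.prems(2)]
  show ?case
  proof (rule Ck_on_SucI[OF S])
    fix x assume x: "x \<in> S"
    then have "g x \<in> T"
      using gS by blast
    have "((\<lambda>x. f (g x)) has_derivative (\<lambda>v. ?f' (g x) (?g' x v))) (at x)"
      using diff_chain_at[OF Ck_on_Suc_deriv[OF Suc.prems(1) x] fd[OF \<open>g x \<in> T\<close>]]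
      by (simp add: comp_def)
    also have "(\<lambda>v. ?f' (g x) (?g' x v)) = (\<lambda>v. \<Sum>b\<in>Basis. (?g' x v \<bullet> b) *\<^sub>R ?f' (g x) b)"
      using linear_eq_sum_Basis[OF has_derivative_linear[OF fd[OF \<open>g x \<in> T\<close>]]] by blast
    finally show "((\<lambda>x. f (g x)) has_derivative
        (\<lambda>v. \<Sum>b\<in>Basis. (?g' x v \<bullet> b) *\<^sub>R ?f' (g x) b)) (at x)" .
  next
    fix v
    have "Ck_on k (\<lambda>x. (?g' x v \<bullet> b) *\<^sub>R ?f' (g x) b) S" for b
    proof (rule Ck_on_bilinear[OF S bounded_bilinear_scaleR])
      show "Ck_on k (\<lambda>x. ?g' x v \<bullet> b) S"
        using Suc.prems(1) by (intro Ck_on_bounded_linear_compose[OF S bounded_linear_inner_left]) auto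
      show "Ck_on k (\<lambda>x. ?f' (g x) b) S"
        using Suc.prems(2) Ck_on_SucD[OF Suc.prems(1)] by (intro Suc.IH) auto
    qed
    then show "Ck_on k (\<lambda>x. \<Sum>b\<in>Basis. (?g' x v \<bullet> b) *\<^sub>R ?f' (g x) b) S"
      by (rule Ck_on_sum[OF S])
  qed
qed

lemma smooth_on_subset: "smooth_on f S \<Longrightarrow> T \<subseteq> S \<Longrightarrow> smooth_on f T"
  unfolding smooth_on_def using Ck_on_subset by blast

lemma smooth_on_cong: "open S \<Longrightarrow> (\<And>x. x \<in> S \<Longrightarrow> f x = g x) \<Longrightarrow> smooth_on f S \<Longrightarrow> smooth_on g S"
  unfolding smooth_on_def using Ck_on_cong by blast

lemma smooth_on_local:
  "(\<And>x. x \<in> S \<Longrightarrow> \<exists>V. open V \<and> x \<in> V \<and> smooth_on f V) \<Longrightarrow> smooth_on f S"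
  unfolding smooth_on_def by (meson Ck_on_local)

lemma smooth_on_const [simp]: "smooth_on (\<lambda>x. c) S"
  by (simp add: smooth_on_def)

lemma smooth_on_bounded_linear: "bounded_linear f \<Longrightarrow> smooth_on f S"
  by (simp add: smooth_on_def Ck_on_bounded_linear)

lemma smooth_on_bounded_linear_compose:
  "open S \<Longrightarrow> bounded_linear L \<Longrightarrow> smooth_on f S \<Longrightarrow> smooth_on (\<lambda>x. L (f x)) S"
  by (simp add: smooth_on_def Ck_on_bounded_linear_compose)

lemma smooth_on_add:
  "open S \<Longrightarrow> smooth_on f S \<Longrightarrow> smooth_on g S \<Longrightarrow> smooth_on (\<lambda>x. f x + g x) S"
  by (simp add: smooth_on_def Ck_on_add)

lemma smooth_on_diff:
  "open S \<Longrightarrow> smooth_on f S \<Longrightarrow> smooth_on g S \<Longrightarrow> smooth_on (\<lambda>x. f x - g x) S"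
  using smooth_on_add[of S f "\<lambda>x. - g x"]
    smooth_on_bounded_linear_compose[of S uminus g] bounded_linear_minus[OF bounded_linear_ident]
  by auto

lemma smooth_on_sum:
  "open S \<Longrightarrow> (\<And>i. i \<in> I \<Longrightarrow> smooth_on (f i) S) \<Longrightarrow> smooth_on (\<lambda>x. \<Sum>i\<in>I. f i x) S"
  by (simp add: smooth_on_def Ck_on_sum)

lemma smooth_on_bilinear:
  "open S \<Longrightarrow> bounded_bilinear B \<Longrightarrow> smooth_on f S \<Longrightarrow> smooth_on g S \<Longrightarrow>
   smooth_on (\<lambda>x. B (f x) (g x)) S"
  by (simp add: smooth_on_def Ck_on_bilinear)

lemmas smooth_on_scaleR = smooth_on_bilinear[OF _ bounded_bilinear_scaleR]

lemma smooth_on_compose: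
  fixes g :: "'a::euclidean_space \<Rightarrow> 'c::euclidean_space"
  shows "open S \<Longrightarrow> g ` S \<subseteq> T \<Longrightarrow> smooth_on g S \<Longrightarrow> smooth_on f T \<Longrightarrow> smooth_on (\<lambda>x. f (g x)) S"
  unfolding smooth_on_def using Ck_on_compose by blast

lemma smooth_onD:
  "smooth_on f S \<Longrightarrow> x \<in> S \<Longrightarrow> (f has_derivative fderiv f x) (at x)"
  unfolding smooth_on_def using Ck_on_Suc_deriv by blast

lemma smooth_on_continuous_on: "smooth_on f S \<Longrightarrow> continuous_on S f"
  unfolding smooth_on_def using Ck_on_imp_continuous_on by blast

lemma smooth_on_fderiv:
  "smooth_on f S \<Longrightarrow> smooth_on (\<lambda>x. fderiv f x v) S"
  unfolding smooth_on_def using Ck_on.simps(2) by blast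

text \<open>The hypothesis on \<open>d\<close> speaks of a fixed vector only. Expanding
  \<open>V y\<close> in \<open>Basis\<close> reduces the moving vector to finitely many fixed ones
  with differentiable coefficients; since \<open>L x\<close> is linear for x in \<open>U\<close>
  only, the expansion is used on a neighbourhood of z.\<close>

lemma has_derivative_linear_family:
  fixes P :: "'a::real_normed_vector \<Rightarrow> 'c::real_normed_vector" and V :: "'a \<Rightarrow> 'v::euclidean_space"
    and L :: "'c \<Rightarrow> 'v \<Rightarrow> 'b::real_normed_vector"
  assumes U: "open U" "P z \<in> U" and P: "(P has_derivative P') (at z)" and V: "(V has_derivative V') (at z)"
    and lin: "\<And>x. x \<in> U \<Longrightarrow> linear (L x)" and d: "\<And>v. ((\<lambda>x. L x v) has_derivative d v) (at (P z))"
  shows "((\<lambda>y. L (P y) (V y)) has_derivative (\<lambda>\<zeta>. d (V z) (P' \<zeta>) + L (P z) (V' \<zeta>))) (at z)"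
proof -
  obtain O' where O': "open O'" "z \<in> O'" "\<And>y. y \<in> O' \<Longrightarrow> P y \<in> U"
    using has_derivative_continuous[OF P] U by (metis continuous_at_open)
  have "((\<lambda>x. \<Sum>b\<in>Basis. (V z \<bullet> b) *\<^sub>R L x b) has_derivative (\<lambda>u. \<Sum>b\<in>Basis. (V z \<bullet> b) *\<^sub>R d b u)) (at (P z))"
    by (intro has_derivative_sum has_derivative_scaleR_right d)
  then have "((\<lambda>x. L x (V z)) has_derivative (\<lambda>u. \<Sum>b\<in>Basis. (V z \<bullet> b) *\<^sub>R d b u)) (at (P z))"
    by (rule has_derivative_transform_within_open[OF _ U]) (use linear_eq_sum_Basis[OF lin] in metis)
  then have eq: "d (V z) = (\<lambda>u. \<Sum>b\<in>Basis. (V z \<bullet> b) *\<^sub>R d b u)"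
    using has_derivative_unique[OF d] by blast
  have "((\<lambda>y. L (P y) b) has_derivative (\<lambda>\<zeta>. d b (P' \<zeta>))) (at z)" for b
    using diff_chain_at[OF P d] by (simp add: comp_def)
  then have "((\<lambda>y. \<Sum>b\<in>Basis. (V y \<bullet> b) *\<^sub>R L (P y) b) has_derivative
    (\<lambda>\<zeta>. \<Sum>b\<in>Basis. (V z \<bullet> b) *\<^sub>R d b (P' \<zeta>) + (V' \<zeta> \<bullet> b) *\<^sub>R L (P z) b)) (at z)"
    by (intro has_derivative_sum has_derivative_scaleR has_derivative_inner_left V)
  also have "(\<lambda>\<zeta>. \<Sum>b\<in>Basis. (V z \<bullet> b) *\<^sub>R d b (P' \<zeta>) + (V' \<zeta> \<bullet> b) *\<^sub>R L (P z) b)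
    = (\<lambda>\<zeta>. d (V z) (P' \<zeta>) + L (P z) (V' \<zeta>))"
    by (simp add: eq sum.distrib linear_eq_sum_Basis[OF lin[OF U(2)], symmetric])
  finally show ?thesis
    by (rule has_derivative_transform_within_open[OF _ O'(1,2)])
      (use linear_eq_sum_Basis[OF lin[OF O'(3)]] in metis)
qed

text \<open>This differentiates images of invariant fields, where base point and vector both depend
  on the group element: moving the point costs a second derivative, moving the vector a first
  one.\<close>

lemma has_derivative_derivative_field:
  fixes h :: "'a::euclidean_space \<Rightarrow> 'b::real_normed_vector"
  assumes h: "open U" "smooth_on h U" and P: "(P has_derivative P') (at z)" "P z \<in> U"
    and V: "(V has_derivative V') (at z)"
  shows "((\<lambda>y. fderiv h (P y) (V y)) has_derivative
    (\<lambda>\<zeta>. fderiv (\<lambda>x. fderiv h x (V z)) (P z) (P' \<zeta>)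
       + fderiv h (P z) (V' \<zeta>))) (at z)"
  by (rule has_derivative_linear_family[OF h(1) P(2,1) V])
    (use smooth_onD[OF h(2)] has_derivative_linear
      smooth_onD[OF smooth_on_fderiv[OF h(2)] P(2)] in blast)+

lemma smooth_on_cos_sin: "smooth_on (cos :: real \<Rightarrow> real) UNIV" "smooth_on (sin :: real \<Rightarrow> real) UNIV"
proof -
  have "Ck_on k (cos :: real \<Rightarrow> real) UNIV \<and> Ck_on k (sin :: real \<Rightarrow> real) UNIV" for k
  proof (induction k)
    case 0
    then show ?case
      by (auto intro!: continuous_intros)
  next
    case (Suc k)
    have "Ck_on (Suc k) (cos :: real \<Rightarrow> real) UNIV"
    proof (rule Ck_on_SucI[OF open_UNIV])
      show "(cos has_derivative (\<lambda>v. v * - sin x)) (at x)" for x :: real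
        by (auto intro!: derivative_eq_intros)
      show "Ck_on k (\<lambda>x. v * - sin x) (UNIV :: real set)" for v
        using Suc by (intro Ck_on_bounded_linear_compose[where L = "\<lambda>y. v * - y"])
          (auto intro: bounded_linear_minus[OF bounded_linear_mult_right, of v])
    qed
    moreover have "Ck_on (Suc k) (sin :: real \<Rightarrow> real) UNIV"
    proof (rule Ck_on_SucI[OF open_UNIV])
      show "(sin has_derivative (\<lambda>v. v * cos x)) (at x)" for x :: real
        by (auto intro!: derivative_eq_intros)
      show "Ck_on k (\<lambda>x. v * cos x) (UNIV :: real set)" for v
        using Suc by (intro Ck_on_bounded_linear_compose[where L = "\<lambda>y. v * y"])
          (auto intro: bounded_linear_mult_right)
    qed
    ultimately show ?case ..
  qed
  then show "smooth_on (cos :: real \<Rightarrow> real) UNIV" "smooth_on (sin :: real \<Rightarrow> real) UNIV"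
    by (auto simp: smooth_on_def)
qed

text \<open>Continuity of g is enough because f vanishes at x: the error splits into
  \<open>(f y - f' (y - x)) *\<^sub>R g y\<close> and
  \<open>f' (y - x) *\<^sub>R (g y - g x)\<close>, and both are of smaller order than
  \<open>norm (y - x)\<close>.\<close>

lemma has_derivative_scaleR_zero:
  fixes f :: "'a::real_normed_vector \<Rightarrow> real" and g :: "'a \<Rightarrow> 'b::real_normed_vector"
  assumes f: "(f has_derivative f') (at x)" and "f x = 0" and g: "isCont g x"
  shows "((\<lambda>y. f y *\<^sub>R g y) has_derivative (\<lambda>v. f' v *\<^sub>R g x)) (at x)"
proof -
  interpret f': bounded_linear f'
    using f has_derivative_bounded_linear by blast
  have "((\<lambda>y. ((f y - f x - f' (y - x)) / norm (y - x)) *\<^sub>R g y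
          + (f' (y - x) / norm (y - x)) *\<^sub>R (g y - g x)) \<longlongrightarrow> 0 *\<^sub>R g x + 0) (at x)"
  proof (intro tendsto_add tendsto_scaleR)
    show "((\<lambda>y. (f y - f x - f' (y - x)) / norm (y - x)) \<longlongrightarrow> 0) (at x)"
      using f unfolding has_derivative_at_within by (simp add: divide_inverse_commute diff_diff_eq)
    show "(g \<longlongrightarrow> g x) (at x)"
      using g by (simp add: isCont_def)
    obtain K where K: "\<And>v. norm (f' v) \<le> norm v * K" "K > 0"
      using f'.pos_bounded by blast
    have "norm ((f' (y - x) / norm (y - x)) *\<^sub>R (g y - g x)) \<le> K * norm (g y - g x)" for y
    proof (cases "y = x")
      case False
      then have "\<bar>f' (y - x) / norm (y - x)\<bar> \<le> K"
        using K(1)[of "y - x"] by (simp add: divide_le_eq mult.commute)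
      then show ?thesis
        by (simp only: norm_scaleR) (intro mult_right_mono, auto)
    qed simp
    moreover have "((\<lambda>y. K * norm (g y - g x)) \<longlongrightarrow> 0) (at x)"
      using g unfolding isCont_def by (auto intro!: tendsto_eq_intros)
    ultimately show "((\<lambda>y. (f' (y - x) / norm (y - x)) *\<^sub>R (g y - g x)) \<longlongrightarrow> 0) (at x)"
      by (rule Lim_null_comparison[OF always_eventually, OF allI])
  qed
  moreover have "((f y - f x - f' (y - x)) / norm (y - x)) *\<^sub>R g y
          + (f' (y - x) / norm (y - x)) *\<^sub>R (g y - g x)
      = (1 / norm (y - x)) *\<^sub>R (f y *\<^sub>R g y - (f x *\<^sub>R g x + f' (y - x) *\<^sub>R g x))" for y
    using \<open>f x = 0\<close> by (simp add: divide_inverse_commute scaleR_diff_left scaleR_diff_right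
        right_diff_distrib scaleR_add_right)
  ultimately show ?thesis
    unfolding has_derivative_at_within
    using \<open>f x = 0\<close> bounded_linear_compose[OF bounded_linear_scaleR_left f'.bounded_linear_axioms]
    by (simp add: divide_inverse_commute diff_diff_eq)
qed

text \<open>Differentiability is reduced to continuity by the identity
  \<open>N x v = y\<^sub>0 + N x (M x\<^sub>0 y\<^sub>0 - M x y\<^sub>0)\<close> with \<open>y\<^sub>0 = N x\<^sub>0 v\<close>, whose second summand is a continuous factor times
  a differentiable one that vanishes at \<open>x\<^sub>0\<close>.\<close>

context
  fixes M N :: "'a::euclidean_space \<Rightarrow> 'e::euclidean_space \<Rightarrow> 'e" and S :: "'a set"
  assumes S: "open S"
    and lin: "\<And>x. x \<in> S \<Longrightarrow> linear (M x)"
    and NM: "\<And>x v. x \<in> S \<Longrightarrow> N x (M x v) = v"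
    and MN: "\<And>x v. x \<in> S \<Longrightarrow> M x (N x v) = v"
begin

lemma linear_inverse_family: "x \<in> S \<Longrightarrow> linear (N x)"
proof (rule linearI)
  assume x: "x \<in> S"
  show "N x (v + w) = N x v + N x w" for v w
    using NM[OF x, of "N x v + N x w"] by (simp add: linear_add[OF lin[OF x]] MN[OF x])
  show "N x (c *\<^sub>R v) = c *\<^sub>R N x v" for c v
    using NM[OF x, of "c *\<^sub>R N x v"] by (simp add: linear_scale[OF lin[OF x]] MN[OF x])
qed

lemma inverse_family_perturb:
  assumes "x0 \<in> S" "x \<in> S"
  shows "N x v = N x0 v + (\<Sum>b\<in>Basis. ((M x0 (N x0 v) - M x (N x0 v)) \<bullet> b) *\<^sub>R N x b)"
proof -
  have "(\<Sum>b\<in>Basis. ((M x0 (N x0 v) - M x (N x0 v)) \<bullet> b) *\<^sub>R N x b) = N x (M x0 (N x0 v) - M x (N x0 v))"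
    using linear_eq_sum_Basis[OF linear_inverse_family[OF assms(2)]] by metis
  also have "\<dots> = N x v - N x0 v"
    using assms by (simp add: MN NM linear_diff[OF linear_inverse_family])
  finally show ?thesis
    by simp
qed

text \<open>If c bounds \<open>N x0\<close> and \<open>M x\<close> is within 1/(2c) of
  \<open>M x0\<close> in operator norm, then \<open>norm w \<le> 2 * c * norm (M x w)\<close>. For
  \<open>w = N x v - N x0 v\<close> the right side tends to zero by continuity of M alone.\<close>

lemma continuous_inverse_family:
  assumes cont: "\<And>w. continuous_on S (\<lambda>x. M x w)"
  shows "continuous_on S (\<lambda>x. N x v)"
proof -
  have "isCont (\<lambda>x. N x v) x0" if x0: "x0 \<in> S" for x0
  proof -
    have isC: "isCont (\<lambda>x. M x w) x0" for w
      using cont S x0 continuous_on_eq_continuous_at by blast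
    have "bounded_linear (N x0)"
      by (intro linear_conv_bounded_linear[THEN iffD1] linear_inverse_family x0)
    then obtain c where c: "c > 0" "\<And>w. norm (N x0 w) \<le> norm w * c"
      using bounded_linear.pos_bounded by blast
    \<comment> \<open>\<open>E x\<close> dominates the operator norm of \<open>M x0 - M x\<close>; a
      finite sum over \<open>Basis\<close> turns pointwise continuity into a uniform bound.\<close>
    define E where "E x = (\<Sum>b\<in>Basis. norm (M x0 b - M x b))" for x
    have "(E \<longlongrightarrow> (\<Sum>b\<in>(Basis::'e set). norm (M x0 b - M x0 b))) (at x0)"
      unfolding E_def using isC unfolding isCont_def by (intro tendsto_intros) auto
    then have "(E \<longlongrightarrow> 0) (at x0)"
      by simp
    then have "eventually (\<lambda>x. E x < 1 / (2 * c)) (at x0)"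
      using c(1) by (intro order_tendstoD) auto
    moreover have "eventually (\<lambda>x. x \<in> S) (at x0)"
      using S x0 eventually_at_topological by blast
    ultimately have ev: "eventually (\<lambda>x. norm (N x v - N x0 v) \<le> 2 * c * norm (M x0 (N x0 v) - M x (N x0 v))) (at x0)"
    proof eventually_elim
      case (elim x)
      have bound: "norm w \<le> 2 * c * norm (M x w)" for w
      proof -
        have "norm (M x0 w - M x w) = norm (\<Sum>b\<in>Basis. (w \<bullet> b) *\<^sub>R (M x0 b - M x b))"
          using linear_eq_sum_Basis[OF lin[OF x0], of w] linear_eq_sum_Basis[OF lin[OF elim(2)], of w]
          by (simp add: sum_subtractf algebra_simps)
        also have "\<dots> \<le> (\<Sum>b\<in>Basis. norm w * norm (M x0 b - M x b))"
          by (intro order.trans[OF norm_sum] sum_mono)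
            (auto intro!: mult_right_mono simp: Basis_le_norm)
        also have "\<dots> = norm w * E x"
          by (simp add: E_def sum_distrib_left)
        finally have *: "norm (M x0 w - M x w) \<le> norm w * E x" .
        have "norm w \<le> norm (M x0 w) * c"
          using c(2)[of "M x0 w"] NM[OF x0] by simp
        also have "\<dots> \<le> (norm (M x w) + norm w * E x) * c"
          using * norm_triangle_sub[of "M x0 w" "M x w"] c(1)
          by (intro mult_right_mono) auto
        also have "\<dots> \<le> (norm (M x w) + norm w * (1 / (2 * c))) * c"
          using elim(1) c(1) by (intro mult_right_mono add_left_mono mult_left_mono) auto
        also have "\<dots> = norm (M x w) * c + norm w / 2"
          using c(1) by (simp add: field_simps)
        finally show ?thesis
          by (simp add: mult.commute mult.left_commute)
      qed
      have "M x (N x v - N x0 v) = M x0 (N x0 v) - M x (N x0 v)"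
        using elim(2) x0 by (simp add: MN linear_diff[OF lin])
      with bound[of "N x v - N x0 v"] show ?case
        by simp
    qed
    have "((\<lambda>x. 2 * c * norm (M x0 (N x0 v) - M x (N x0 v))) \<longlongrightarrow> 2 * c * norm (M x0 (N x0 v) - M x0 (N x0 v))) (at x0)"
      using isC unfolding isCont_def by (intro tendsto_intros)
    then have "((\<lambda>x. N x v - N x0 v) \<longlongrightarrow> 0) (at x0)"
      by (intro Lim_null_comparison[OF ev]) simp
    then show ?thesis
      by (simp add: isCont_def LIM_zero_iff)
  qed
  then show ?thesis
    by (simp add: continuous_at_imp_continuous_on)
qed

lemma smooth_on_inverse_family:
  assumes smooth: "\<And>w. smooth_on (\<lambda>x. M x w) S"
  shows "smooth_on (\<lambda>x. N x v) S"
proof -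
  let ?M' = "\<lambda>w x. fderiv (\<lambda>x. M x w) x"
  have cont: "continuous_on S (\<lambda>x. N x v)" for v
    using continuous_inverse_family smooth smooth_on_continuous_on by blast
  \<comment> \<open>The derivative \<open>- N M' N\<close> of an inverse, written out in
    \<open>Basis\<close>. It is built from values of N and derivatives of M, so each order of
    smoothness of N yields the next.\<close>
  define D where "D v x u = (\<Sum>b\<in>Basis. \<Sum>c\<in>Basis. (- ((N x v \<bullet> c) *\<^sub>R ?M' c x u) \<bullet> b) *\<^sub>R N x b)" for v x u
  have der: "((\<lambda>x. N x v) has_derivative D v x0) (at x0)" if x0: "x0 \<in> S" for v x0
  proof -
    define y0 where "y0 = N x0 v"
    have My: "((\<lambda>x. M x y0) has_derivative (\<lambda>u. \<Sum>c\<in>Basis. (y0 \<bullet> c) *\<^sub>R ?M' c x0 u)) (at x0)"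
    proof (rule has_derivative_transform_within_open[OF _ S x0])
      show "((\<lambda>x. \<Sum>c\<in>Basis. (y0 \<bullet> c) *\<^sub>R M x c) has_derivative (\<lambda>u. \<Sum>c\<in>Basis. (y0 \<bullet> c) *\<^sub>R ?M' c x0 u)) (at x0)"
        by (intro has_derivative_sum has_derivative_scaleR_right smooth_onD[OF smooth x0])
    qed (metis lin linear_eq_sum_Basis)
    have "((\<lambda>x. N x0 v + (\<Sum>b\<in>Basis. ((M x0 y0 - M x y0) \<bullet> b) *\<^sub>R N x b)) has_derivative
       (\<lambda>u. 0 + (\<Sum>b\<in>Basis. ((0 - (\<Sum>c\<in>Basis. (y0 \<bullet> c) *\<^sub>R ?M' c x0 u)) \<bullet> b) *\<^sub>R N x0 b))) (at x0)"
      using cont S x0 My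
      by (intro has_derivative_add has_derivative_sum has_derivative_const has_derivative_scaleR_zero
          has_derivative_inner_left has_derivative_diff)
        (auto simp: continuous_on_eq_continuous_at)
    also have "(\<lambda>u. 0 + (\<Sum>b\<in>Basis. ((0 - (\<Sum>c\<in>Basis. (y0 \<bullet> c) *\<^sub>R ?M' c x0 u)) \<bullet> b) *\<^sub>R N x0 b)) = D v x0"
      unfolding D_def y0_def by (simp add: scaleR_sum_left inner_sum_left sum_negf)
    finally show ?thesis
      by (rule has_derivative_transform_within_open[OF _ S x0])
        (use inverse_family_perturb[OF x0, of _ v] in \<open>simp add: y0_def\<close>)
  qed
  have "Ck_on k (\<lambda>x. N x v) S" for k v
  proof (induction k arbitrary: v)
    case 0
    then show ?case
      using cont by simp
  next
    case (Suc k)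
    show ?case
    proof (rule Ck_on_SucI[OF S der])
      have "Ck_on k (\<lambda>x. ?M' c x u) S" for c u
        using smooth_on_fderiv[OF smooth] by (simp add: smooth_on_def)
      then show "Ck_on k (\<lambda>x. D v x u) S" for u
        unfolding D_def
        by (intro Ck_on_sum[OF S] Ck_on_bilinear[OF S bounded_bilinear_scaleR] Suc
            Ck_on_bounded_linear_compose[OF S bounded_linear_inner_left]
            Ck_on_bounded_linear_compose[OF S bounded_linear_minus[OF bounded_linear_ident]])
    qed
  qed
  then show ?thesis
    by (simp add: smooth_on_def)
qed

end

text \<open>The classical theorem provides a differentiable inverse with
  \<open>g' y = inv (D (g y))\<close>. The rest is a bootstrap: \<open>inv (D x)\<close> depends
  smoothly on x, so if g is of order k, then so is \<open>g'\<close>, and g is of order k +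
  1.\<close>

theorem smooth_inverse_function:
  fixes f :: "'e::euclidean_space \<Rightarrow> 'e"
  assumes "open U" "smooth_on f U" "x0 \<in> U" "(f has_derivative f') (at x0)" "inj f'"
  obtains U' V g where "open U'" "U' \<subseteq> U" "x0 \<in> U'" "open V" "f x0 \<in> V" "homeomorphism U' V f g"
    "smooth_on g V"
proof -
  define D where "D x = Blinfun (fderiv f x)" for x
  have D: "blinfun_apply (D x) = fderiv f x" if "x \<in> U" for x
    unfolding D_def using has_derivative_bounded_linear[OF smooth_onD[OF assms(2) that]]
    by (rule bounded_linear_Blinfun_apply)
  have fD: "(f has_derivative blinfun_apply (D x)) (at x)" if "x \<in> U" for x
    using smooth_onD[OF assms(2) that] D that by simp
  have contD: "continuous_on U D"
  proof (rule continuous_on_blinfun_componentwise)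
    fix i :: 'e
    have "continuous_on U (\<lambda>x. fderiv f x i)"
      using assms(2) smooth_on_continuous_on smooth_on_fderiv by blast
    then show "continuous_on U (\<lambda>x. blinfun_apply (D x) i)"
      by (rule continuous_on_eq) (simp add: D)
  qed
  have f': "f' = blinfun_apply (D x0)"
    using fD[OF assms(3)] assms(4) has_derivative_unique by blast
  have lin: "linear f'"
    using assms(4) has_derivative_linear by blast
  obtain h where h: "linear h" "h \<circ> f' = id"
    using linear_injective_left_inverse[OF lin assms(5)] by blast
  then have "Blinfun h o\<^sub>L D x0 = id_blinfun"
    by (intro blinfun_eqI)
      (simp add: bounded_linear_Blinfun_apply linear_conv_bounded_linear[symmetric] f' pointfree_idE)
  from inverse_function_theorem[OF assms(1) fD contD assms(3) this]
  obtain U' V g g' where UV: "open U'" "U' \<subseteq> U" "x0 \<in> U'" "open V" "f x0 \<in> V" "homeomorphism U' V f g"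
    and g: "\<And>y. y \<in> V \<Longrightarrow> (g has_derivative g' y) (at y)"
      "\<And>y. y \<in> V \<Longrightarrow> g' y = inv (blinfun_apply (D (g y)))"
      "\<And>y. y \<in> V \<Longrightarrow> bij (blinfun_apply (D (g y)))"
    by metis
  have gV: "g ` V = U'"
    using UV(6) by (simp add: homeomorphism_def)
  have smU': "Ck_on k (\<lambda>x. inv (blinfun_apply (D x)) v) U'" for k v
  proof -
    have bij: "bij (blinfun_apply (D x))" if "x \<in> U'" for x
      using g(3) gV that by blast
    have "smooth_on (\<lambda>x. blinfun_apply (D x) w) U'" for w
      by (rule smooth_on_cong[OF UV(1) _ smooth_on_subset[OF smooth_on_fderiv[OF assms(2)] UV(2)]])
        (use D UV(2) in auto)
    moreover have "linear (blinfun_apply (D x))" for x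
      by (simp add: blinfun.bounded_linear_right bounded_linear.linear)
    moreover have "inv (blinfun_apply (D x)) (blinfun_apply (D x) w) = w"
      "blinfun_apply (D x) (inv (blinfun_apply (D x)) w) = w" if "x \<in> U'" for x w
      using inv_f_f[OF bij_is_inj[OF bij[OF that]]] surj_f_inv_f[OF bij_is_surj[OF bij[OF that]]] by auto
    ultimately have "smooth_on (\<lambda>x. inv (blinfun_apply (D x)) v) U'"
      using smooth_on_inverse_family[OF UV(1), of "\<lambda>x. blinfun_apply (D x)" "\<lambda>x. inv (blinfun_apply (D x))"]
      by blast
    then show ?thesis
      by (simp add: smooth_on_def)
  qed
  have "Ck_on k g V" for k
  proof (induction k)
    case 0
    then show ?case
      using UV(6) by (simp add: homeomorphism_def)
  next
    case (Suc k)
    show ?case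
    proof (rule Ck_on_SucI[OF UV(4) g(1)])
      fix v
      show "Ck_on k (\<lambda>y. g' y v) V"
        by (rule Ck_on_cong[OF UV(4) _ Ck_on_compose[OF UV(4) _ Suc smU']]) (use g(2) gV in auto)
    qed
  qed
  then show thesis
    using that[OF UV] by (simp add: smooth_on_def)
qed

text \<open>Both mixed derivatives are the limit of the second difference quotient
  \<open>(f(x + hu + hv) - f(x + hu) - f(x + hv) + f x) / h\<^sup>2\<close>.\<close>

lemma second_difference_quotient:
  fixes f :: "'a::euclidean_space \<Rightarrow> real"
  assumes "open S" "x \<in> S" and f: "\<And>y. y \<in> S \<Longrightarrow> (f has_derivative f' y) (at y)"
    and f'': "((\<lambda>y. f' y u) has_derivative d) (at x)"
  shows "((\<lambda>h. (f (x + h *\<^sub>R u + h *\<^sub>R v) - f (x + h *\<^sub>R u) - f (x + h *\<^sub>R v) + f x) / h\<^sup>2) \<longlongrightarrow> d v) (at_right 0)"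
proof -
  interpret d: bounded_linear d
    using f'' has_derivative_bounded_linear by blast
  obtain r where r: "r > 0" "ball x r \<subseteq> S"
    using assms(1,2) open_contains_ball by blast
  define K where "K = 1 + norm u + norm v"
  have K: "K > 0" "norm u \<le> K" "norm v \<le> K" "norm u + norm v \<le> K"
    by (auto simp: K_def add_pos_nonneg)
  show ?thesis
  proof (rule tendstoI)
    fix e :: real assume "e > 0"
    \<comment> \<open>Two remainders, each at most \<open>e' * (h * K)\<close>, are divided by h
      below; the factor 4 leaves \<open>e / 2\<close>.\<close>
    define e' where "e' = e / (4 * K)"
    have "e' > 0"
      using \<open>e > 0\<close> K by (simp add: e'_def)
    then obtain \<delta> where \<delta>: "\<delta> > 0"
      "\<And>y. norm (y - x) < \<delta> \<Longrightarrow> norm (f' y u - f' x u - d (y - x)) \<le> e' * norm (y - x)"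
      using f'' unfolding has_derivative_at_alt by metis
    define h0 where "h0 = min r \<delta> / K"
    have "h0 > 0"
      using r \<delta> K by (simp add: h0_def)
    have "dist ((f (x + h *\<^sub>R u + h *\<^sub>R v) - f (x + h *\<^sub>R u) - f (x + h *\<^sub>R v) + f x) / h\<^sup>2) (d v) < e"
      if h: "0 < h" "h < h0" for h
    proof -
      have hK: "h * K < min r \<delta>"
        using h K by (simp add: h0_def field_simps)
      have nb: "norm (t *\<^sub>R u + s *\<^sub>R v) \<le> h * K" if "0 \<le> t" "t \<le> h" "0 \<le> s" "s \<le> h" for t s
      proof -
        have "norm (t *\<^sub>R u + s *\<^sub>R v) \<le> t * norm u + s * norm v"
          using norm_triangle_ineq[of "t *\<^sub>R u" "s *\<^sub>R v"] that by simp
        also have "\<dots> \<le> h * norm u + h * norm v"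
          using that by (intro add_mono mult_right_mono) auto
        also have "\<dots> \<le> h * K"
          using K h by (simp add: distrib_left[symmetric])
        finally show ?thesis .
      qed
      have inS: "x + t *\<^sub>R u + s *\<^sub>R v \<in> S" if "0 \<le> t" "t \<le> h" "0 \<le> s" "s \<le> h" for t s
        using nb[OF that] hK r by (auto simp: dist_norm add.assoc subset_iff norm_minus_commute)
      \<comment> \<open>The mean value theorem is applied once, in direction u, to the increment of
        f in direction v; what remains uses differentiability of \<open>f' y u\<close> at the single
        point x.\<close>
      define \<psi> where "\<psi> t = f (x + t *\<^sub>R u + h *\<^sub>R v) - f (x + t *\<^sub>R u)" for t
      have der: "(\<psi> has_real_derivative f' (x + t *\<^sub>R u + h *\<^sub>R v) u - f' (x + t *\<^sub>R u) u) (at t)"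
        if t: "0 \<le> t" "t \<le> h" for t
      proof -
        have "((\<lambda>t. f (x + t *\<^sub>R u + s *\<^sub>R v)) has_derivative (\<lambda>k. f' (x + t *\<^sub>R u + s *\<^sub>R v) (k *\<^sub>R u))) (at t)"
          if "0 \<le> s" "s \<le> h" for s
          by (rule has_derivative_compose[where g = f and f = "\<lambda>t. x + t *\<^sub>R u + s *\<^sub>R v", OF _ f[OF inS[OF t that]]])
            (auto intro!: derivative_eq_intros)
        from this[of h] this[of 0] h
        have "(\<psi> has_derivative (\<lambda>k. f' (x + t *\<^sub>R u + h *\<^sub>R v) (k *\<^sub>R u) - f' (x + t *\<^sub>R u) (k *\<^sub>R u))) (at t)"
          unfolding \<psi>_def by (intro has_derivative_diff) auto
        moreover have "linear (f' (x + t *\<^sub>R u + h *\<^sub>R v))" "linear (f' (x + t *\<^sub>R u))"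
          using f[OF inS[OF t, of h]] f[OF inS[OF t, of 0]] h has_derivative_linear by auto
        moreover from this have "f' (x + t *\<^sub>R u + h *\<^sub>R v) (k *\<^sub>R u) - f' (x + t *\<^sub>R u) (k *\<^sub>R u)
            = (f' (x + t *\<^sub>R u + h *\<^sub>R v) u - f' (x + t *\<^sub>R u) u) * k" for k
          by (simp add: linear_scale right_diff_distrib mult.commute)
        ultimately show ?thesis
          by (simp add: has_field_derivative_def)
      qed
      obtain t where t: "0 < t" "t < h" "\<psi> h - \<psi> 0 = (h - 0) * (f' (x + t *\<^sub>R u + h *\<^sub>R v) u - f' (x + t *\<^sub>R u) u)"
        using MVT2[OF h(1), of \<psi> "\<lambda>t. f' (x + t *\<^sub>R u + h *\<^sub>R v) u - f' (x + t *\<^sub>R u) u"] der by blast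
      let ?R = "\<lambda>y. f' y u - f' x u - d (y - x)"
      have R: "\<bar>?R (x + t *\<^sub>R u + s *\<^sub>R v)\<bar> \<le> e' * (h * K)" if "0 \<le> s" "s \<le> h" for s
      proof -
        have n: "norm ((x + t *\<^sub>R u + s *\<^sub>R v) - x) \<le> h * K"
          using nb[of t s] t that by (simp add: add.assoc)
        then show ?thesis
          using \<delta>(2)[of "x + t *\<^sub>R u + s *\<^sub>R v"] hK mult_left_mono[OF n, of e'] \<open>e' > 0\<close> n
          unfolding real_norm_def by linarith
      qed
      have "f' (x + t *\<^sub>R u + h *\<^sub>R v) u - f' (x + t *\<^sub>R u) u
          = h * d v + (?R (x + t *\<^sub>R u + h *\<^sub>R v) - ?R (x + t *\<^sub>R u))"
        by (simp add: d.add d.scaleR add.assoc)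
      then have "\<psi> h - \<psi> 0 = h * (h * d v + (?R (x + t *\<^sub>R u + h *\<^sub>R v) - ?R (x + t *\<^sub>R u)))"
        using t(3) by simp
      moreover have "p / h\<^sup>2 - q = r / h" if "p = h * (h * q + r)" for p q r :: real
        using h that by (simp add: power2_eq_square field_simps)
      ultimately have "(\<psi> h - \<psi> 0) / h\<^sup>2 - d v = (?R (x + t *\<^sub>R u + h *\<^sub>R v) - ?R (x + t *\<^sub>R u)) / h"
        by blast
      also have "\<bar>\<dots>\<bar> \<le> (2 * (e' * (h * K))) / h"
        using R[of h] R[of 0] h by (simp only: abs_divide, intro divide_mono) auto
      also have "\<dots> = e / 2"
        using h K by (simp add: e'_def)
      also have "\<dots> < e"
        using \<open>e > 0\<close> by simp
      finally show ?thesis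
        by (simp add: \<psi>_def dist_real_def algebra_simps)
    qed
    then show "\<forall>\<^sub>F h in at_right 0. dist ((f (x + h *\<^sub>R u + h *\<^sub>R v) - f (x + h *\<^sub>R u) - f (x + h *\<^sub>R v) + f x) / h\<^sup>2) (d v) < e"
      using \<open>h0 > 0\<close> by (auto simp: eventually_at_right)
  qed
qed

lemma symmetric_second_derivative:
  fixes f :: "'a::euclidean_space \<Rightarrow> 'b::euclidean_space"
  assumes "open S" "smooth_on f S" "x \<in> S"
  shows "fderiv (\<lambda>y. fderiv f y u) x v =
         fderiv (\<lambda>y. fderiv f y v) x u"
proof (rule euclidean_eqI)
  fix b :: 'b
  let ?f' = "\<lambda>y. fderiv f y"
  have 1: "((\<lambda>y. f y \<bullet> b) has_derivative (\<lambda>v. ?f' y v \<bullet> b)) (at y)" if "y \<in> S" for y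
    by (intro has_derivative_inner_left smooth_onD[OF assms(2) that])
  have 2: "((\<lambda>y. ?f' y u \<bullet> b) has_derivative (\<lambda>v. fderiv (\<lambda>y. ?f' y u) x v \<bullet> b)) (at x)" for u
    by (intro has_derivative_inner_left smooth_onD[OF _ assms(3)]
        smooth_on_fderiv assms(2))
  define Q where "Q u v h = (f (x + h *\<^sub>R u + h *\<^sub>R v) \<bullet> b - f (x + h *\<^sub>R u) \<bullet> b - f (x + h *\<^sub>R v) \<bullet> b + f x \<bullet> b) / h\<^sup>2"
    for u v h
  have lim: "(Q u v \<longlongrightarrow> fderiv (\<lambda>y. ?f' y u) x v \<bullet> b) (at_right 0)" for u v
    unfolding Q_def using second_difference_quotient[OF assms(1,3) 1 2, of u v] by simp
  have "Q u v = Q v u"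
    by (simp add: Q_def fun_eq_iff algebra_simps)
  with lim[of u v] lim[of v u]
  show "fderiv (\<lambda>y. ?f' y u) x v \<bullet> b = fderiv (\<lambda>y. ?f' y v) x u \<bullet> b"
    by (metis tendsto_unique trivial_limit_at_right_real)
qed

section \<open>Inner products and orthonormal bases\<close>

lemma inner_productD:
  assumes "inner_product \<beta>"
  shows "\<beta> (u + v) w = \<beta> u w + \<beta> v w" "\<beta> u (v + w) = \<beta> u v + \<beta> u w"
    "\<beta> (c *\<^sub>R u) w = c * \<beta> u w" "\<beta> u (c *\<^sub>R w) = c * \<beta> u w"
    "\<beta> (u - v) w = \<beta> u w - \<beta> v w" "\<beta> u (v - w) = \<beta> u v - \<beta> u w"
    "\<beta> 0 w = 0" "\<beta> u 0 = 0"
    "\<beta> (sum f I) w = (\<Sum>i\<in>I. \<beta> (f i) w)" "\<beta> u (sum f I) = (\<Sum>i\<in>I. \<beta> u (f i))"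
proof -
  have 1: "linear (\<lambda>x. \<beta> x w)" and 2: "linear (\<beta> u)" for u w
    using assms by (auto simp: inner_product_def bilinear_def)
  show "\<beta> (u + v) w = \<beta> u w + \<beta> v w" "\<beta> u (v + w) = \<beta> u v + \<beta> u w"
    "\<beta> (c *\<^sub>R u) w = c * \<beta> u w" "\<beta> u (c *\<^sub>R w) = c * \<beta> u w"
    "\<beta> (u - v) w = \<beta> u w - \<beta> v w" "\<beta> u (v - w) = \<beta> u v - \<beta> u w"
    "\<beta> 0 w = 0" "\<beta> u 0 = 0"
    "\<beta> (sum f I) w = (\<Sum>i\<in>I. \<beta> (f i) w)" "\<beta> u (sum f I) = (\<Sum>i\<in>I. \<beta> u (f i))"
    using linear_add[OF 1, of u v w] linear_add[OF 2, of u v w] linear_scale[OF 1, of c u w]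
      linear_scale[OF 2, of u c w] linear_diff[OF 1, of u v w] linear_diff[OF 2, of u v w]
      linear_0[OF 1, of w] linear_0[OF 2, of u] linear_sum[OF 1, of f I w] linear_sum[OF 2, of u f I]
    by simp_all
qed

lemma inner_product_commute: "inner_product \<beta> \<Longrightarrow> \<beta> v w = \<beta> w v"
  by (auto simp: inner_product_def)

lemma inner_product_eq_0_iff: "inner_product \<beta> \<Longrightarrow> \<beta> v v = 0 \<longleftrightarrow> v = 0"
  by (metis inner_productD(7) inner_product_def order_less_irrefl)

lemma inner_product_eqI:
  assumes "inner_product \<beta>" "\<And>w. \<beta> u w = \<beta> v w"
  shows "u = v"
  using inner_product_eq_0_iff[OF assms(1), of "u - v"] assms(2)
  by (simp add: inner_productD(5)[OF assms(1)])

text \<open>The map T represents \<open>\<beta>\<close> through the Euclidean inner product;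
  positive definiteness makes it injective, hence bijective. This gives meaning to the definite
  descriptions in \<open>gradient\<close> and \<open>christoffel\<close>.\<close>

lemma inner_product_riesz:
  fixes \<beta> :: "'e::euclidean_space \<Rightarrow> 'e \<Rightarrow> real"
  assumes \<beta>: "inner_product \<beta>" and l: "linear l"
  shows "\<exists>!\<gamma>. \<forall>w. \<beta> \<gamma> w = l w"
proof -
  define T where "T v = (\<Sum>b\<in>Basis. \<beta> v b *\<^sub>R b)" for v
  have "linear T"
    by (rule linearI) (simp_all add: T_def inner_productD[OF \<beta>] algebra_simps sum.distrib scaleR_sum_right)
  moreover have Tb: "T v \<bullet> b = \<beta> v b" if "b \<in> Basis" for v b
    using that by (simp add: T_def)
  have lin\<beta>: "linear (\<beta> v)" for v
    using \<beta> by (auto simp: inner_product_def bilinear_def)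
  have "v = 0" if "T v = 0" for v
  proof -
    have "\<beta> v b = 0" if "b \<in> Basis" for b
      using Tb[OF that, of v] \<open>T v = 0\<close> by simp
    then have "\<beta> v v = 0"
      using linear_eq_sum_Basis[OF lin\<beta>, of v v] by simp
    then show ?thesis
      by (simp add: inner_product_eq_0_iff[OF \<beta>])
  qed
  with \<open>linear T\<close> have "surj T"
    by (intro linear_injective_imp_surjective) (simp_all add: linear_injective_0)
  then obtain \<gamma> where \<gamma>: "T \<gamma> = (\<Sum>b\<in>Basis. l b *\<^sub>R b)"
    by (metis surjD)
  have "\<beta> \<gamma> b = l b" if "b \<in> Basis" for b
    using Tb[OF that, of \<gamma>] that by (simp add: \<gamma>)
  then have "\<forall>w. \<beta> \<gamma> w = l w"
    using linear_eq_sum_Basis[OF lin\<beta>, of \<gamma>] linear_eq_sum_Basis[OF l] by (metis (no_types, lifting) sum.cong)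
  then show ?thesis
    using inner_product_eqI[OF \<beta>] by (intro ex1I[of _ \<gamma>]) auto
qed

lemma orthonormal_basis_expand_wrt:
  assumes "inner_product \<beta>" "orthonormal_basis_of \<beta> W B" "v \<in> W"
  shows "v = (\<Sum>e\<in>B. \<beta> v e *\<^sub>R e)"
proof -
  have B: "finite B" "span B = W" "\<And>b b'. b \<in> B \<Longrightarrow> b' \<in> B \<Longrightarrow> \<beta> b b' = (if b = b' then 1 else 0)"
    using assms(2) by (auto simp: orthonormal_basis_of_def)
  note [simp] = inner_productD[OF assms(1)]
  have "v \<in> span B"
    using assms(3) B by simp
  then show ?thesis
  proof (induction rule: span_induct)
    case base
    have "(\<Sum>e\<in>B. (c * \<beta> x e) *\<^sub>R e) = c *\<^sub>R (\<Sum>e\<in>B. \<beta> x e *\<^sub>R e)" for c x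
      by (simp add: scaleR_sum_right)
    then show ?case
      by (intro subspaceI) (auto simp: scaleR_add_left sum.distrib)
  next
    case (step x)
    have "(\<Sum>e\<in>B. \<beta> x e *\<^sub>R e) = (\<Sum>e\<in>B. if x = e then e else 0)"
      using B(3) step by (intro sum.cong) auto
    then show ?case
      using step B(1) by simp
  qed
qed

lemma orthonormal_basis_parseval:
  assumes "inner_product \<beta>" "orthonormal_basis_of \<beta> W B" "v \<in> W"
  shows "\<beta> v w = (\<Sum>e\<in>B. \<beta> v e * \<beta> w e)"
proof -
  have "\<beta> v w = \<beta> (\<Sum>e\<in>B. \<beta> v e *\<^sub>R e) w"
    using orthonormal_basis_expand_wrt[OF assms] by simp
  also have "\<dots> = (\<Sum>e\<in>B. \<beta> v e * \<beta> e w)"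
    by (simp add: inner_productD[OF assms(1)])
  finally show ?thesis
    using inner_product_commute[OF assms(1), of _ w] by simp
qed

text \<open>Gram-Schmidt as an induction on the dimension: a normalized vector e is added to a basis
  of its \<open>\<beta>\<close>-complement inside W.\<close>

lemma orthonormal_basis_exists:
  fixes \<beta> :: "'e::euclidean_space \<Rightarrow> 'e \<Rightarrow> real"
  assumes \<beta>: "inner_product \<beta>" and "subspace W"
  shows "\<exists>B. orthonormal_basis_of \<beta> W B"
  using assms(2)
proof (induction "dim W" arbitrary: W rule: less_induct)
  case less
  note [simp] = inner_productD[OF \<beta>]
  show ?case
  proof (cases "W = {0}")
    case True
    then show ?thesis
      by (intro exI[of _ "{}"]) (simp add: orthonormal_basis_of_def)
  next
    case False
    then obtain w where w: "w \<in> W" "w \<noteq> 0"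
      using subspace_0[OF less.prems] by blast
    then have pos: "\<beta> w w > 0"
      using \<beta> by (simp add: inner_product_def)
    define e where "e = (1 / sqrt (\<beta> w w)) *\<^sub>R w"
    have e: "e \<in> W" "\<beta> e e = 1"
      using w less.prems pos by (simp_all add: e_def subspace_scale)
    define W' where "W' = {v\<in>W. \<beta> v e = 0}"
    have sub: "subspace W'"
      using less.prems by (auto simp: W'_def subspace_def)
    moreover have "W' \<subset> W"
    proof -
      have "e \<notin> W'"
        by (simp add: W'_def e)
      with e(1) show ?thesis
        by (auto simp: W'_def)
    qed
    ultimately have "dim W' < dim W"
      by (metis dim_psubset less.prems span_eq_iff)
    then obtain B where B: "orthonormal_basis_of \<beta> W' B"
      using less.hyps sub by blast
    then have B': "finite B" "B \<subseteq> W'" "span B = W'" "\<And>b b'. b \<in> B \<Longrightarrow> b' \<in> B \<Longrightarrow> \<beta> b b' = (if b = b' then 1 else 0)"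
      by (auto simp: orthonormal_basis_of_def)
    have "W \<subseteq> span (insert e B)"
    proof
      fix v assume "v \<in> W"
      then have "v - \<beta> v e *\<^sub>R e \<in> span B"
        using e less.prems by (simp add: B' W'_def subspace_diff subspace_scale)
      then show "v \<in> span (insert e B)"
        using span_breakdown_eq by blast
    qed
    moreover have "span (insert e B) \<subseteq> W"
      using e B' less.prems by (intro span_minimal) (auto simp: W'_def)
    moreover have "\<beta> e b = 0" "\<beta> b e = 0" "e \<noteq> b" if "b \<in> B" for b
      using that B'(2) e inner_product_commute[OF \<beta>, of e b] by (auto simp: W'_def)
    ultimately have "orthonormal_basis_of \<beta> W (insert e B)"
      using e B' unfolding orthonormal_basis_of_def W'_def by auto
    then show ?thesis
      by blast
  qed
qed

text \<open>\<open>divergence\<close> uses the Euclidean \<open>Basis\<close>, whereas the metric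
  provides bases that are orthonormal for \<open>\<beta>\<close>. Expanding \<open>T b\<close> in
  the latter and exchanging the sums passes from one trace to the other.\<close>

lemma trace_orthonormal_basis:
  fixes T :: "'e::euclidean_space \<Rightarrow> 'e"
  assumes \<beta>: "inner_product \<beta>" and B: "orthonormal_basis_of \<beta> UNIV B" and T: "linear T"
  shows "(\<Sum>b\<in>Basis. T b \<bullet> b) = (\<Sum>e\<in>B. \<beta> (T e) e)"
proof -
  have "(\<Sum>b\<in>Basis. T b \<bullet> b) = (\<Sum>b\<in>Basis. (\<Sum>e\<in>B. \<beta> (T b) e *\<^sub>R e) \<bullet> b)"
    using orthonormal_basis_expand_wrt[OF \<beta> B] by simp
  also have "\<dots> = (\<Sum>e\<in>B. \<Sum>b\<in>Basis. (e \<bullet> b) * \<beta> (T b) e)"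
    by (subst sum.swap) (simp add: inner_sum_left mult.commute)
  also have "\<dots> = (\<Sum>e\<in>B. \<beta> (\<Sum>b\<in>Basis. (e \<bullet> b) *\<^sub>R T b) e)"
    by (simp add: inner_productD[OF \<beta>])
  also have "\<dots> = (\<Sum>e\<in>B. \<beta> (T e) e)"
    using linear_eq_sum_Basis[OF T] by metis
  finally show ?thesis .
qed

text \<open>Subtracting the \<open>\<beta>\<close>-orthonormal expansion along W leaves the witness.
  Two candidates differ by a vector of W orthogonal to W, so the description in
  \<open>normal_part\<close> is unique.\<close>

lemma normal_part:
  fixes \<beta> :: "'e::euclidean_space \<Rightarrow> 'e \<Rightarrow> real"
  assumes \<beta>: "inner_product \<beta>" and W: "subspace W"
  shows "\<forall>w\<in>W. \<beta> (normal_part \<beta> W \<xi>) w = 0" "\<xi> - normal_part \<beta> W \<xi> \<in> W"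
proof -
  obtain B where B: "orthonormal_basis_of \<beta> W B"
    using orthonormal_basis_exists[OF \<beta> W] by blast
  then have BW: "B \<subseteq> W"
    by (simp add: orthonormal_basis_of_def)
  define \<nu> where "\<nu> = \<xi> - (\<Sum>e\<in>B. \<beta> \<xi> e *\<^sub>R e)"
  have "(\<forall>w\<in>W. \<beta> (normal_part \<beta> W \<xi>) w = 0) \<and> \<xi> - normal_part \<beta> W \<xi> \<in> W"
    unfolding normal_part_def
  proof (rule theI[of _ \<nu>])
    have "\<beta> \<nu> w = 0" if "w \<in> W" for w
    proof -
      have "\<beta> \<xi> w = (\<Sum>e\<in>B. \<beta> \<xi> e * \<beta> w e)"
        using orthonormal_basis_parseval[OF \<beta> B that, of \<xi>] inner_product_commute[OF \<beta>, of w \<xi>]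
        by (simp add: mult.commute)
      then show ?thesis
        using inner_product_commute[OF \<beta>, of _ w] by (simp add: \<nu>_def inner_productD[OF \<beta>])
    qed
    moreover have "\<xi> - \<nu> \<in> W"
      using BW W by (auto simp: \<nu>_def intro!: subspace_sum subspace_scale)
    ultimately show \<nu>: "(\<forall>w\<in>W. \<beta> \<nu> w = 0) \<and> \<xi> - \<nu> \<in> W"
      by blast
    fix \<nu>' assume \<nu>': "(\<forall>w\<in>W. \<beta> \<nu>' w = 0) \<and> \<xi> - \<nu>' \<in> W"
    have "\<nu>' - \<nu> \<in> W"
      using subspace_diff[OF W, of "\<xi> - \<nu>" "\<xi> - \<nu>'"] \<nu> \<nu>' by simp
    then have "\<beta> (\<nu>' - \<nu>) (\<nu>' - \<nu>) = 0"
      using \<nu> \<nu>' by (simp add: inner_productD(5)[OF \<beta>])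
    then show "\<nu>' = \<nu>"
      by (simp add: inner_product_eq_0_iff[OF \<beta>])
  qed
  then show "\<forall>w\<in>W. \<beta> (normal_part \<beta> W \<xi>) w = 0" "\<xi> - normal_part \<beta> W \<xi> \<in> W"
    by blast+
qed

lemma derivative_vanishes_along_curve:
  assumes "(f has_derivative f') (at (k 0))" "(k has_vector_derivative v) (at 0)"
    and "\<forall>\<^sub>F t in at 0. f (k t) = f (k (0::real))"
  shows "f' v = 0"
proof -
  have "((\<lambda>t. f (k t)) has_derivative (\<lambda>t. f' (t *\<^sub>R v))) (at 0)"
    using has_derivative_compose[of k "\<lambda>t. t *\<^sub>R v" 0 UNIV f f'] assms(1,2)
    by (simp add: has_vector_derivative_def)
  moreover have "((\<lambda>t. f (k t)) has_derivative (\<lambda>t. 0)) (at 0)"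
    by (rule has_derivative_transform_eventually[OF has_derivative_const[of "f (k 0)"]])
      (use assms(3) in \<open>auto simp: eq_commute\<close>)
  ultimately have "(\<lambda>t. f' (t *\<^sub>R v)) = (\<lambda>t. 0)"
    by (rule has_derivative_unique)
  then show ?thesis
    by (metis scaleR_one)
qed


lemma derivative_vanishes_along_subspace:
  assumes "open U" "subspace W" "(f has_derivative f') (at y)" "y \<in> U \<inter> W" "v \<in> W"
    and f: "\<And>y. y \<in> U \<inter> W \<Longrightarrow> f y = c"
  shows "f' v = 0"
proof (rule derivative_vanishes_along_curve[of f f' "\<lambda>t. y + t *\<^sub>R v"])
  have "((\<lambda>t. y + t *\<^sub>R v) \<longlongrightarrow> y + 0 *\<^sub>R v) (at 0)"
    by (intro tendsto_intros)
  then have "\<forall>\<^sub>F t in at 0. y + t *\<^sub>R v \<in> U"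
    using assms(1,4) by (auto dest: topological_tendstoD)
  then show "\<forall>\<^sub>F t in at 0. f (y + t *\<^sub>R v) = f (y + 0 *\<^sub>R v)"
  proof eventually_elim
    case (elim t)
    then have "y + t *\<^sub>R v \<in> U \<inter> W"
      using assms by (auto intro!: subspace_add subspace_scale)
    then show ?case
      using assms(4) by (simp add: f)
  qed
qed (use assms in \<open>auto intro!: derivative_eq_intros\<close>)

section \<open>The Levi-Civita connection in a chart\<close>

text \<open>The covariant derivative of dh. Values in an arbitrary normed space allow a complex
  function to be treated as a whole, with its two real defining equations kept together.\<close>

definition hessian ::
    "('e::euclidean_space \<Rightarrow> 'e \<Rightarrow> 'e \<Rightarrow> real) \<Rightarrow> ('e \<Rightarrow> 'b::real_normed_vector) \<Rightarrow> 'e \<Rightarrow> 'e \<Rightarrow> 'e \<Rightarrow> 'b" where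
  "hessian G h x u w = fderiv (\<lambda>y. fderiv h y w) x u
     - fderiv h x (christoffel G x u w)"

locale chart_metric =
  fixes G :: "'e::euclidean_space \<Rightarrow> 'e \<Rightarrow> 'e \<Rightarrow> real" and U :: "'e set"
  assumes open_U: "open U"
    and ip: "x \<in> U \<Longrightarrow> inner_product (G x)"
    and smooth_G: "smooth_on (\<lambda>x. G x v w) U"
begin

abbreviation dG :: "'e \<Rightarrow> 'e \<Rightarrow> 'e \<Rightarrow> 'e \<Rightarrow> real" where
  "dG x u v w \<equiv> fderiv (\<lambda>y. G y v w) x u"

lemma dG: "x \<in> U \<Longrightarrow> ((\<lambda>y. G y v w) has_derivative (\<lambda>u. dG x u v w)) (at x)"
  using smooth_onD[OF smooth_G] .

text \<open>Algebraic laws of \<open>G y\<close> hold for y in U only; as U is open, they pass to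
  the derivative at a point of U.\<close>

lemma dG_unique:
  assumes "x \<in> U" "\<And>y. y \<in> U \<Longrightarrow> G y v w = f y" "(f has_derivative f') (at x)"
  shows "dG x u v w = f' u"
proof -
  have "((\<lambda>y. G y v w) has_derivative f') (at x)"
    by (rule has_derivative_transform_within_open[OF assms(3) open_U assms(1)]) (simp add: assms(2))
  then show ?thesis
    by (simp add: fderiv_eq)
qed

lemma dG_commute: "x \<in> U \<Longrightarrow> dG x u v w = dG x u w v"
  by (rule dG_unique[OF _ _ dG]) (auto simp: inner_product_commute[OF ip])

lemma linear_dG:
  assumes "x \<in> U"
  shows "linear (\<lambda>u. dG x u v w)" "linear (\<lambda>v. dG x u v w)" "linear (\<lambda>w. dG x u v w)"
proof -
  show "linear (\<lambda>u. dG x u v w)"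
    using dG[OF assms] has_derivative_linear by blast
  show lin: "linear (\<lambda>w. dG x u v w)" for v
  proof (rule linearI)
    show "dG x u v (w + w') = dG x u v w + dG x u v w'" for w w'
      by (rule dG_unique[OF assms _ has_derivative_add[OF dG dG]]) (simp_all add: assms inner_productD[OF ip])
    show "dG x u v (c *\<^sub>R w) = c *\<^sub>R dG x u v w" for c w
      by (rule dG_unique[OF assms _ has_derivative_scaleR_right[OF dG]]) (simp_all add: assms inner_productD[OF ip])
  qed
  have "(\<lambda>v. dG x u v w) = (\<lambda>v. dG x u w v)"
    using dG_commute[OF assms] by blast
  then show "linear (\<lambda>v. dG x u v w)"
    using lin[of w] by simp
qed

lemma dG_simps:
  assumes "x \<in> U"
  shows "dG x (u + u') v w = dG x u v w + dG x u' v w" "dG x u (v + v') w = dG x u v w + dG x u v' w"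
    "dG x u v (w + w') = dG x u v w + dG x u v w'" "dG x (c *\<^sub>R u) v w = c * dG x u v w"
    "dG x u (c *\<^sub>R v) w = c * dG x u v w" "dG x u v (c *\<^sub>R w) = c * dG x u v w"
  using linear_add[OF linear_dG(1)[OF assms]] linear_add[OF linear_dG(2)[OF assms]]
    linear_add[OF linear_dG(3)[OF assms]] linear_scale[OF linear_dG(1)[OF assms]]
    linear_scale[OF linear_dG(2)[OF assms]] linear_scale[OF linear_dG(3)[OF assms]]
  by auto

text \<open>The point and both vectors move: the rule for families of linear maps is applied once in
  each vector slot.\<close>

lemma has_derivative_metric:
  assumes P: "(P has_derivative P') (at z)" and "P z \<in> U"
    and V: "(V has_derivative V') (at z)" and W: "(W has_derivative W') (at z)"
  shows "((\<lambda>z. G (P z) (V z) (W z)) has_derivative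
    (\<lambda>\<zeta>. dG (P z) (P' \<zeta>) (V z) (W z) + G (P z) (V z) (W' \<zeta>) + G (P z) (V' \<zeta>) (W z))) (at z)"
proof -
  obtain O' where O': "open O'" "z \<in> O'" "\<And>y. y \<in> O' \<Longrightarrow> P y \<in> U"
    using has_derivative_continuous[OF P] \<open>P z \<in> U\<close> open_U by (metis continuous_at_open)
  have lin: "linear (G x v)" "linear (\<lambda>v. G x v w)" if "x \<in> U" for x v w
    using ip[OF that] by (auto simp: inner_product_def bilinear_def)
  have "((\<lambda>y. G (P y) v (W y)) has_derivative (\<lambda>\<zeta>. dG (P z) (P' \<zeta>) v (W z) + G (P z) v (W' \<zeta>))) (at z)" for v
    by (rule has_derivative_linear_family[OF open_U \<open>P z \<in> U\<close> P W lin(1) dG[OF \<open>P z \<in> U\<close>]])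
  from has_derivative_linear_family[OF O'(1,2) has_derivative_ident V lin(2)[OF O'(3)] this]
  show ?thesis .
qed

lemma christoffel:
  assumes "x \<in> U"
  shows "2 * G x (christoffel G x u v) w = dG x u v w + dG x v u w - dG x w u v"
proof -
  have "linear (\<lambda>w. (dG x u v w + dG x v u w - dG x w u v) / 2)"
    by (intro linearI) (simp_all add: dG_simps[OF assms] field_simps)
  from inner_product_riesz[OF ip[OF assms] this]
  have "\<exists>!\<gamma>. \<forall>w. 2 * G x \<gamma> w = dG x u v w + dG x v u w - dG x w u v"
    by (simp add: field_simps)
  from theI'[OF this] show ?thesis
    unfolding christoffel_def by blast
qed

text \<open>In the sum of the Koszul identities for (u, v, w) and (u, w, v) the derivatives in
  directions v and w cancel by symmetry, and \<open>2 * dG x u v w\<close> remains.\<close>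

lemma metric_compatible:
  assumes "x \<in> U"
  shows "dG x u v w = G x (christoffel G x u v) w + G x v (christoffel G x u w)"
  using christoffel[OF assms, of u v w] christoffel[OF assms, of u w v]
    inner_product_commute[OF ip[OF assms], of v "christoffel G x u w"]
    dG_commute[OF assms, where u = u and v = v and w = w] dG_commute[OF assms, where u = v and v = u and w = w]
    dG_commute[OF assms, where u = w and v = u and w = v]
  by linarith

lemma christoffel_eqI:
  assumes "x \<in> U" "\<And>w. 2 * G x \<gamma> w = dG x u v w + dG x v u w - dG x w u v"
  shows "christoffel G x u v = \<gamma>"
  using christoffel[OF assms(1)] assms(2) by (intro inner_product_eqI[OF ip[OF assms(1)]]) (metis mult_cancel_left zero_neq_numeral)

lemma linear_christoffel:
  assumes "x \<in> U"
  shows "linear (\<lambda>u. christoffel G x u v)" "linear (\<lambda>v. christoffel G x u v)"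
proof -
  show lin: "linear (\<lambda>v. christoffel G x u v)" for u
  proof (rule linearI; rule christoffel_eqI[OF assms])
    fix v v' w c
    show "2 * G x (christoffel G x u v + christoffel G x u v') w
        = dG x u (v + v') w + dG x (v + v') u w - dG x w u (v + v')"
      by (simp add: inner_productD[OF ip[OF assms]] christoffel[OF assms] distrib_left dG_simps[OF assms])
    have "2 * (c * G x (christoffel G x u v) w) = c * (2 * G x (christoffel G x u v) w)"
      by simp
    also have "\<dots> = dG x u (c *\<^sub>R v) w + dG x (c *\<^sub>R v) u w - dG x w u (c *\<^sub>R v)"
      unfolding christoffel[OF assms] by (simp add: dG_simps[OF assms] algebra_simps)
    finally show "2 * G x (c *\<^sub>R christoffel G x u v) w
        = dG x u (c *\<^sub>R v) w + dG x (c *\<^sub>R v) u w - dG x w u (c *\<^sub>R v)"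
      by (simp add: inner_productD[OF ip[OF assms]])
  qed
  have "christoffel G x u v = christoffel G x v u" for u
    by (rule christoffel_eqI[OF assms]) (simp add: christoffel[OF assms] dG_commute[OF assms, where v = v and w = u])
  then show "linear (\<lambda>u. christoffel G x u v)"
    using lin[of v] by simp
qed

lemma gradient:
  assumes "x \<in> U" "f differentiable at x"
  shows "G x (gradient G f x) w = fderiv f x w"
  using theI'[OF inner_product_riesz[OF ip[OF assms(1)] linear_frechet_derivative[OF assms(2)]]]
  unfolding gradient_def by blast

text \<open>The Gram operator \<open>M x\<close> sends a vector to its inner products with
  \<open>Basis\<close>. The gradient is \<open>inv (M x)\<close> applied to the coefficients of df,
  and inverses of smooth families of linear maps are smooth.\<close>

lemma smooth_on_gradient:
  assumes f: "smooth_on f U"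
  shows "smooth_on (gradient G f) U"
proof -
  define M where "M x v = (\<Sum>b\<in>Basis. G x v b *\<^sub>R b)" for x v
  have lin: "linear (M x)" if "x \<in> U" for x
    by (rule linearI) (simp_all add: M_def inner_productD[OF ip[OF that]] algebra_simps sum.distrib scaleR_sum_right)
  have eqI: "u = v" if "x \<in> U" "M x u = M x v" for x u v
  proof (rule inner_product_eqI[OF ip[OF that(1)]])
    fix w
    have "G x u b = G x v b" if "b \<in> Basis" for b
      using arg_cong[OF \<open>M x u = M x v\<close>, of "\<lambda>y. y \<bullet> b"] that by (simp add: M_def)
    moreover have "linear (G x u)" "linear (G x v)"
      using ip[OF that(1)] by (auto simp: inner_product_def bilinear_def)
    ultimately show "G x u w = G x v w"
      by (simp add: linear_eq_sum_Basis[of "G x u" w] linear_eq_sum_Basis[of "G x v" w])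
  qed
  then have inj: "inj (M x)" if "x \<in> U" for x
    using that by (auto simp: inj_on_def)
  then have surj: "surj (M x)" if "x \<in> U" for x
    using that lin linear_injective_imp_surjective by blast
  have smM: "smooth_on (\<lambda>x. M x w) U" for w
    unfolding M_def using bounded_linear_scaleR_left
    by (intro smooth_on_sum[OF open_U] smooth_on_bounded_linear_compose[OF open_U _ smooth_G])
  have N: "smooth_on (\<lambda>x. inv (M x) b) U" for b
    using smooth_on_inverse_family[OF open_U lin inv_f_f[OF inj] surj_f_inv_f[OF surj] smM] .
  show ?thesis
  proof (rule smooth_on_cong[OF open_U])
    show "smooth_on (\<lambda>x. \<Sum>b\<in>Basis. fderiv f x b *\<^sub>R inv (M x) b) U"
      by (intro smooth_on_sum[OF open_U] smooth_on_scaleR[OF open_U] smooth_on_fderiv[OF f] N)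
    fix x assume x: "x \<in> U"
    have linN: "linear (inv (M x))"
      using linear_inverse_family[OF open_U lin inv_f_f[OF inj] surj_f_inv_f[OF surj] x] .
    have "f differentiable at x"
      using smooth_onD[OF f x] differentiable_def by blast
    then have "M x (gradient G f x) = (\<Sum>b\<in>Basis. fderiv f x b *\<^sub>R b)"
      by (simp add: M_def gradient[OF x])
    then have "gradient G f x = inv (M x) (\<Sum>b\<in>Basis. fderiv f x b *\<^sub>R b)"
      using inv_f_f[OF inj[OF x]] by metis
    then show "(\<Sum>b\<in>Basis. fderiv f x b *\<^sub>R inv (M x) b) = gradient G f x"
      by (simp add: linear_sum[OF linN] linear_scale[OF linN])
  qed
qed

text \<open>Differentiating \<open>G y (gradient G f y) w = fderiv f y w\<close> for constant w and
  inserting metric compatibility shows that the covariant derivative of the gradient is dual to the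
  Hessian; the divergence is its trace.\<close>

lemma divergence_gradient:
  assumes f: "smooth_on f U" and x: "x \<in> U" and E: "orthonormal_basis_of (G x) UNIV E"
  shows "divergence G (gradient G f) x = (\<Sum>e\<in>E. hessian G f x e e)"
proof -
  let ?X = "gradient G f" and ?f' = "\<lambda>y. fderiv f y"
  have X: "(?X has_derivative fderiv ?X x) (at x)"
    using smooth_onD[OF smooth_on_gradient[OF f] x] .
  have grad: "G y (?X y) w = ?f' y w" if "y \<in> U" for y w
    using gradient[OF that] smooth_onD[OF f that] differentiable_def by blast
  have cov: "G x (covariant_derivative G ?X x u) w = hessian G f x u w" for u w
  proof -
    have 1: "((\<lambda>y. G y (?X y) w) has_derivative
        (\<lambda>u. dG x u (?X x) w + G x (?X x) 0 + G x (fderiv ?X x u) w)) (at x)"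
      by (rule has_derivative_metric) (auto simp: x X)
    have 2: "((\<lambda>y. G y (?X y) w) has_derivative fderiv (\<lambda>y. ?f' y w) x) (at x)"
      by (rule has_derivative_transform_within_open[OF _ open_U x])
        (use smooth_onD[OF smooth_on_fderiv[OF f] x] grad in auto)
    have "fderiv (\<lambda>y. ?f' y w) x u
        = dG x u (?X x) w + G x (fderiv ?X x u) w"
      using fun_cong[OF has_derivative_unique[OF 2 1], of u] by (simp add: inner_productD(8)[OF ip[OF x]])
    then show ?thesis
      by (simp add: hessian_def covariant_derivative_def inner_productD[OF ip[OF x]]
          metric_compatible[OF x] grad[OF x])
  qed
  have "linear (covariant_derivative G ?X x)"
    unfolding covariant_derivative_def
    using linear_compose_add[OF has_derivative_linear[OF X] linear_christoffel(1)[OF x]] by blast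
  then show ?thesis
    unfolding divergence_def by (simp add: trace_orthonormal_basis[OF ip[OF x] E] cov)
qed

lemma hessian_bounded_linear:
  assumes L: "bounded_linear L" and h: "smooth_on h U" and x: "x \<in> U"
  shows "hessian G (L \<circ> h) x u w = L (hessian G h x u w)"
proof -
  have d: "fderiv (L \<circ> h) y w = L (fderiv h y w)" if "y \<in> U" for y w
    using bounded_linear.has_derivative[OF L smooth_onD[OF h that]]
    by (simp add: fderiv_eq comp_def)
  have "((\<lambda>y. L (fderiv h y w)) has_derivative
      (\<lambda>u. L (fderiv (\<lambda>y. fderiv h y w) x u))) (at x)"
    by (rule bounded_linear.has_derivative[OF L smooth_onD[OF smooth_on_fderiv[OF h] x]])
  then have "((\<lambda>y. fderiv (L \<circ> h) y w) has_derivative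
      (\<lambda>u. L (fderiv (\<lambda>y. fderiv h y w) x u))) (at x)"
    by (rule has_derivative_transform_within_open[OF _ open_U x]) (simp add: d)
  then show ?thesis
    by (simp add: hessian_def fderiv_eq d[OF x] linear_diff[OF bounded_linear.linear[OF L]])
qed

lemma laplace_beltrami_eq_trace_hessian:
  assumes h: "smooth_on h U" and x: "x \<in> U" and E: "orthonormal_basis_of (G x) UNIV E"
  shows "laplace_beltrami G h x = (\<Sum>e\<in>E. hessian G h x e e)"
proof -
  have "smooth_on (Re \<circ> h) U" "smooth_on (Im \<circ> h) U"
    using smooth_on_bounded_linear_compose[OF open_U bounded_linear_Re h]
      smooth_on_bounded_linear_compose[OF open_U bounded_linear_Im h] by (simp_all add: comp_def)
  then show ?thesis
    by (simp add: laplace_beltrami_def divergence_gradient[OF _ x E] complex_eq_iff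
        hessian_bounded_linear[OF bounded_linear_Re h x] hessian_bounded_linear[OF bounded_linear_Im h x])
qed

text \<open>Parseval turns the four real products in \<open>kappa\<close> into sums over E. Their
  combination is the square of the complex number \<open>fderiv h x e\<close>, as the bilinear
  extension involves no conjugation.\<close>

lemma kappa_eq_sum:
  assumes h: "smooth_on h U" and x: "x \<in> U" and E: "orthonormal_basis_of (G x) UNIV E"
  shows "kappa G h h x = (\<Sum>e\<in>E. (fderiv h x e)\<^sup>2)"
proof -
  let ?h' = "fderiv h x"
  have hd: "(h has_derivative ?h') (at x)"
    by (rule smooth_onD[OF h x])
  have Re: "((Re \<circ> h) has_derivative (\<lambda>w. Re (?h' w))) (at x)" and Im: "((Im \<circ> h) has_derivative (\<lambda>w. Im (?h' w))) (at x)"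
    using bounded_linear.has_derivative[OF bounded_linear_Re hd] bounded_linear.has_derivative[OF bounded_linear_Im hd]
    by (simp_all add: comp_def)
  have grad: "G x (gradient G (Re \<circ> h) x) w = Re (?h' w)" "G x (gradient G (Im \<circ> h) x) w = Im (?h' w)" for w
    using gradient[OF x differentiableI[OF Re]] gradient[OF x differentiableI[OF Im]]
    by (simp_all add: fderiv_eq[OF Re] fderiv_eq[OF Im])
  have pars: "G x v w = (\<Sum>e\<in>E. G x v e * G x w e)" for v w
    by (rule orthonormal_basis_parseval[OF ip[OF x] E]) simp
  have "G x (gradient G (Re \<circ> h) x) (gradient G (Re \<circ> h) x) = (\<Sum>e\<in>E. Re (?h' e) * Re (?h' e))"
    "G x (gradient G (Im \<circ> h) x) (gradient G (Im \<circ> h) x) = (\<Sum>e\<in>E. Im (?h' e) * Im (?h' e))"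
    "G x (gradient G (Re \<circ> h) x) (gradient G (Im \<circ> h) x) = (\<Sum>e\<in>E. Re (?h' e) * Im (?h' e))"
    "G x (gradient G (Im \<circ> h) x) (gradient G (Re \<circ> h) x) = (\<Sum>e\<in>E. Im (?h' e) * Re (?h' e))"
    by (subst pars, simp only: grad)+
  then show ?thesis
    unfolding kappa_def
    by (simp add: complex_eq_iff power2_eq_square sum_subtractf mult.commute flip: sum.distrib)
qed

text \<open>The second fundamental form of a zero set of \<open>h\<close> is detected by \<open>h\<close>: its image under \<open>dh\<close> is minus the
  Hessian of \<open>h\<close>. So the mean curvature vanishes when the Hessian has trace zero on the whole tangent
  space and vanishes on the normal directions.\<close>

lemma mean_curvature_zero:
  fixes h :: "'e \<Rightarrow> 'b::euclidean_space"
  assumes h: "smooth_on h U" and x: "x \<in> U" "x \<in> W" and W: "subspace W"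
    and h0: "\<And>y. y \<in> U \<inter> W \<Longrightarrow> h y = 0"
    and ker: "\<And>v. fderiv h x v = 0 \<Longrightarrow> v \<in> W"
    and N: "finite N" "\<And>n n'. n \<in> N \<Longrightarrow> n' \<in> N \<Longrightarrow> G x n n' = (if n = n' then 1 else 0)"
    and WN: "W = {v. \<forall>n\<in>N. G x v n = 0}"
    and hessN: "\<And>n. n \<in> N \<Longrightarrow> hessian G h x n n = 0"
    and trace: "\<And>E. orthonormal_basis_of (G x) UNIV E \<Longrightarrow> (\<Sum>e\<in>E. hessian G h x e e) = 0"
  shows "mean_curvature G W x = 0"
proof -
  note ipx = ip[OF x(1)]
  note [simp] = inner_productD[OF ipx]
  let ?h' = "\<lambda>y. fderiv h y"
  note line = derivative_vanishes_along_subspace[OF open_U W]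
  have h'0: "?h' y v = 0" if "y \<in> U \<inter> W" "v \<in> W" for y v
    using line[OF smooth_onD[OF h]] that h0 by blast
  have h''0: "fderiv (\<lambda>y. ?h' y v) x u = 0" if "u \<in> W" "v \<in> W" for u v
    using line[OF smooth_onD[OF smooth_on_fderiv[OF h] x(1)]] x that h'0 by blast
  have lin: "linear (?h' x)"
    using smooth_onD[OF h x(1)] has_derivative_linear by blast
  define B where "B = (SOME B. orthonormal_basis_of (G x) W B)"
  have onB: "orthonormal_basis_of (G x) W B"
    unfolding B_def using someI_ex[OF orthonormal_basis_exists[OF ipx W]] .
  then have B: "finite B" "B \<subseteq> W" "span B = W"
      "\<And>b b'. b \<in> B \<Longrightarrow> b' \<in> B \<Longrightarrow> G x b b' = (if b = b' then 1 else 0)"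
    by (auto simp: orthonormal_basis_of_def)
  let ?II = "\<lambda>e. second_fundamental_form G W x e e"
  define H where "H = (\<Sum>e\<in>B. ?II e)"
  have II: "?II e = normal_part (G x) W (christoffel G x e e)" for e
    by (simp add: second_fundamental_form_def covariant_derivative_def)
  have h'II: "?h' x (?II e) = - hessian G h x e e" if "e \<in> B" for e
  proof -
    \<comment> \<open>The tangential part of the Christoffel vector lies in W, which dh annihilates,
      so dh sees only the second fundamental form.\<close>
    have "?h' x (christoffel G x e e - ?II e) = 0"
      using h'0 x normal_part(2)[OF ipx W] unfolding II by blast
    moreover have "e \<in> W"
      using that B by blast
    ultimately show ?thesis
      using h''0 by (simp add: hessian_def linear_diff[OF lin])
  qed
  have "orthonormal_basis_of (G x) UNIV (B \<union> N)"
  proof -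
    have span: "span (B \<union> N) = UNIV"
    proof (rule UNIV_eq_I[symmetric])
      fix v
      define p where "p = (\<Sum>n\<in>N. G x v n *\<^sub>R n)"
      have "G x (v - p) n = 0" if "n \<in> N" for n
      proof -
        have "G x p n = (\<Sum>m\<in>N. if m = n then G x v n else 0)"
          unfolding p_def using N(2)[OF _ that] by (auto intro!: sum.cong)
        then show ?thesis
          using N(1) that by simp
      qed
      then have "v - p \<in> span B"
        using WN B(3) by blast
      then have "v - p \<in> span (B \<union> N)"
        using span_mono[of B "B \<union> N"] by blast
      moreover have "p \<in> span (B \<union> N)"
        unfolding p_def by (intro span_sum span_scale span_base) auto
      ultimately show "v \<in> span (B \<union> N)"
        using span_add[of "v - p" "B \<union> N" p] by simp
    qed
    have cross: "G x b n = 0" "G x n b = 0" "b \<noteq> n" if "b \<in> B" "n \<in> N" for b n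
      using that B(2) WN inner_product_commute[OF ipx, of n b] N(2)[OF that(2) that(2)] by auto
    have "G x b b' = (if b = b' then 1 else 0)" if "b \<in> B \<union> N" "b' \<in> B \<union> N" for b b'
      using that by (elim UnE) (metis B(4), metis cross(1,3), metis cross(2,3), metis N(2))
    then show ?thesis
      using span N(1) B(1) unfolding orthonormal_basis_of_def by blast
  qed
  from trace[OF this] have "(\<Sum>e\<in>B. hessian G h x e e) = 0"
  proof -
    have "B \<inter> N = {}"
      using B(2) WN N(2) by force
    then show ?thesis
      using \<open>(\<Sum>e\<in>B \<union> N. hessian G h x e e) = 0\<close> B(1) N(1) hessN by (simp add: sum.union_disjoint)
  qed
  \<comment> \<open>H is normal to W as a sum of normal parts, while the vanishing trace puts it
    into the kernel of dh, hence into W; so it is zero.\<close>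
  then have "?h' x H = 0"
    by (simp add: H_def linear_sum[OF lin] h'II sum_negf)
  then have "H \<in> W"
    by (rule ker)
  moreover have "G x H w = 0" if "w \<in> W" for w
    using normal_part(1)[OF ipx W] that by (simp add: H_def II)
  ultimately have "H = 0"
    using inner_product_eq_0_iff[OF ipx] by blast
  then show ?thesis
    by (simp add: mean_curvature_def H_def B_def)
qed

end

section \<open>Regular level sets\<close>

text \<open>The kernel of f is the orthogonal complement of the range of its adjoint, and
  surjectivity of f makes the adjoint injective.\<close>

lemma dim_kernel_surj:
  fixes f :: "'a::euclidean_space \<Rightarrow> 'b::euclidean_space"
  assumes f: "linear f" "surj f"
  shows "dim {v. f v = 0} + DIM('b) = DIM('a)"
proof -
  have "inj (adjoint f)"
  proof (rule injI)
    fix u v assume eq: "adjoint f u = adjoint f v"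
    have *: "f x \<bullet> u = f x \<bullet> v" for x
      using adjoint_works[OF f(1), of x u] adjoint_works[OF f(1), of x v] eq by simp
    obtain x where "f x = u - v"
      using f(2) unfolding surj_def by metis
    then have "(u - v) \<bullet> (u - v) = 0"
      using *[of x] by (simp only: inner_diff_right diff_self)
    then show "u = v"
      by simp
  qed
  then have "dim (range (adjoint f)) = DIM('b)"
    using dim_image_eq[OF adjoint_linear[OF f(1)], of UNIV] by simp
  moreover have "{v. f v = 0} = {y \<in> UNIV. \<forall>x\<in>range (adjoint f). orthogonal x y}"
  proof -
    have "orthogonal (adjoint f w) y \<longleftrightarrow> f y \<bullet> w = 0" for w y
      using adjoint_works[OF f(1), of y w] by (simp add: orthogonal_def inner_commute)
    moreover have "f y = 0 \<longleftrightarrow> (\<forall>w. f y \<bullet> w = 0)" for y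
      using inner_eq_zero_iff[of "f y"] by auto
    ultimately show ?thesis
      by simp
  qed
  ultimately show ?thesis
    using dim_subspace_orthogonal_to_vectors[of "range (adjoint f)" UNIV]
      linear_subspace_image[OF adjoint_linear[OF f(1)] subspace_UNIV] by simp
qed

section \<open>Changes of charts and slice charts\<close>

context smooth_manifold
begin

lemma chart_homeo:
  assumes "C \<in> \<A>"
  shows "openin T (fst C)" "open (chart_image C)" "fst C \<subseteq> topspace T"
    "homeomorphic_map (subtopology T (fst C)) (top_of_set (chart_image C)) (snd C)"
    "topspace (subtopology T (fst C)) = fst C" "inj_on (snd C) (fst C)"
proof -
  show C: "openin T (fst C)" "open (chart_image C)"
    "homeomorphic_map (subtopology T (fst C)) (top_of_set (chart_image C)) (snd C)"
    using charts[OF assms] by (auto simp: topological_chart_def)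
  show "fst C \<subseteq> topspace T"
    using openin_subset[OF C(1)] .
  then show top: "topspace (subtopology T (fst C)) = fst C"
    by (simp add: topspace_subtopology inf_absorb2)
  show "inj_on (snd C) (fst C)"
    using homeomorphic_imp_injective_map[OF C(3)] top by simp
qed

lemma chart_inverse:
  assumes "C \<in> \<A>" "p \<in> fst C"
  shows "chart_inv C (snd C p) = p"
  unfolding chart_inv_def using chart_homeo(6)[OF assms(1)] assms(2) by (rule inv_into_f_f)

lemma open_chart_image_Int:
  assumes C: "C \<in> \<A>" and Q: "openin T Q"
  shows "open (snd C ` (fst C \<inter> Q))"
proof -
  have "openin (subtopology T (fst C)) (fst C \<inter> Q)"
    using Q by (simp add: openin_subtopology_Int2)
  then have "openin (top_of_set (chart_image C)) (snd C ` (fst C \<inter> Q))"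
    using homeomorphic_map_openness_eq[OF chart_homeo(4)[OF C]] by blast
  then show ?thesis
    using chart_homeo(2)[OF C] openin_open_eq by blast
qed

text \<open>This is where maximality of the atlas enters: a chart followed by a diffeomorphism of an
  open piece of its image is compatible with every chart and therefore belongs to the atlas.\<close>

lemma restrict_compose_chart:
  fixes \<psi> :: "'e \<Rightarrow> 'e"
  assumes C: "C \<in> \<A>" and U: "open U'" "U' \<subseteq> chart_image C" and V: "open V'"
    and hom: "homeomorphism U' V' \<psi> \<eta>" and \<psi>: "smooth_on \<psi> U'" and \<eta>: "smooth_on \<eta> V'"
  defines "C' \<equiv> ({q \<in> fst C. snd C q \<in> U'}, \<psi> \<circ> snd C)"
  shows "C' \<in> \<A>" "chart_image C' = V'"
proof -
  have hom': "\<And>x. x \<in> U' \<Longrightarrow> \<eta> (\<psi> x) = x" "\<psi> ` U' = V'" "\<And>y. y \<in> V' \<Longrightarrow> \<psi> (\<eta> y) = y" "\<eta> ` V' = U'"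
    using hom by (auto simp: homeomorphism_def)
  have cU: "snd C ` fst C' = U'"
    using U(2) by (auto simp: C'_def chart_image_def)
  then show image: "chart_image C' = V'"
  proof -
    have "snd C' ` fst C' = \<psi> ` snd C ` fst C'"
      by (simp add: C'_def image_comp)
    then show ?thesis
      by (simp only: chart_image_def cU hom'(2))
  qed
  have C'C: "fst C' \<subseteq> fst C"
    by (auto simp: C'_def)
  have homC: "homeomorphic_map (subtopology T (fst C')) (top_of_set U') (snd C)"
  proof -
    have "snd C ` (topspace (subtopology T (fst C)) \<inter> fst C') = topspace (top_of_set (chart_image C)) \<inter> U'"
      using cU C'C U(2) unfolding chart_homeo(5)[OF C] by (simp add: inf_absorb2)
    from homeomorphic_map_subtopologies[OF chart_homeo(4)[OF C] this] show ?thesis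
      using C'C U(2) by (simp add: subtopology_subtopology inf_absorb2)
  qed
  have "openin (subtopology T (fst C)) (fst C')"
  proof -
    have "openin (top_of_set (chart_image C)) (snd C ` fst C')"
      using cU U by (simp add: openin_open_eq chart_homeo(2)[OF C])
    then show ?thesis
      using homeomorphic_map_openness_eq[OF chart_homeo(4)[OF C]] C'C chart_homeo(5)[OF C] by blast
  qed
  then have openC': "openin T (fst C')"
    using chart_homeo(1)[OF C] openin_trans_full by blast
  have "homeomorphic_map (top_of_set U') (top_of_set V') \<psi>"
    unfolding homeomorphic_map_maps homeomorphic_maps_def using hom
    by (intro exI[of _ \<eta>]) (auto simp: homeomorphism_def)
  then have "homeomorphic_map (subtopology T (fst C')) (top_of_set V') (snd C')"
    using homeomorphic_map_compose[OF homC] by (simp add: C'_def)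
  then have top: "topological_chart T C'"
    using openC' V image by (simp add: topological_chart_def)
  have inj: "inj_on (snd C') (fst C')"
    using homeomorphic_imp_injective_map[OF \<open>homeomorphic_map (subtopology T (fst C')) (top_of_set V') (snd C')\<close>]
      openin_subset[OF openC'] by (simp add: topspace_subtopology inf_absorb2)
  have inv: "chart_inv C' y = chart_inv C (\<eta> y)" if y: "y \<in> V'" for y
  proof -
    obtain q where q: "q \<in> fst C'" "y = \<psi> (snd C q)"
      using y image by (auto simp: chart_image_def C'_def)
    then have "snd C q \<in> U'"
      by (simp add: C'_def)
    then have "chart_inv C (\<eta> y) = q"
      using q C'C chart_inverse[OF C] by (auto simp: hom'(1))
    moreover have "chart_inv C' y = q"
      unfolding chart_inv_def using inv_into_f_f[OF inj q(1)] q(2) by (simp add: C'_def)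
    ultimately show ?thesis
      by simp
  qed
  show "C' \<in> \<A>"
  proof (rule maximal[OF top])
    fix B assume B: "B \<in> \<A>"
    have "smooth_on (transition B C') (overlap B C')"
    proof -
      have ov: "overlap B C' \<subseteq> overlap B C"
        using C'C by (auto simp: overlap_def)
      have op: "open (overlap B C')"
        unfolding overlap_def by (rule open_chart_image_Int[OF B openC'])
      have "transition B C ` overlap B C' \<subseteq> U'"
        by (auto simp: overlap_def transition_def chart_inverse[OF B] C'_def)
      moreover have "smooth_on (transition B C) (overlap B C')"
        using compatible[OF B C] smooth_on_subset[OF _ ov] by (auto simp: smoothly_compatible_def)
      ultimately have "smooth_on (\<lambda>x. \<psi> (transition B C x)) (overlap B C')"
        using smooth_on_compose[OF op _ _ \<psi>] by blast
      moreover have "(\<lambda>x. \<psi> (transition B C x)) = transition B C'"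
        by (simp add: fun_eq_iff transition_def C'_def)
      ultimately show ?thesis
        by simp
    qed
    moreover have "smooth_on (transition C' B) (overlap C' B)"
    proof -
      have eq: "overlap C' B = \<psi> ` (snd C ` (fst C \<inter> (fst C' \<inter> fst B)))"
        using C'C by (auto simp: overlap_def C'_def)
      have sub: "snd C ` (fst C \<inter> (fst C' \<inter> fst B)) \<subseteq> U'"
        by (auto simp: C'_def)
      have "open (snd C ` (fst C \<inter> (fst C' \<inter> fst B)))"
        by (rule open_chart_image_Int[OF C openin_Int[OF openC' chart_homeo(1)[OF B]]])
      then have op: "open (overlap C' B)"
        unfolding eq using homeomorphism_imp_open_map[OF hom] sub V U(1)
        by (metis open_openin openin_open_eq openin_trans_full open_subset)
      have ovV: "overlap C' B \<subseteq> V'"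
        unfolding eq using sub hom'(2) by blast
      have \<eta>ov: "\<eta> ` overlap C' B \<subseteq> overlap C B"
      proof (rule image_subsetI)
        fix y assume "y \<in> overlap C' B"
        then obtain q where q: "q \<in> fst C'" "q \<in> fst B" "y = \<psi> (snd C q)" "snd C q \<in> U'"
          by (auto simp: overlap_def C'_def)
        then show "\<eta> y \<in> overlap C B"
          using C'C hom'(1) by (auto simp: overlap_def)
      qed
      have "smooth_on (transition C B) (overlap C B)"
        using compatible[OF C B] by (simp add: smoothly_compatible_def)
      then have "smooth_on (\<lambda>y. transition C B (\<eta> y)) (overlap C' B)"
        by (rule smooth_on_compose[OF op \<eta>ov smooth_on_subset[OF \<eta> ovV]])
      then show ?thesis
        by (rule smooth_on_cong[OF op, rotated]) (use inv ovV in \<open>auto simp: transition_def\<close>)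
    qed
    ultimately show "smoothly_compatible B C'"
      by (simp add: smoothly_compatible_def)
  qed
qed

text \<open>A slice chart at a point of the level set: correct the chart \<open>x\<close> to
  \<open>\<psi> x = (x - x\<^sub>0) - R (D (x - x\<^sub>0)) + R (h x - y)\<close>, where \<open>D\<close> is the differential of \<open>h\<close> at \<open>x\<^sub>0\<close> and \<open>R\<close> a
  linear right inverse of it. The differential of \<open>\<psi>\<close> is the identity and \<open>D (\<psi> x) = h x - y\<close>.\<close>

lemma regular_level_set_submanifold:
  fixes \<phi> :: "'p \<Rightarrow> 'b::euclidean_space"
  assumes reg: "regular_value \<A> \<phi> y"
  shows "submanifold_of_codim \<A> DIM('b) {p\<in>topspace T. \<phi> p = y}"
  unfolding submanifold_of_codim_def
proof
  fix p assume "p \<in> {p\<in>topspace T. \<phi> p = y}"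
  then obtain C where C: "C \<in> \<A>" and p: "p \<in> fst C" "\<phi> p = y"
    using cover by blast
  define h where "h = \<phi> \<circ> chart_inv C"
  define x0 where "x0 = snd C p"
  have h: "smooth_on h (chart_image C)"
    using reg C by (simp add: regular_value_def smooth_function_def h_def)
  obtain D where D: "(h has_derivative D) (at x0)" "surj D"
    using reg C p unfolding regular_value_def h_def x0_def by blast
  then have lin: "linear D"
    using has_derivative_linear by blast
  obtain R where R: "linear R" "D \<circ> R = id"
    using linear_surjective_right_inverse[OF lin D(2)] by blast
  have DR: "D (R v) = v" for v
    using R(2) by (simp add: pointfree_idE)
  have hx0: "h x0 = y"
    by (simp add: h_def x0_def chart_inverse[OF C p(1)] p(2))
  define \<psi> where "\<psi> x = (x - x0) - R (D (x - x0)) + R (h x - y)" for x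
  have bl: "bounded_linear R" "bounded_linear (\<lambda>x. R (D x))"
    using R(1) lin by (simp_all add: linear_conv_bounded_linear bounded_linear_compose)
  have D\<psi>: "D (\<psi> x) = h x - y" for x
    by (simp add: \<psi>_def linear_add[OF lin] linear_diff[OF lin] DR)
  have \<psi>_smooth: "smooth_on \<psi> (chart_image C)"
    unfolding \<psi>_def using chart_homeo(2)[OF C]
    by (intro smooth_on_add smooth_on_diff smooth_on_bounded_linear_compose[OF _ bl(1)]
        smooth_on_bounded_linear_compose[OF _ bl(2)] smooth_on_bounded_linear[OF bounded_linear_ident] smooth_on_const h)
  have "(\<psi> has_derivative (\<lambda>v. (v - 0) - R (D (v - 0)) + R (D v - 0))) (at x0)"
    unfolding \<psi>_def
    by (intro has_derivative_add has_derivative_diff bounded_linear.has_derivative[OF bl(1)]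
        bounded_linear.has_derivative[OF bl(2)] has_derivative_ident has_derivative_const D(1))
  then have "(\<psi> has_derivative id) (at x0)"
    by (simp add: id_def)
  moreover have "x0 \<in> chart_image C"
    using p(1) by (simp add: x0_def chart_image_def)
  ultimately obtain U' V' \<eta> where \<eta>: "open U'" "U' \<subseteq> chart_image C" "x0 \<in> U'" "open V'"
    "homeomorphism U' V' \<psi> \<eta>" "smooth_on \<eta> V'"
    using smooth_inverse_function[OF chart_homeo(2)[OF C] \<psi>_smooth _ _ inj_on_id] by metis
  define C' where "C' = ({q \<in> fst C. snd C q \<in> U'}, \<psi> \<circ> snd C)"
  have C': "C' \<in> \<A>" "chart_image C' = V'"
    using restrict_compose_chart[OF C \<eta>(1,2,4,5) smooth_on_subset[OF \<psi>_smooth \<eta>(2)] \<eta>(6)]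
    unfolding C'_def by blast+
  define W where "W = {v. D v = 0}"
  have iff: "snd C' q \<in> W \<longleftrightarrow> \<phi> q = y" if "q \<in> fst C'" for q
  proof -
    have "q \<in> fst C"
      using that by (simp add: C'_def)
    then have "D (snd C' q) = \<phi> q - y"
      by (simp add: C'_def D\<psi> h_def chart_inverse[OF C])
    then show ?thesis
      by (simp add: W_def)
  qed
  have "snd C' ` (fst C' \<inter> {p\<in>topspace T. \<phi> p = y}) = chart_image C' \<inter> W"
    unfolding chart_image_def using iff chart_homeo(3)[OF C'(1)] by auto
  moreover have "subspace W"
    unfolding W_def by (rule linear_subspace_kernel[OF lin])
  moreover have "dim W + DIM('b) = DIM('e)"
    unfolding W_def by (rule dim_kernel_surj[OF lin D(2)])
  ultimately have "slice_chart \<A> DIM('b) {p\<in>topspace T. \<phi> p = y} C' W"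
    using C'(1) by (simp add: slice_chart_def)
  moreover have "p \<in> fst C'"
    using p(1) \<eta>(3) by (simp add: C'_def x0_def)
  ultimately show "\<exists>C W. slice_chart \<A> DIM('b) {p\<in>topspace T. \<phi> p = y} C W \<and> p \<in> fst C"
    by blast
qed

end

section \<open>The special unitary group\<close>

lemma bounded_bilinear_matrix_mult: "bounded_bilinear ((**) :: complex^'n^'m \<Rightarrow> complex^'p^'n \<Rightarrow> complex^'p^'m)"
proof -
  have "bilinear ((**) :: complex^'n^'m \<Rightarrow> complex^'p^'n \<Rightarrow> complex^'p^'m)"
    unfolding bilinear_def
    by (intro conjI allI linearI)
      (simp_all add: matrix_matrix_mult_def vec_eq_iff scaleR_sum_right distrib_left distrib_right sum.distrib)
  then show ?thesis
    by (simp add: bilinear_conv_bounded_bilinear)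
qed

lemmas matrix_mult_simps =
  bounded_bilinear.add_left[OF bounded_bilinear_matrix_mult]
  bounded_bilinear.add_right[OF bounded_bilinear_matrix_mult]
  bounded_bilinear.diff_left[OF bounded_bilinear_matrix_mult]
  bounded_bilinear.diff_right[OF bounded_bilinear_matrix_mult]
  bounded_bilinear.minus_left[OF bounded_bilinear_matrix_mult]
  bounded_bilinear.minus_right[OF bounded_bilinear_matrix_mult]
  bounded_bilinear.scaleR_left[OF bounded_bilinear_matrix_mult]
  bounded_bilinear.scaleR_right[OF bounded_bilinear_matrix_mult]
  bounded_bilinear.zero_left[OF bounded_bilinear_matrix_mult]
  bounded_bilinear.zero_right[OF bounded_bilinear_matrix_mult]

lemmas bounded_linear_matrix_mult_left = bounded_bilinear.bounded_linear_left[OF bounded_bilinear_matrix_mult]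
lemmas bounded_linear_matrix_mult_right = bounded_bilinear.bounded_linear_right[OF bounded_bilinear_matrix_mult]

lemma conj_transpose_nth [simp]: "conj_transpose z $ i $ j = cnj (z $ j $ i)"
  by (simp add: conj_transpose_def transpose_def map_matrix_def)

lemma bounded_linear_conj_transpose: "bounded_linear (conj_transpose :: complex^'n^'m \<Rightarrow> complex^'m^'n)"
  unfolding linear_conv_bounded_linear[symmetric] by (rule linearI) (simp_all add: vec_eq_iff)

lemma conj_transpose_mult: "conj_transpose (A ** B) = conj_transpose B ** conj_transpose A"
  by (simp add: vec_eq_iff matrix_matrix_mult_def mult.commute)

lemma conj_transpose_simps [simp]:
  "conj_transpose (conj_transpose A) = A" "conj_transpose (mat 1) = mat 1"
  "conj_transpose (A + B) = conj_transpose A + conj_transpose B"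
  "conj_transpose (A - B) = conj_transpose A - conj_transpose B"
  "conj_transpose (- A) = - conj_transpose A"
  "conj_transpose (c *\<^sub>R A) = c *\<^sub>R conj_transpose A"
  by (simp_all add: vec_eq_iff mat_def)

lemma inner_matrix: "(X :: complex^'n^'m) \<bullet> Y = (\<Sum>i\<in>UNIV. \<Sum>j\<in>UNIV. Re (X $ i $ j * cnj (Y $ i $ j)))"
  by (simp add: inner_vec_def inner_complex_def)

lemma Re_trace_conj_transpose: "Re (trace (X ** conj_transpose Y)) = (X :: complex^'n^'n) \<bullet> Y"
  by (simp add: inner_matrix trace_def matrix_matrix_mult_def)

lemma inner_matrix_mult_left: "((A :: complex^'n^'n) ** X) \<bullet> Y = (X :: complex^'n^'n) \<bullet> (conj_transpose A ** Y)"
proof -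
  have "(A ** X) \<bullet> Y = Re (trace (A ** (X ** conj_transpose Y)))"
    using Re_trace_conj_transpose[of "A ** X" Y] by (simp only: matrix_mul_assoc)
  also have "\<dots> = Re (trace (X ** conj_transpose Y ** A))"
    using trace_mul_sym[of A "X ** conj_transpose Y"] by simp
  also have "\<dots> = Re (trace (X ** conj_transpose (conj_transpose A ** Y)))"
    by (simp add: conj_transpose_mult matrix_mul_assoc)
  finally show ?thesis
    by (simp only: Re_trace_conj_transpose)
qed

lemma inner_matrix_mult_right: "(X ** (A :: complex^'n^'n)) \<bullet> Y = (X :: complex^'n^'n) \<bullet> (Y ** conj_transpose A)"
  using Re_trace_conj_transpose[of "X ** A" Y] Re_trace_conj_transpose[of X "Y ** conj_transpose A"]
  by (simp only: conj_transpose_mult conj_transpose_simps matrix_mul_assoc)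

lemma SU_unitary:
  assumes "z \<in> (SU :: (complex^'n^'n) set)"
  shows "z ** conj_transpose z = mat 1" "conj_transpose z ** z = mat 1"
  using assms matrix_left_right_inverse by (auto simp: SU_def)

lemma SU_mult: "y \<in> SU \<Longrightarrow> z \<in> SU \<Longrightarrow> y ** z \<in> (SU :: (complex^'n^'n) set)"
proof -
  assume yz: "y \<in> SU" "z \<in> SU"
  have "y ** z ** conj_transpose (y ** z) = y ** (z ** conj_transpose z) ** conj_transpose y"
    by (simp add: conj_transpose_mult matrix_mul_assoc)
  with yz show ?thesis
    by (simp add: SU_def det_mul)
qed

lemma mat_1_in_SU: "mat 1 \<in> (SU :: (complex^'n^'n) set)"
  by (simp add: SU_def)

lemma SU_conj_transpose: "z \<in> SU \<Longrightarrow> conj_transpose z \<in> (SU :: (complex^'n^'n) set)"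
proof -
  assume z: "z \<in> (SU :: (complex^'n^'n) set)"
  have "det z * det (conj_transpose z) = 1"
    using SU_unitary(1)[OF z] by (metis det_mul det_I)
  with z SU_unitary(2)[OF z] show ?thesis
    by (simp add: SU_def)
qed

lemma SU_matrix_inv: "z \<in> (SU :: (complex^'n^'n) set) \<Longrightarrow> matrix_inv z = conj_transpose z"
proof -
  assume z: "z \<in> SU"
  have "z ** matrix_inv z = mat 1 \<and> matrix_inv z ** z = mat 1"
    unfolding matrix_inv_def by (rule someI[of _ "conj_transpose z"]) (simp add: SU_unitary[OF z])
  then show ?thesis
    by (metis SU_unitary(2)[OF z] matrix_mul_assoc matrix_mul_lid matrix_mul_rid)
qed

text \<open>Left translation by a unitary matrix preserves the Euclidean inner product, so the
  bi-invariant metric is the restriction of the inner product of the matrix space.\<close>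

lemma metric_SU_eq_inner:
  assumes "z \<in> (SU :: (complex^'n^'n) set)"
  shows "metric_SU z X Y = X \<bullet> Y"
proof -
  have "metric_SU z X Y = X \<bullet> (z ** (conj_transpose z ** Y))"
    by (simp add: metric_SU_def SU_matrix_inv[OF assms] Re_trace_conj_transpose inner_matrix_mult_left)
  then show ?thesis
    by (simp add: matrix_mul_assoc SU_unitary(1)[OF assms])
qed

lemma isometry_SU: "z \<in> SU \<Longrightarrow> (z ** X) \<bullet> (z ** Y) = X \<bullet> (Y :: complex^'n^'n)"
  by (simp add: inner_matrix_mult_left matrix_mul_assoc SU_unitary)

lemma continuous_on_det: "continuous_on S (det :: complex^'n^'n \<Rightarrow> complex)"
  unfolding det_def by (intro continuous_intros)

lemma compact_SU: "compact (SU :: (complex^'n^'n) set)"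
proof -
  have "norm z \<le> sqrt (real CARD('n))" if "z \<in> SU" for z :: "complex^'n^'n"
    using SU_unitary(1)[OF that] Re_trace_conj_transpose[of z z] by (simp add: norm_eq_sqrt_inner trace_I)
  then have "bounded (SU :: (complex^'n^'n) set)"
    unfolding bounded_iff by blast
  moreover have "closed ({z. z ** conj_transpose z = mat 1} \<inter> {z :: complex^'n^'n. det z = 1})"
    by (intro closed_Int closed_Collect_eq continuous_on_const continuous_on_det
        bounded_bilinear.continuous_on[OF bounded_bilinear_matrix_mult] continuous_on_id
        linear_continuous_on[OF bounded_linear_conj_transpose])
  ultimately show ?thesis
    by (simp add: SU_def compact_eq_bounded_closed Collect_conj_eq)
qed

lemma su_iff: "X \<in> su \<longleftrightarrow> conj_transpose X = - X \<and> trace X = 0"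
  unfolding su_def mem_Collect_eq using add_eq_0_iff[of X "conj_transpose X"] by argo

lemma trace_scaleR: "trace (c *\<^sub>R (X :: complex^'n^'n)) = c *\<^sub>R trace X"
  by (simp add: trace_def scaleR_sum_right)

lemma subspace_su: "subspace (su :: (complex^'n^'n) set)"
proof (rule subspaceI)
  show "0 \<in> (su :: (complex^'n^'n) set)"
    using trace_0 by (simp add: su_iff vec_eq_iff trace_def)
qed (simp_all add: su_iff trace_add trace_scaleR)

lemma su_conjugate:
  assumes "z \<in> (SU :: (complex^'n^'n) set)" "X \<in> su"
  shows "conj_transpose z ** X ** z \<in> su"
proof -
  have "trace (conj_transpose z ** X ** z) = trace (z ** (conj_transpose z ** X))"
    by (rule trace_mul_sym)
  then show ?thesis
    using assms by (simp add: su_iff conj_transpose_mult matrix_mul_assoc SU_unitary matrix_mult_simps)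
qed

lemma SO_mult: "x \<in> SO \<Longrightarrow> y \<in> SO \<Longrightarrow> x ** y \<in> (SO :: (complex^'n^'n) set)"
  by (simp add: SO_def SU_mult) (simp add: matrix_matrix_mult_def)

lemma mat_1_in_SO: "mat 1 \<in> (SO :: (complex^'n^'n) set)"
  by (simp add: SO_def mat_1_in_SU) (simp add: mat_def)

lemma SO_transpose: "x \<in> (SO :: (complex^'n^'n) set) \<Longrightarrow> transpose x = conj_transpose x"
  by (auto simp: SO_def vec_eq_iff transpose_def Reals_cnj_iff)

text \<open>The hypotheses say \<open>exp (t N) = 1 + sin t N + (1 - cos t) N\<^sup>2\<close> and, through \<open>Q\<close>, that \<open>exp (t N)\<close> is
  conjugate to \<open>exp (- t N)\<close>; hence its determinant is \<open>\<plusminus>1\<close>, and it is a square.\<close>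

lemma one_parameter_subgroup_SU:
  fixes N Q :: "complex^'n^'n"
  assumes N: "conj_transpose N = - N" "N ** N ** N = - N" and Q: "Q ** Q = mat 1" "Q ** N = - (N ** Q)"
  defines "K \<equiv> \<lambda>t. mat 1 + sin t *\<^sub>R N + (1 - cos t) *\<^sub>R (N ** N)"
  shows "K t \<in> SU" "K 0 = mat 1" "smooth_on K UNIV" "(K has_derivative (\<lambda>t. t *\<^sub>R N)) (at 0)"
proof -
  have N3: "N ** (N ** N) = - N" "N ** (N ** (N ** N)) = - (N ** N)"
    using N(2) by (simp_all add: matrix_mul_assoc matrix_mult_simps)
  have cs: "(cos t * cos t) *\<^sub>R (N ** N) + (sin t * sin t) *\<^sub>R (N ** N) = N ** N" for t
    by (simp flip: scaleR_add_left)
  have unit: "K t ** K (- t) = mat 1" for t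
  proof -
    have "K t ** K (- t) = mat 1 + (2 * (1 - cos t) - (1 - cos t)\<^sup>2 - (sin t)\<^sup>2) *\<^sub>R (N ** N)"
      using cs[of t] by (simp add: K_def matrix_mult_simps matrix_mul_assoc[symmetric] N3 algebra_simps power2_eq_square)
    also have "2 * (1 - cos t) - (1 - cos t)\<^sup>2 - (sin t)\<^sup>2 = 0"
      using sin_cos_squared_add[of t] by (simp add: power2_eq_square algebra_simps)
    finally show ?thesis
      by simp
  qed
  have double: "K (2 * t) = K t ** K t" for t
  proof -
    have "K t ** K t = mat 1 + ((sin t * cos t) *\<^sub>R N + (sin t * cos t) *\<^sub>R N) + (2 * (1 - cos t) - (1 - cos t)\<^sup>2 + (sin t)\<^sup>2) *\<^sub>R (N ** N)"
      by (simp add: K_def matrix_mult_simps matrix_mul_assoc[symmetric] N3 algebra_simps power2_eq_square)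
    also have "2 * (1 - cos t) - (1 - cos t)\<^sup>2 + (sin t)\<^sup>2 = 1 - cos (2 * t)"
      using sin_cos_squared_add[of t] cos_double[of t] by (simp add: power2_eq_square algebra_simps)
    also have "(sin t * cos t) *\<^sub>R N + (sin t * cos t) *\<^sub>R N = sin (2 * t) *\<^sub>R N"
      by (simp add: sin_double flip: scaleR_add_left)
    finally show ?thesis
      by (simp only: K_def)
  qed
  have QNN: "Q ** (N ** N) = N ** N ** Q"
  proof -
    have "Q ** (N ** N) = - (N ** Q) ** N"
      by (simp add: matrix_mul_assoc Q)
    also have "\<dots> = - (N ** (Q ** N))"
      by (simp add: matrix_mul_assoc matrix_mult_simps)
    finally show ?thesis
      by (simp add: Q matrix_mult_simps matrix_mul_assoc)
  qed
  have "Q ** K t = K (- t) ** Q" for t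
    by (simp add: K_def matrix_mult_simps QNN Q)
  then have "det Q * det (K t) = det (K (- t)) * det Q" for t
    by (metis det_mul)
  moreover have "det Q * det Q = 1"
    using Q(1) by (metis det_mul det_I)
  ultimately have "det (K t) = det (K (- t))" for t
    by (metis mult.commute mult_cancel_left mult_zero_left zero_neq_one)
  then have "det (K t) * det (K t) = 1" for t
    using unit[of t] by (metis det_mul det_I)
  then have "det (K t) = 1" for t
    using double[of "t / 2"] by (simp add: det_mul)
  moreover have "conj_transpose (K t) = K (- t)" for t
    by (simp add: K_def conj_transpose_mult N matrix_mult_simps)
  ultimately show "K t \<in> SU"
    using unit by (simp add: SU_def)
  show "K 0 = mat 1"
    by (simp add: K_def)
  show "smooth_on K UNIV"
    unfolding K_def
    by (intro smooth_on_add smooth_on_const smooth_on_scaleR smooth_on_diff smooth_on_cos_sin open_UNIV)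
  have "(K has_derivative (\<lambda>t. (t * cos 0) *\<^sub>R N + (t * sin 0) *\<^sub>R (N ** N))) (at 0)"
    unfolding K_def by (auto intro!: derivative_eq_intros)
  then show "(K has_derivative (\<lambda>t. t *\<^sub>R N)) (at 0)"
    by simp
qed

section \<open>Generators of the Lie algebra and curves through the identity\<close>

definition matrix_unit :: "'n \<Rightarrow> 'n \<Rightarrow> complex \<Rightarrow> complex^'n^'n" where
  "matrix_unit a b c = (\<chi> i j. if i = a \<and> j = b then c else 0)"

lemma matrix_unit_mult: "matrix_unit a b c ** matrix_unit a' b' c' = (if b = a' then matrix_unit a b' (c * c') else 0)"
proof -
  have "(\<Sum>k\<in>UNIV. (if i = a \<and> k = b then c else 0) * (if k = a' \<and> j = b' then c' else 0)) =
    (if b = a' \<and> i = a \<and> j = b' then c * c' else 0)" for i j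
  proof -
    have "(\<Sum>k\<in>UNIV. (if i = a \<and> k = b then c else 0) * (if k = a' \<and> j = b' then c' else 0)) =
      (\<Sum>k\<in>UNIV. if k = b then (if b = a' \<and> i = a \<and> j = b' then c * c' else 0) else 0)"
      by (intro sum.cong) auto
    then show ?thesis
      by simp
  qed
  then show ?thesis
    by (simp add: vec_eq_iff matrix_matrix_mult_def matrix_unit_def)
qed

lemma conj_transpose_matrix_unit: "conj_transpose (matrix_unit a b c) = matrix_unit b a (cnj c)"
  by (auto simp: vec_eq_iff matrix_unit_def)

lemma matrix_unit_simps:
  "matrix_unit a b c + matrix_unit a b c' = matrix_unit a b (c + c')"
  "matrix_unit a b c - matrix_unit a b c' = matrix_unit a b (c - c')"
  "- matrix_unit a b c = matrix_unit a b (- c)" "matrix_unit a b 0 = 0"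
  by (auto simp: vec_eq_iff matrix_unit_def)

lemma trace_matrix_unit: "trace (matrix_unit a b c) = (if a = b then c else 0)"
proof -
  have "trace (matrix_unit a b c) = (\<Sum>i\<in>UNIV. if i = a then (if a = b then c else 0) else 0)"
    unfolding trace_def matrix_unit_def by (intro sum.cong) auto
  then show ?thesis
    by simp
qed

lemma inner_matrix_unit: "X \<bullet> matrix_unit a b c = Re (X $ a $ b * cnj c)"
proof -
  have "X \<bullet> matrix_unit a b c = (\<Sum>i\<in>UNIV. \<Sum>j\<in>UNIV. if j = b then if i = a then Re (X $ a $ b * cnj c) else 0 else 0)"
    unfolding inner_matrix matrix_unit_def by (intro sum.cong refl) auto
  then show ?thesis
    by simp
qed

text \<open>A real spanning set of the Lie algebra chosen for its exponentials: every generator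
  satisfies \<open>N ** N ** N = - N\<close>, so a curve with velocity N is explicit. The generators
  with \<open>\<omega> = 1\<close> are real and span the Lie algebra of SO(n).\<close>

definition su_generators :: "(complex^'n^'n) set" where
  "su_generators =
     {matrix_unit a b \<omega> - matrix_unit b a (cnj \<omega>) |a b \<omega>. a \<noteq> b \<and> (\<omega> = 1 \<or> \<omega> = \<i>)} \<union>
     {matrix_unit a a \<i> - matrix_unit b b \<i> |a b. a \<noteq> b}"

lemma su_generators_subset: "su_generators \<subseteq> (su :: (complex^'n^'n) set)"
  by (auto simp: su_generators_def su_iff conj_transpose_matrix_unit trace_sub trace_add trace_matrix_unit
      simp flip: matrix_unit_simps(3))

text \<open>By orthogonal decomposition it suffices that an element of \<open>su\<close> orthogonal
  to all generators is zero. The off-diagonal generators kill its off-diagonal entries, the diagonal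
  ones make its diagonal constant, and the trace is zero.\<close>

lemma span_su_generators: "span su_generators = (su :: (complex^'n^'n) set)"
proof
  show "span su_generators \<subseteq> (su :: (complex^'n^'n) set)"
    by (rule span_minimal[OF su_generators_subset subspace_su])
  show "(su :: (complex^'n^'n) set) \<subseteq> span su_generators"
  proof
    fix X :: "complex^'n^'n" assume X: "X \<in> su"
    obtain Y Z where Y: "Y \<in> span su_generators" and Z: "\<And>W. W \<in> span su_generators \<Longrightarrow> orthogonal Z W"
      and XYZ: "X = Y + Z"
      using orthogonal_subspace_decomp_exists[of su_generators X] by metis
    have "Y \<in> su"
      using Y \<open>span su_generators \<subseteq> su\<close> by blast
    then have "Z \<in> su"
      using X XYZ subspace_diff[OF subspace_su, of X Y] by simp
    then have skew: "Z $ i $ j = - cnj (Z $ j $ i)" and tr: "trace Z = 0" for i j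
      by (auto simp: su_iff vec_eq_iff minus_equation_iff)
    have Z0: "Z \<bullet> W = 0" if "W \<in> su_generators" for W
      using Z[OF span_base[OF that]] by (simp add: orthogonal_def)
    have off: "Z $ a $ b = 0" if "a \<noteq> b" for a b
    proof -
      have "Z \<bullet> (matrix_unit a b \<omega> - matrix_unit b a (cnj \<omega>)) = 0" if "\<omega> = 1 \<or> \<omega> = \<i>" for \<omega>
        using \<open>a \<noteq> b\<close> that by (intro Z0) (auto simp: su_generators_def)
      from this[of 1] this[of \<i>] show ?thesis
        using skew[of b a] by (simp add: inner_diff_right inner_matrix_unit complex_eq_iff)
    qed
    have diag: "Z $ a $ a = Z $ b $ b" for a b
    proof (cases "a = b")
      case False
      then have "Z \<bullet> (matrix_unit a a \<i> - matrix_unit b b \<i>) = 0"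
        by (intro Z0) (auto simp: su_generators_def)
      moreover have "Re (Z $ a $ a) = 0" "Re (Z $ b $ b) = 0"
        using arg_cong[OF skew[of a a], of Re] arg_cong[OF skew[of b b], of Re] by simp_all
      ultimately show ?thesis
        by (simp add: inner_diff_right inner_matrix_unit complex_eq_iff)
    qed simp
    have "Z $ a $ a = 0" for a
    proof -
      have "trace Z = (\<Sum>b\<in>(UNIV :: 'n set). Z $ a $ a)"
        unfolding trace_def using diag by (intro sum.cong) auto
      then show ?thesis
        using tr by simp
    qed
    with off have "Z = 0"
      unfolding vec_eq_iff by (metis zero_index)
    then show "X \<in> span su_generators"
      using XYZ Y by simp
  qed
qed

lemma su_generator_curve:
  fixes N :: "complex^'n^'n"
  assumes "N \<in> su_generators"
  shows "\<exists>K. (\<forall>t. K t \<in> SU \<and> ((\<forall>i j. N $ i $ j \<in> \<real>) \<longrightarrow> K t \<in> SO)) \<and> K 0 = mat 1 \<and>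
    smooth_on K UNIV \<and> (K has_derivative (\<lambda>t::real. t *\<^sub>R N)) (at 0)"
proof -
  have *: ?thesis if "conj_transpose N = - N" "N ** N ** N = - N" "Q ** Q = mat 1" "Q ** N = - (N ** Q)" for Q
  proof (intro exI[of _ "\<lambda>t. mat 1 + sin t *\<^sub>R N + (1 - cos t) *\<^sub>R (N ** N)"] conjI allI impI)
    fix t
    assume real: "\<forall>i j. N $ i $ j \<in> \<real>"
    then have "(N ** N) $ i $ j \<in> \<real>" for i j
      by (simp add: matrix_matrix_mult_def)
    moreover have "(mat 1 :: complex^'n^'n) $ i $ j \<in> \<real>" for i j
      by (simp add: mat_def)
    ultimately have "(mat 1 + sin t *\<^sub>R N + (1 - cos t) *\<^sub>R (N ** N)) $ i $ j \<in> \<real>" for i j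
      using real by (simp add: scaleR_conv_of_real[where 'a = complex])
    then show "mat 1 + sin t *\<^sub>R N + (1 - cos t) *\<^sub>R (N ** N) \<in> SO"
      using one_parameter_subgroup_SU(1)[OF that] unfolding SO_def by blast
  qed (rule one_parameter_subgroup_SU[OF that])+
  consider a b \<omega> where "N = matrix_unit a b \<omega> - matrix_unit b a (cnj \<omega>)" "a \<noteq> b" "\<omega> = 1 \<or> \<omega> = \<i>"
    | a b where "N = matrix_unit a a \<i> - matrix_unit b b \<i>" "a \<noteq> b"
    using assms unfolding su_generators_def by blast
  then show ?thesis
  proof cases
    case 1
    have "\<omega> * cnj \<omega> = 1" "cnj \<omega> * \<omega> = 1"
      using 1(3) by auto
    \<comment> \<open>Q is the reflection that changes the sign of coordinate a; it anticommutes
      with N, whose nonzero entries sit at (a, b) and (b, a).\<close>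
    then show ?thesis
      using 1(2) by (intro *[of "mat 1 - matrix_unit a a 2"])
        (simp_all add: 1(1) conj_transpose_matrix_unit matrix_mult_simps matrix_unit_mult matrix_unit_simps algebra_simps mult.assoc[symmetric])
  next
    case 2
    \<comment> \<open>Q exchanges the coordinates a and b, and conjugation by it changes the sign of
      N.\<close>
    let ?Q = "mat 1 - matrix_unit a a 1 - matrix_unit b b 1 + matrix_unit a b 1 + matrix_unit b a 1"
    show ?thesis
      using 2(2) by (intro *[of ?Q])
        (simp_all add: 2(1) conj_transpose_matrix_unit matrix_mult_simps matrix_unit_mult matrix_unit_simps algebra_simps)
  qed
qed

text \<open>Under products of H-valued maps the derivatives at the identity add up, and a linear map
  into the span of the generators is built by sums and scalings from maps
  \<open>l x *\<^sub>R N\<close> with l linear, each realized by the curve of N evaluated at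
  \<open>l x\<close>. This replaces the exponential map for \<open>SU\<close> and for
  \<open>SO\<close>.\<close>

lemma subgroup_parametrization:
  fixes \<Lambda> :: "'e::euclidean_space \<Rightarrow> complex^'n^'n" and H :: "(complex^'n^'n) set"
  assumes "linear \<Lambda>" "range \<Lambda> \<subseteq> span \<G>"
    and mat_1_in_H: "mat 1 \<in> H" and H_mult: "\<And>x y. x \<in> H \<Longrightarrow> y \<in> H \<Longrightarrow> x ** y \<in> H"
    and generator: "\<And>N. N \<in> \<G> \<Longrightarrow> \<exists>K. (\<forall>t. K t \<in> H) \<and> K 0 = mat 1 \<and> smooth_on K UNIV \<and>
      (K has_derivative (\<lambda>t::real. t *\<^sub>R N)) (at 0)"
  shows "\<exists>\<theta>. (\<forall>x. \<theta> x \<in> H) \<and> \<theta> 0 = mat 1 \<and> smooth_on \<theta> UNIV \<and> (\<theta> has_derivative \<Lambda>) (at 0)"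
proof -
  define P where "P \<Lambda> \<longleftrightarrow> (\<exists>\<theta>. (\<forall>x. \<theta> x \<in> H) \<and> \<theta> 0 = mat 1 \<and> smooth_on \<theta> UNIV \<and> (\<theta> has_derivative \<Lambda>) (at 0))"
    for \<Lambda> :: "'e \<Rightarrow> complex^'n^'n"
  have P0: "P (\<lambda>x. 0)"
    unfolding P_def using mat_1_in_H by (intro exI[of _ "\<lambda>x. mat 1"]) auto
  have Padd: "P (\<lambda>x. \<Lambda> x + \<Lambda>' x)" if P: "P \<Lambda>" "P \<Lambda>'" for \<Lambda> \<Lambda>'
  proof -
    obtain \<theta> \<theta>' where \<theta>: "\<forall>x. \<theta> x \<in> H" "\<theta> 0 = mat 1" "smooth_on \<theta> UNIV" "(\<theta> has_derivative \<Lambda>) (at 0)"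
      "\<forall>x. \<theta>' x \<in> H" "\<theta>' 0 = mat 1" "smooth_on \<theta>' UNIV" "(\<theta>' has_derivative \<Lambda>') (at 0)"
      using P unfolding P_def by blast
    have "((\<lambda>x. \<theta> x ** \<theta>' x) has_derivative (\<lambda>x. \<theta> 0 ** \<Lambda>' x + \<Lambda> x ** \<theta>' 0)) (at 0)"
      by (intro bounded_bilinear.FDERIV[OF bounded_bilinear_matrix_mult] \<theta>)
    then have "((\<lambda>x. \<theta> x ** \<theta>' x) has_derivative (\<lambda>x. \<Lambda> x + \<Lambda>' x)) (at 0)"
      by (simp add: \<theta> add.commute)
    moreover have "smooth_on (\<lambda>x. \<theta> x ** \<theta>' x) UNIV"
      by (rule smooth_on_bilinear[OF open_UNIV bounded_bilinear_matrix_mult \<theta>(3) \<theta>(7)])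
    ultimately show ?thesis
      unfolding P_def using \<theta> by (intro exI[of _ "\<lambda>x. \<theta> x ** \<theta>' x"]) (simp add: H_mult)
  qed
  have gen: "P (\<lambda>x. l x *\<^sub>R N)" if N: "N \<in> \<G>" and l: "linear l" for N and l :: "'e \<Rightarrow> real"
  proof -
    obtain K where K: "\<forall>t. K t \<in> H" "K 0 = mat 1" "smooth_on K UNIV" "(K has_derivative (\<lambda>t::real. t *\<^sub>R N)) (at 0)"
      using generator[OF N] by blast
    have "((\<lambda>x. K (l x)) has_derivative (\<lambda>x. l x *\<^sub>R N)) (at 0)"
      using l K(4) by (intro has_derivative_compose[of l l 0 UNIV K "\<lambda>t. t *\<^sub>R N"])
        (auto simp: linear_0 linear_conv_bounded_linear intro: bounded_linear_imp_has_derivative)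
    moreover have "smooth_on (\<lambda>x. K (l x)) UNIV"
      using l by (intro smooth_on_compose[OF open_UNIV _ _ K(3)] smooth_on_bounded_linear)
        (auto simp: linear_conv_bounded_linear)
    ultimately show ?thesis
      unfolding P_def using K l by (intro exI[of _ "\<lambda>x. K (l x)"]) (simp add: linear_0)
  qed
  have all: "P (\<lambda>x. l x *\<^sub>R X)" if "X \<in> span \<G>" "linear l" for X and l :: "'e \<Rightarrow> real"
  proof -
    have "\<forall>l. linear l \<longrightarrow> P (\<lambda>x. l x *\<^sub>R X)"
      using that(1)
    proof (induction rule: span_induct)
      case base
      have "P (\<lambda>x. l x *\<^sub>R (c *\<^sub>R X))" if "\<forall>l. linear l \<longrightarrow> P (\<lambda>x. l x *\<^sub>R X)" "linear l" for c X l
        using that(1)[rule_format, of "\<lambda>x. c * l x"] that(2)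
        by (simp add: linear_compose_scale_right[where f = l and c = c, simplified] mult.commute)
      then show ?case
        using P0 Padd by (intro subspaceI) (auto simp: scaleR_add_right)
    qed (use gen in blast)
    then show ?thesis
      using that by blast
  qed
  have sum: "P (\<lambda>x. \<Sum>b\<in>B. (x \<bullet> b) *\<^sub>R \<Lambda> b)" if "finite B" for B
    using that
  proof induction
    case (insert b B)
    have "P (\<lambda>x. (x \<bullet> b) *\<^sub>R \<Lambda> b)"
      using assms(2) by (intro all) (auto simp: linear_conv_bounded_linear bounded_linear_inner_left)
    from Padd[OF this insert.IH] show ?case
      using insert.hyps by simp
  qed (simp add: P0)
  have eq: "\<Lambda> = (\<lambda>x. \<Sum>b\<in>Basis. (x \<bullet> b) *\<^sub>R \<Lambda> b)"
    using linear_eq_sum_Basis[OF assms(1)] by (rule ext)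
  have "P \<Lambda>"
    by (subst eq) (rule sum[OF finite_Basis])
  then show ?thesis
    unfolding P_def .
qed

lemma SU_parametrization:
  fixes \<Lambda> :: "'e::euclidean_space \<Rightarrow> complex^'n^'n"
  assumes "linear \<Lambda>" "range \<Lambda> \<subseteq> su"
  shows "\<exists>\<theta>. (\<forall>x. \<theta> x \<in> SU) \<and> \<theta> 0 = mat 1 \<and> smooth_on \<theta> UNIV \<and> (\<theta> has_derivative \<Lambda>) (at 0)"
proof (rule subgroup_parametrization[of \<Lambda> su_generators SU, OF assms(1) _ mat_1_in_SU SU_mult])
  show "range \<Lambda> \<subseteq> span su_generators"
    using assms(2) by (simp add: span_su_generators)
next
  fix N :: "complex^'n^'n" assume "N \<in> su_generators"
  from su_generator_curve[OF this] show "\<exists>K. (\<forall>t. K t \<in> SU) \<and> K 0 = mat 1 \<and> smooth_on K UNIV \<and>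
      (K has_derivative (\<lambda>t::real. t *\<^sub>R N)) (at 0)"
    by blast
qed

text \<open>Tangent spaces are given algebraically, as translates of \<open>su\<close>; a translated
  curve through the identity realizes each such vector as a velocity.\<close>

lemma tangent_curve_SU:
  fixes X :: "complex^'n^'n"
  assumes "z \<in> SU" "X \<in> su"
  obtains k :: "real \<Rightarrow> complex^'n^'n" where "\<And>t. k t \<in> SU" "k 0 = z" "(k has_vector_derivative z ** X) (at 0)"
proof -
  have "linear (\<lambda>t::real. t *\<^sub>R X)"
    by (auto intro!: linearI simp: scaleR_add_left)
  moreover have "range (\<lambda>t::real. t *\<^sub>R X) \<subseteq> su"
    using assms(2) subspace_scale[OF subspace_su] by blast
  ultimately obtain \<theta> :: "real \<Rightarrow> complex^'n^'n" where \<theta>: "\<forall>x. \<theta> x \<in> SU" "\<theta> 0 = mat 1" "(\<theta> has_derivative (\<lambda>t. t *\<^sub>R X)) (at 0)"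
    using SU_parametrization by blast
  have "((\<lambda>t. z ** \<theta> t) has_derivative (\<lambda>t. z ** (t *\<^sub>R X))) (at 0)"
    by (rule bounded_linear.has_derivative[OF bounded_linear_matrix_mult_right \<theta>(3)])
  then show thesis
    by (intro that[of "\<lambda>t. z ** \<theta> t"])
      (use \<theta> assms(1) SU_mult in \<open>auto simp: has_vector_derivative_def matrix_mult_simps\<close>)
qed

text \<open>The identities to be differentiated hold on \<open>SU\<close> only, which has no
  interior in the matrix space. Pulled back to curves in \<open>SU\<close> they may still be
  differentiated in the directions \<open>z ** X\<close>; the computations with lifted charts rest
  on this.\<close>

lemma derivative_vanishes_on_SU:
  fixes f :: "complex^'n^'n \<Rightarrow> 'b::real_normed_vector"
  assumes "(f has_derivative f') (at z)" "z \<in> SU" "open V" "z \<in> V" "\<And>y. y \<in> V \<inter> SU \<Longrightarrow> f y = c" "X \<in> su"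
  shows "f' (z ** X) = 0"
proof -
  obtain k where k: "\<And>t. k t \<in> SU" "k 0 = z" "(k has_vector_derivative z ** X) (at 0)"
    using tangent_curve_SU[OF assms(2,6)] by blast
  have "isCont k 0"
    using k(3) has_vector_derivative_continuous by blast
  then have "\<forall>\<^sub>F t in at 0. k t \<in> V"
    using assms(3,4) k(2) unfolding isCont_def by (auto dest: topological_tendstoD)
  then have "\<forall>\<^sub>F t in at 0. f (k t) = f (k 0)"
    by eventually_elim (use assms k in auto)
  then show ?thesis
    using derivative_vanishes_along_curve[of f f' k "z ** X"] assms(1) k by simp
qed

section \<open>The quadratic form \<open>\<Sum>\<^sub>j w\<^sub>j\<^sup>2\<close> on symmetric elements of the Lie algebra\<close>

definition bdot :: "complex^'n \<Rightarrow> complex^'n \<Rightarrow> complex" where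
  "bdot u v = (\<Sum>j\<in>UNIV. u $ j * v $ j)"

lemma bounded_bilinear_bdot: "bounded_bilinear (bdot :: complex^'n \<Rightarrow> complex^'n \<Rightarrow> complex)"
proof -
  have "bilinear (bdot :: complex^'n \<Rightarrow> complex^'n \<Rightarrow> complex)"
    unfolding bilinear_def
    by (intro conjI allI linearI)
      (simp_all add: bdot_def scaleR_sum_right distrib_left distrib_right sum.distrib)
  then show ?thesis
    by (simp add: bilinear_conv_bounded_bilinear)
qed

lemmas bdot_simps =
  bounded_bilinear.add_left[OF bounded_bilinear_bdot] bounded_bilinear.add_right[OF bounded_bilinear_bdot]
  bounded_bilinear.zero_left[OF bounded_bilinear_bdot] bounded_bilinear.zero_right[OF bounded_bilinear_bdot]
  bounded_bilinear.scaleR_left[OF bounded_bilinear_bdot] bounded_bilinear.scaleR_right[OF bounded_bilinear_bdot]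

lemma bdot_commute: "bdot u v = bdot v u"
  by (simp add: bdot_def mult.commute)

lemma bounded_linear_vec_mat_mult: "bounded_linear (\<lambda>z :: complex^'n^'m. a v* z)"
  unfolding linear_conv_bounded_linear[symmetric]
  by (rule linearI)
    (simp_all add: vec_eq_iff vector_matrix_mult_def scaleR_sum_right distrib_left distrib_right sum.distrib)

lemma bounded_linear_vec_mat_mult_left: "bounded_linear (\<lambda>a. a v* (z :: complex^'n^'m))"
  unfolding linear_conv_bounded_linear[symmetric]
  by (rule linearI)
    (simp_all add: vec_eq_iff vector_matrix_mult_def scaleR_sum_right distrib_left distrib_right sum.distrib)

lemma bdot_transpose: "bdot (u v* X) v = bdot u (v v* transpose X)"
proof -
  have "bdot (u v* X) v = (\<Sum>j\<in>UNIV. \<Sum>i\<in>UNIV. X $ i $ j * u $ i * v $ j)"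
    by (simp add: bdot_def vector_matrix_mult_def sum_distrib_left sum_distrib_right ac_simps)
  also have "\<dots> = (\<Sum>i\<in>UNIV. \<Sum>j\<in>UNIV. X $ i $ j * u $ i * v $ j)"
    by (rule sum.swap)
  also have "\<dots> = bdot u (v v* transpose X)"
    by (simp add: bdot_def vector_matrix_mult_def sum_distrib_left transpose_def ac_simps)
  finally show ?thesis .
qed

lemma phi_hat_eq_bdot: "phi_hat a z = bdot (a v* z) (a v* z)"
proof -
  have "phi_hat a z = (\<Sum>i\<in>UNIV. \<Sum>j\<in>UNIV. (\<Sum>k\<in>UNIV. a $ i * a $ k * z $ k $ j) * z $ i $ j)"
    by (simp add: phi_hat_def Let_def trace_def matrix_matrix_mult_def transpose_def rowvector_def)
  also have "\<dots> = (\<Sum>j\<in>UNIV. \<Sum>i\<in>UNIV. (\<Sum>k\<in>UNIV. a $ i * a $ k * z $ k $ j) * z $ i $ j)"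
    by (rule sum.swap)
  also have "\<dots> = (\<Sum>j\<in>UNIV. (\<Sum>i\<in>UNIV. z $ i $ j * a $ i) * (\<Sum>k\<in>UNIV. z $ k $ j * a $ k))"
    by (simp add: sum_product sum_distrib_left sum_distrib_right ac_simps)
  finally show ?thesis
    by (simp add: bdot_def vector_matrix_mult_def mult.commute)
qed

lemma smooth_on_phi_hat: "smooth_on (phi_hat a :: complex^'n^'n \<Rightarrow> complex) UNIV"
proof -
  have "smooth_on (\<lambda>z :: complex^'n^'n. bdot (a v* z) (a v* z)) UNIV"
    by (rule smooth_on_bilinear[OF open_UNIV bounded_bilinear_bdot];
        rule smooth_on_bounded_linear[OF bounded_linear_vec_mat_mult])
  then show ?thesis
    using phi_hat_eq_bdot[of a] by presburger
qed

lemma has_derivative_phi_hat: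
  "(phi_hat a has_derivative (\<lambda>Z. 2 * bdot (a v* Z) (a v* z))) (at (z :: complex^'n^'n))"
proof -
  have L: "((\<lambda>z :: complex^'n^'n. a v* z) has_derivative (\<lambda>Z. a v* Z)) (at z)"
    by (rule bounded_linear_imp_has_derivative[OF bounded_linear_vec_mat_mult])
  have "((\<lambda>z :: complex^'n^'n. bdot (a v* z) (a v* z)) has_derivative
      (\<lambda>Z. bdot (a v* z) (a v* Z) + bdot (a v* Z) (a v* z))) (at z)"
    by (rule bounded_bilinear.FDERIV[OF bounded_bilinear_bdot L L])
  then show ?thesis
    unfolding phi_hat_eq_bdot[abs_def] by (simp add: bdot_commute[of "a v* z"])
qed

lemma phi_hat_left_invariant_derivative:
  "fderiv (phi_hat a) (z :: complex^'n^'n) (z ** X) = 2 * bdot (a v* z v* X) (a v* z)"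
  by (simp add: fderiv_eq[OF has_derivative_phi_hat] vector_matrix_mul_assoc)

text \<open>Symmetry of X lets it pass from one argument of \<open>bdot\<close> to the other, so
  both terms of the derivative along \<open>z ** X\<close> equal
  \<open>2 * bdot (w v* X) (w v* X)\<close>.\<close>

lemma phi_hat_left_invariant_second_derivative:
  fixes z X :: "complex^'n^'n" and a :: "complex^'n"
  assumes "transpose X = X"
  defines "w \<equiv> a v* z"
  shows "((\<lambda>z. fderiv (phi_hat a) z (z ** X)) has_derivative
      (\<lambda>Z. 2 * bdot (a v* (Z ** X)) w + 2 * bdot (w v* X) (a v* Z))) (at z)"
    "2 * bdot (a v* (z ** X ** X)) w + 2 * bdot (w v* X) (a v* (z ** X)) = 4 * bdot (w v* X) (w v* X)"
proof -
  have L: "((\<lambda>z :: complex^'n^'n. a v* z) has_derivative (\<lambda>Z. a v* Z)) (at z)"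
    by (rule bounded_linear_imp_has_derivative[OF bounded_linear_vec_mat_mult])
  have LX: "((\<lambda>z :: complex^'n^'n. a v* (z ** X)) has_derivative (\<lambda>Z. a v* (Z ** X))) (at z)"
    by (rule bounded_linear_imp_has_derivative[OF bounded_linear_compose[OF
            bounded_linear_vec_mat_mult bounded_linear_matrix_mult_left]])
  have "((\<lambda>z. 2 * bdot (a v* (z ** X)) (a v* z)) has_derivative
      (\<lambda>Z. 2 * (bdot (a v* (z ** X)) (a v* Z) + bdot (a v* (Z ** X)) (a v* z)))) (at z)"
    by (intro has_derivative_mult_right bounded_bilinear.FDERIV[OF bounded_bilinear_bdot LX L])
  then show "((\<lambda>z. fderiv (phi_hat a) z (z ** X)) has_derivative
      (\<lambda>Z. 2 * bdot (a v* (Z ** X)) w + 2 * bdot (w v* X) (a v* Z))) (at z)"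
    by (simp add: phi_hat_left_invariant_derivative w_def vector_matrix_mul_assoc algebra_simps)
  have "bdot (a v* (z ** X ** X)) w = bdot (w v* X) (w v* X)"
    using bdot_transpose[of "w v* X" X w] assms(1) by (simp add: w_def vector_matrix_mul_assoc)
  then show "2 * bdot (a v* (z ** X ** X)) w + 2 * bdot (w v* X) (a v* (z ** X)) = 4 * bdot (w v* X) (w v* X)"
    by (simp add: w_def vector_matrix_mul_assoc)
qed

text \<open>Together with \<open>real_su\<close> this is the Cartan decomposition for SU(n)/SO(n).
  Here is the horizontal part: the imaginary unit times the real symmetric matrices of trace
  zero.\<close>

definition sym_su :: "(complex^'n^'n) set" where
  "sym_su = {X\<in>su. transpose X = X}"

text \<open>A skew-symmetric element of \<open>su\<close> equals its own conjugate, so this is the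
  Lie algebra of SO(n), the vertical part.\<close>

definition real_su :: "(complex^'n^'n) set" where
  "real_su = {X\<in>su. transpose X = - X}"

lemma subspace_sym_su: "subspace (sym_su :: (complex^'n^'n) set)"
  using subspace_su unfolding sym_su_def
  by (auto simp: subspace_def transpose_def vec_eq_iff)

lemma sym_suD:
  assumes "X \<in> sym_su"
  shows "X \<in> su" "transpose X = X" "X $ i $ j = X $ j $ i" "Re (X $ i $ j) = 0"
    "X $ i $ j = \<i> * of_real (Im (X $ i $ j))"
proof -
  show X: "X \<in> su" "transpose X = X"
    using assms by (auto simp: sym_su_def)
  show s: "X $ i $ j = X $ j $ i"
    using X(2) by (simp add: vec_eq_iff transpose_def)
  have "cnj (X $ j $ i) = - (X $ i $ j)"
    using X(1) by (simp add: su_iff vec_eq_iff)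
  then show "Re (X $ i $ j) = 0"
    using s by (simp add: complex_eq_iff)
  then show "X $ i $ j = \<i> * of_real (Im (X $ i $ j))"
    by (simp add: complex_eq_iff)
qed

lemma su_decompose:
  assumes "X \<in> (su :: (complex^'n^'n) set)"
  obtains Y Z where "Y \<in> sym_su" "Z \<in> real_su" "X = Y + Z"
proof
  have tr: "trace (transpose X) = trace X"
    by (simp add: trace_def transpose_def)
  have "transpose X \<in> su"
    using assms tr by (simp add: su_iff) (simp add: vec_eq_iff transpose_def)
  then have "(1/2) *\<^sub>R (X + transpose X) \<in> su" "(1/2) *\<^sub>R (X - transpose X) \<in> su"
    using assms subspace_su by (auto intro!: subspace_scale subspace_add subspace_diff)
  then show "(1/2) *\<^sub>R (X + transpose X) \<in> sym_su" "(1/2) *\<^sub>R (X - transpose X) \<in> real_su"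
    by (auto simp: sym_su_def real_su_def vec_eq_iff transpose_def scaleR_diff_right)
  show "X = (1/2) *\<^sub>R (X + transpose X) + (1/2) *\<^sub>R (X - transpose X)"
    by (simp add: vec_eq_iff complex_eq_iff field_simps)
qed

text \<open>Exchanging the two matrix indices changes the sign of the sum.\<close>

lemma sym_su_orthogonal_real_su:
  assumes "X \<in> sym_su" "Y \<in> real_su"
  shows "X \<bullet> Y = 0"
proof -
  have "X \<bullet> Y = (\<Sum>i\<in>UNIV. \<Sum>j\<in>UNIV. Re (X $ i $ j * cnj (Y $ i $ j)))"
    by (rule inner_matrix)
  also have "\<dots> = (\<Sum>j\<in>UNIV. \<Sum>i\<in>UNIV. Re (X $ i $ j * cnj (Y $ i $ j)))"
    by (rule sum.swap)
  also have "\<dots> = (\<Sum>j\<in>UNIV. \<Sum>i\<in>UNIV. Re (X $ j $ i * - cnj (Y $ j $ i)))"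
  proof (intro sum.cong refl)
    fix i j
    have "transpose Y $ j $ i = - (Y $ j $ i)"
      using assms(2) by (simp add: real_su_def)
    then have "Y $ i $ j = - (Y $ j $ i)"
      by (simp add: transpose_def)
    then show "Re (X $ i $ j * cnj (Y $ i $ j)) = Re (X $ j $ i * - cnj (Y $ j $ i))"
      using sym_suD(3)[OF assms(1), of i j] by simp
  qed
  also have "\<dots> = - (X \<bullet> Y)"
    unfolding inner_matrix by (simp flip: sum_negf)
  finally show ?thesis
    by simp
qed

lemma inner_sym_su: "X \<in> sym_su \<Longrightarrow> Y \<in> sym_su \<Longrightarrow> X \<bullet> Y = (\<Sum>i\<in>UNIV. \<Sum>j\<in>UNIV. Im (X $ i $ j) * Im (Y $ i $ j))"
  by (simp add: inner_matrix sym_suD(4))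

lemma sym_suI:
  fixes f :: "'n::finite \<Rightarrow> 'n \<Rightarrow> real"
  assumes "\<And>i j. f i j = f j i" "(\<Sum>i\<in>UNIV. f i i) = 0"
  shows "(\<chi> i j. \<i> * of_real (f i j)) \<in> sym_su"
proof -
  have "(\<Sum>i\<in>UNIV. \<i> * complex_of_real (f i i)) = 0"
    using assms(2) by (metis mult_zero_right of_real_0 of_real_sum sum_distrib_left)
  then show ?thesis
    using assms(1) by (simp add: sym_su_def su_iff vec_eq_iff transpose_def trace_def)
qed

lemma inner_product_inner: "inner_product ((\<bullet>) :: 'a::euclidean_space \<Rightarrow> 'a \<Rightarrow> real)"
  by (auto simp: inner_product_def inner_commute bilinear_def linear_conv_bounded_linear
      bounded_linear_inner_left bounded_linear_inner_right)

section \<open>Contractions over orthonormal bases of the symmetric part\<close>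

lemma sum_Kronecker:
  fixes f :: "'n::finite \<Rightarrow> 'a::semiring_0"
  shows "(\<Sum>i\<in>UNIV. (if i = a then c else 0) * f i) = c * f a" "(\<Sum>i\<in>UNIV. (if a = i then c else 0) * f i) = c * f a"
    "(\<Sum>i\<in>UNIV. f i * (if i = a then c else 0)) = f a * c" "(\<Sum>i\<in>UNIV. f i * (if a = i then c else 0)) = f a * c"
  by (simp_all add: if_distrib[of "\<lambda>x. x * _"] if_distrib[of "\<lambda>x. _ * x"] cong: if_cong)

abbreviation kron :: "'n \<Rightarrow> 'n \<Rightarrow> real" where
  "kron a b \<equiv> (if a = b then 1 else 0)"

text \<open>Coefficients of the orthogonal projection of real matrices onto the symmetric ones of
  trace zero: the first term symmetrizes, the second removes the trace, n being the squared norm of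
  the identity matrix.\<close>

definition sym_coefficient :: "'n::finite \<Rightarrow> 'n \<Rightarrow> 'n \<Rightarrow> 'n \<Rightarrow> real" where
  "sym_coefficient a b c d =
     (kron a c * kron b d + kron a d * kron b c) / 2 - kron a b * kron c d / real CARD('n)"

lemma sym_coefficient_contract:
  fixes f :: "'n::finite \<Rightarrow> 'n \<Rightarrow> 'a::real_field"
  shows "(\<Sum>c\<in>UNIV. \<Sum>d\<in>UNIV. f c d * of_real (sym_coefficient a b c d))
    = (f a b + f b a) / 2 - (if a = b then (\<Sum>c\<in>UNIV. f c c) / of_nat CARD('n) else 0)"
proof -
  have "(\<Sum>d\<in>UNIV. f c d * of_real (sym_coefficient a b c d))
      = (f c b / 2) * (if a = c then 1 else 0) + (f c a / 2) * (if b = c then 1 else 0)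
        - f c c * (if a = b then 1 / of_nat CARD('n) else 0)" for c
  proof -
    have "f c d * of_real (sym_coefficient a b c d)
      = ((f c d / 2) * (if a = c then 1 else 0)) * (if b = d then 1 else 0)
        + ((f c d / 2) * (if b = c then 1 else 0)) * (if a = d then 1 else 0)
        - (f c d * (if a = b then 1 / of_nat CARD('n) else 0)) * (if c = d then 1 else 0)" for d
      by (auto simp: sym_coefficient_def field_simps)
    then show ?thesis
      by (simp only: sum.distrib sum_subtractf sum_Kronecker mult_1_right)
  qed
  then have "(\<Sum>c\<in>UNIV. \<Sum>d\<in>UNIV. f c d * of_real (sym_coefficient a b c d))
      = f a b / 2 + f b a / 2 - (\<Sum>c\<in>UNIV. f c c) * (if a = b then 1 / of_nat CARD('n) else 0)"
    by (simp only: sum.distrib sum_subtractf sum_Kronecker mult_1_right sum_distrib_right[symmetric])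
  then show ?thesis
    by (simp add: add_divide_distrib)
qed

text \<open>The entry \<open>Im X\<^sub>a\<^sub>b\<close> is the inner product of \<open>X\<close> with the projection of \<open>\<i> E\<^sub>a\<^sub>b\<close>, so Parseval's identity
  gives the sum of products of entries without choosing a basis.\<close>

lemma sum_entries_orthonormal_basis:
  assumes E: "orthonormal_basis_of (\<bullet>) (sym_su :: (complex^'n^'n) set) E"
  shows "(\<Sum>e\<in>E. Im (e $ a $ b) * Im (e $ c $ d)) = sym_coefficient a b c d"
proof -
  define P where "P a b = (\<chi> i j. \<i> * complex_of_real (sym_coefficient a b i j))" for a b :: 'n
  have P: "P a b \<in> sym_su" for a b
    unfolding P_def
  proof (rule sym_suI)
    show "sym_coefficient a b i j = sym_coefficient a b j i" for i j
      by (auto simp: sym_coefficient_def)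
    show "(\<Sum>i\<in>UNIV. sym_coefficient a b i i) = 0"
      by (simp add: sym_coefficient_def sum_subtractf sum_Kronecker sum.distrib flip: sum_divide_distrib)
  qed
  have entry: "X \<bullet> P a b = Im (X $ a $ b)" if X: "X \<in> sym_su" for X a b
  proof -
    have tr: "(\<Sum>i\<in>UNIV. Im (X $ i $ i)) = 0"
      using sym_suD(1)[OF X] by (simp add: su_iff trace_def flip: Im_sum)
    have "X \<bullet> P a b = (\<Sum>i\<in>UNIV. \<Sum>j\<in>UNIV. Im (X $ i $ j) * sym_coefficient a b i j)"
      using inner_sym_su[OF X P] by (simp add: P_def)
    also have "\<dots> = (Im (X $ a $ b) + Im (X $ b $ a)) / 2 - (if a = b then (\<Sum>i\<in>UNIV. Im (X $ i $ i)) / CARD('n) else 0)"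
      using sym_coefficient_contract[of "\<lambda>i j. Im (X $ i $ j)" a b] by simp
    also have "\<dots> = Im (X $ a $ b)"
      using sym_suD(3)[OF X, of b a] tr by simp
    finally show ?thesis .
  qed
  have EP: "e \<in> sym_su" if "e \<in> E" for e
    using E that by (auto simp: orthonormal_basis_of_def)
  have "P a b \<bullet> P c d = (\<Sum>e\<in>E. (P a b \<bullet> e) * (P c d \<bullet> e))"
    by (rule orthonormal_basis_parseval[OF inner_product_inner E P])
  also have "\<dots> = (\<Sum>e\<in>E. Im (e $ a $ b) * Im (e $ c $ d))"
    using entry[OF EP] by (intro sum.cong) (simp_all add: inner_commute)
  finally show ?thesis
    using entry[OF P, of a b c d] by (simp add: P_def)
qed

lemma sum_entries_orthonormal_basis_complex:
  assumes E: "orthonormal_basis_of (\<bullet>) (sym_su :: (complex^'n^'n) set) E"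
  shows "(\<Sum>e\<in>E. e $ a $ b * e $ c $ d) = - of_real (sym_coefficient a b c d)"
proof -
  have "(\<Sum>e\<in>E. e $ a $ b * e $ c $ d) = (\<Sum>e\<in>E. - of_real (Im (e $ a $ b) * Im (e $ c $ d)))"
  proof (rule sum.cong[OF refl])
    fix e assume "e \<in> E"
    then have "e \<in> sym_su"
      using E by (auto simp: orthonormal_basis_of_def)
    then show "e $ a $ b * e $ c $ d = - of_real (Im (e $ a $ b) * Im (e $ c $ d))"
      using sym_suD(4)[of e] by (simp add: complex_eq_iff)
  qed
  also have "\<dots> = - of_real (\<Sum>e\<in>E. Im (e $ a $ b) * Im (e $ c $ d))"
    by (simp only: sum_negf of_real_sum)
  finally show ?thesis
    by (simp only: sum_entries_orthonormal_basis[OF E])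
qed

text \<open>The sum of \<open>e ** e\<close> over E is a multiple of the identity: summing
  \<open>sym_coefficient a j b j\<close> over j gives n/2 + 1/2 - 1/n times the Kronecker symbol of
  a and b. The minus sign comes from the imaginary entries.\<close>

lemma trace_bdot_square:
  fixes w :: "complex^'n"
  assumes E: "orthonormal_basis_of (\<bullet>) (sym_su :: (complex^'n^'n) set) E"
  shows "(\<Sum>e\<in>E. bdot (w v* e) (w v* e)) =
    - of_real (real CARD('n) / 2 + 1 / 2 - 1 / real CARD('n)) * bdot w w"
proof -
  let ?n = "real CARD('n)"
  have "(\<Sum>e\<in>E. bdot (w v* e) (w v* e))
      = (\<Sum>e\<in>E. \<Sum>j\<in>UNIV. \<Sum>a\<in>UNIV. \<Sum>b\<in>UNIV. w $ a * w $ b * (e $ a $ j * e $ b $ j))"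
    by (simp add: bdot_def vector_matrix_mult_def sum_product ac_simps)
  also have "\<dots> = (\<Sum>j\<in>UNIV. \<Sum>a\<in>UNIV. \<Sum>b\<in>UNIV. w $ a * w $ b * (\<Sum>e\<in>E. e $ a $ j * e $ b $ j))"
    unfolding sum_distrib_left
    by (subst sum.swap, rule sum.cong[OF refl], subst sum.swap, rule sum.cong[OF refl], rule sum.swap)
  also have "\<dots> = (\<Sum>j\<in>UNIV. \<Sum>a\<in>UNIV. - (w $ a * w $ a / 2 + (w $ a * w $ j * of_real (1 / 2 - 1 / ?n)) * (if a = j then 1 else 0)))"
  proof (intro sum.cong refl)
    fix a j
    \<comment> \<open>The index d, tied to j by a Kronecker symbol, brings the single sum into the
      double form to which \<open>sym_coefficient_contract\<close> applies.\<close>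
    have "(\<Sum>b\<in>UNIV. w $ a * w $ b * of_real (sym_coefficient a j b j))
      = (\<Sum>b\<in>UNIV. \<Sum>d\<in>UNIV. (w $ a * w $ b * (if d = j then 1 else 0)) * of_real (sym_coefficient a j b d))"
    proof (rule sum.cong[OF refl])
      fix b
      have "(w $ a * w $ b * (if d = j then 1 else 0)) * of_real (sym_coefficient a j b d)
        = (w $ a * w $ b * of_real (sym_coefficient a j b d)) * (if d = j then 1 else 0)" for d
        by simp
      then show "w $ a * w $ b * of_real (sym_coefficient a j b j)
        = (\<Sum>d\<in>UNIV. (w $ a * w $ b * (if d = j then 1 else 0)) * of_real (sym_coefficient a j b d))"
        by (simp only: sum_Kronecker mult_1_right)
    qed
    also have "\<dots> = (w $ a * w $ a + w $ a * w $ j * (if a = j then 1 else 0)) / 2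
        - (if a = j then (\<Sum>c\<in>UNIV. w $ a * w $ c * (if c = j then 1 else 0)) / of_nat CARD('n) else 0)"
      unfolding sym_coefficient_contract by simp
    also have "\<dots> = w $ a * w $ a / 2 + (w $ a * w $ j * of_real (1 / 2 - 1 / ?n)) * (if a = j then 1 else 0)"
      unfolding sum_Kronecker by (simp add: algebra_simps)
    finally show "(\<Sum>b\<in>UNIV. w $ a * w $ b * (\<Sum>e\<in>E. e $ a $ j * e $ b $ j))
      = - (w $ a * w $ a / 2 + (w $ a * w $ j * of_real (1 / 2 - 1 / ?n)) * (if a = j then 1 else 0))"
      by (simp add: sum_entries_orthonormal_basis_complex[OF E] sum_negf)
  qed
  also have "\<dots> = (\<Sum>j\<in>UNIV. - (bdot w w / 2 + w $ j * w $ j * of_real (1 / 2 - 1 / ?n)))"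
    by (simp only: sum_negf sum.distrib sum_Kronecker mult_1_right bdot_def sum_divide_distrib)
  also have "\<dots> = - (of_nat CARD('n) * (bdot w w / 2) + bdot w w * of_real (1 / 2 - 1 / ?n))"
    by (simp only: sum_negf sum.distrib sum_distrib_right[symmetric] bdot_def sum_constant)
  finally show ?thesis
    by (simp add: algebra_simps)
qed

lemma bdot_matrix: "bdot (u v* X) v = (\<Sum>i\<in>UNIV. \<Sum>j\<in>UNIV. u $ i * v $ j * X $ i $ j)"
  by (subst sum.swap) (simp add: bdot_def vector_matrix_mult_def sum_distrib_left ac_simps)

lemma sum_UNIV_prod: "(\<Sum>p\<in>(UNIV :: ('a::finite \<times> 'b::finite) set). f p) = (\<Sum>a\<in>UNIV. \<Sum>b\<in>UNIV. f (a, b))"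
  by (simp add: sum.cartesian_product)

text \<open>\<open>sym_coefficient\<close> is contracted with four copies of w: the symmetrizing
  term gives \<open>(bdot w w)\<^sup>2\<close>, and the trace term subtracts 1/n of it.\<close>

lemma trace_bdot_derivative:
  fixes w :: "complex^'n"
  assumes E: "orthonormal_basis_of (\<bullet>) (sym_su :: (complex^'n^'n) set) E"
  shows "(\<Sum>e\<in>E. (bdot (w v* e) w)\<^sup>2) = - of_real (1 - 1 / real CARD('n)) * (bdot w w)\<^sup>2"
proof -
  let ?n = "real CARD('n)"
  let ?q = "\<lambda>a b. w $ a * w $ b"
  \<comment> \<open>A pair of matrix indices is treated as one index, so that the square is a double
    sum and two swaps bring the sum over E inside.\<close>
  have "(\<Sum>e\<in>E. (bdot (w v* e) w)\<^sup>2)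
      = (\<Sum>e\<in>E. \<Sum>p\<in>UNIV. \<Sum>q\<in>UNIV. (?q (fst p) (snd p) * ?q (fst q) (snd q)) * (e $ fst p $ snd p * e $ fst q $ snd q))"
  proof (rule sum.cong[OF refl])
    fix e :: "complex^'n^'n"
    have "bdot (w v* e) w = (\<Sum>p\<in>UNIV. ?q (fst p) (snd p) * e $ fst p $ snd p)"
      by (simp add: bdot_matrix sum_UNIV_prod)
    then show "(bdot (w v* e) w)\<^sup>2 = (\<Sum>p\<in>UNIV. \<Sum>q\<in>UNIV. (?q (fst p) (snd p) * ?q (fst q) (snd q)) * (e $ fst p $ snd p * e $ fst q $ snd q))"
      by (simp add: power2_eq_square sum_product ac_simps)
  qed
  also have "\<dots> = (\<Sum>p\<in>UNIV. \<Sum>q\<in>UNIV. (?q (fst p) (snd p) * ?q (fst q) (snd q)) * (\<Sum>e\<in>E. e $ fst p $ snd p * e $ fst q $ snd q))"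
    unfolding sum_distrib_left
    by (subst sum.swap, rule sum.cong[OF refl], rule sum.swap)
  also have "\<dots> = (\<Sum>a\<in>UNIV. \<Sum>b\<in>UNIV. \<Sum>c\<in>UNIV. \<Sum>d\<in>UNIV. - (?q a b * ?q c d * of_real (sym_coefficient a b c d)))"
    by (simp add: sum_entries_orthonormal_basis_complex[OF E] sum_UNIV_prod)
  also have "\<dots> = (\<Sum>a\<in>UNIV. \<Sum>b\<in>UNIV. - (?q a a * ?q b b - (?q a b * (bdot w w / of_real ?n)) * (if a = b then 1 else 0)))"
  proof (intro sum.cong refl)
    fix a b
    have "(\<Sum>c\<in>UNIV. x * ?q c c) = x * bdot w w" for x
      by (simp only: bdot_def sum_distrib_left)
    then show "(\<Sum>c\<in>UNIV. \<Sum>d\<in>UNIV. - (?q a b * ?q c d * of_real (sym_coefficient a b c d)))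
        = - (?q a a * ?q b b - (?q a b * (bdot w w / of_real ?n)) * (if a = b then 1 else 0))"
      unfolding sum_negf sym_coefficient_contract by simp
  qed
  also have "\<dots> = (\<Sum>a\<in>UNIV. - ((\<Sum>b\<in>UNIV. ?q a a * ?q b b) - ?q a a * (bdot w w / of_real ?n)))"
    by (simp only: sum_negf sum_subtractf sum_Kronecker mult_1_right)
  also have "\<dots> = - (bdot w w * bdot w w - bdot w w * (bdot w w / of_real ?n))"
  proof -
    have "(\<Sum>a\<in>UNIV. \<Sum>b\<in>UNIV. ?q a a * ?q b b) = bdot w w * bdot w w"
      "(\<Sum>a\<in>UNIV. ?q a a * c) = bdot w w * c" for c
      unfolding bdot_def by (rule sum_product[symmetric], rule sum_distrib_right[symmetric])
    then show ?thesis
      by (simp only: sum_negf sum_subtractf)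
  qed
  finally show ?thesis
    by (simp add: power2_eq_square algebra_simps)
qed

text \<open>With \<open>B\<^sub>1 = \<i> Re (w\<^sup>t w)\<close> and \<open>B\<^sub>2 = \<i> Im (w\<^sup>t w)\<close> the differential \<open>X \<mapsto> w X w\<^sup>t\<close> is
  \<open>\<i> \<langle>X, B\<^sub>1\<rangle> - \<langle>X, B\<^sub>2\<rangle>\<close>. If \<open>w w\<^sup>t = 0\<close>, then \<open>B\<^sub>1\<close> and \<open>B\<^sub>2\<close> are orthogonal of equal norm, and \<open>w B\<^sub>k\<close> is a
  multiple of the conjugate of \<open>w\<close>.\<close>

lemma null_vector_normal_frame:
  fixes w :: "complex^'n"
  assumes w: "w \<noteq> 0" "bdot w w = 0"
  obtains X1 X2 :: "complex^'n^'n" and r :: real where "X1 \<in> sym_su" "X2 \<in> sym_su" "X1 \<bullet> X1 = 1" "X2 \<bullet> X2 = 1" "X1 \<bullet> X2 = 0"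
    "r > 0" "\<And>X. X \<in> sym_su \<Longrightarrow> bdot (w v* X) w = of_real r * (\<i> * of_real (X \<bullet> X1) - of_real (X \<bullet> X2))"
    "bdot (w v* X1) (w v* X1) = 0" "bdot (w v* X2) (w v* X2) = 0"
proof -
  define B1 :: "complex^'n^'n" where "B1 = (\<chi> i j. \<i> * of_real (Re (w $ i * w $ j)))"
  define B2 :: "complex^'n^'n" where "B2 = (\<chi> i j. \<i> * of_real (Im (w $ i * w $ j)))"
  define s where "s = (\<Sum>i\<in>UNIV. (cmod (w $ i))\<^sup>2)"
  have "s > 0"
  proof -
    obtain i where "w $ i \<noteq> 0"
      using w(1) by (auto simp: vec_eq_iff)
    then show ?thesis
      unfolding s_def by (intro sum_pos2[of _ i]) auto
  qed
  have B: "B1 \<in> sym_su" "B2 \<in> sym_su"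
    unfolding B1_def B2_def using arg_cong[OF w(2), of Re] arg_cong[OF w(2), of Im]
    by (intro sym_suI; simp only: bdot_def Re_sum Im_sum zero_complex.sel mult.commute)+
  have bdot_eq: "bdot (w v* X) w = \<i> * of_real (X \<bullet> B1) - of_real (X \<bullet> B2)" if X: "X \<in> sym_su" for X
  proof -
    have "bdot (w v* X) w = (\<Sum>i\<in>UNIV. \<Sum>j\<in>UNIV. \<i> * of_real (Im (X $ i $ j) * Re (w $ i * w $ j))
        - of_real (Im (X $ i $ j) * Im (w $ i * w $ j)))"
      unfolding bdot_matrix using sym_suD(4)[OF X]
      by (intro sum.cong refl) (simp add: complex_eq_iff algebra_simps)
    then show ?thesis
      unfolding inner_sym_su[OF X B(1)] inner_sym_su[OF X B(2)]
      by (simp add: sum_subtractf sum_distrib_left B1_def B2_def)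
  qed
  have sc: "of_real s = (\<Sum>i\<in>UNIV. w $ i * cnj (w $ i))"
    by (simp add: s_def complex_mult_cnj cmod_power2)
  have wB1: "(w v* B1) $ j = \<i> * of_real s / 2 * cnj (w $ j)" and wB2: "(w v* B2) $ j = - of_real s / 2 * cnj (w $ j)" for j
  proof -
    \<comment> \<open>Real and imaginary parts are written through conjugates; the terms with
      \<open>w $ i * w $ i\<close> then sum to zero by \<open>bdot w w = 0\<close>, and the others
      sum to multiples of s.\<close>
    have "(w v* B1) $ j = (\<Sum>i\<in>UNIV. (\<i> / 2 * w $ j) * (w $ i * w $ i) + (\<i> / 2 * cnj (w $ j)) * (w $ i * cnj (w $ i)))"
      "(w v* B2) $ j = (\<Sum>i\<in>UNIV. (1 / 2 * w $ j) * (w $ i * w $ i) - (1 / 2 * cnj (w $ j)) * (w $ i * cnj (w $ i)))"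
      unfolding vector_matrix_mult_def B1_def B2_def
      by (auto intro!: sum.cong simp: complex_eq_iff field_simps)
    then show "(w v* B1) $ j = \<i> * of_real s / 2 * cnj (w $ j)" "(w v* B2) $ j = - of_real s / 2 * cnj (w $ j)"
      unfolding sum.distrib sum_subtractf sum_distrib_left[symmetric] sc[symmetric] w(2)[unfolded bdot_def]
      by simp_all
  qed
  have null: "bdot (w v* B) w = c * of_real s" "bdot (w v* B) (w v* B) = 0" if "\<And>j. (w v* B) $ j = c * cnj (w $ j)" for B c
  proof -
    show "bdot (w v* B) w = c * of_real s"
      by (simp add: bdot_def that sc sum_distrib_left ac_simps)
    have "bdot (w v* B) (w v* B) = c\<^sup>2 * cnj (bdot w w)"
      by (simp add: bdot_def that sum_distrib_left power2_eq_square ac_simps)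
    then show "bdot (w v* B) (w v* B) = 0"
      by (simp add: w(2))
  qed
  \<comment> \<open>Evaluating \<open>bdot_eq\<close> at B1 and B2 themselves and comparing real and
    imaginary parts gives all three inner products.\<close>
  have i: "B1 \<bullet> B1 = s\<^sup>2 / 2" "B1 \<bullet> B2 = 0" "B2 \<bullet> B2 = s\<^sup>2 / 2"
    using null(1)[OF wB1] null(1)[OF wB2] unfolding bdot_eq[OF B(1)] bdot_eq[OF B(2)]
    by (auto simp: complex_eq_iff power2_eq_square)
  \<comment> \<open>The common norm of B1 and B2.\<close>
  define r where "r = s / sqrt 2"
  have "r > 0" and r2: "r * r = s\<^sup>2 / 2"
    using \<open>s > 0\<close> by (simp_all add: r_def power2_eq_square)
  note vm = linear_scale[OF bounded_linear.linear[OF bounded_linear_vec_mat_mult]]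
  have "(1 / r) *\<^sub>R B1 \<in> sym_su" "(1 / r) *\<^sub>R B2 \<in> sym_su"
    using B subspace_scale[OF subspace_sym_su] by blast+
  then show thesis
  proof (rule that[of "(1 / r) *\<^sub>R B1" "(1 / r) *\<^sub>R B2" r])
    show "bdot (w v* X) w = of_real r * (\<i> * of_real (X \<bullet> (1 / r) *\<^sub>R B1) - of_real (X \<bullet> (1 / r) *\<^sub>R B2))"
      if "X \<in> sym_su" for X
      unfolding bdot_eq[OF that] using \<open>r > 0\<close> by (simp add: algebra_simps)
  qed (use \<open>r > 0\<close> r2 \<open>s > 0\<close> i null(2)[OF wB1] null(2)[OF wB2] in \<open>auto simp: vm bdot_simps r2[symmetric]\<close>)
qed

text \<open>Polarization recovers the bilinear form from the quadratic one, and unit vectors then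
  read off the entries.\<close>

lemma bdot_zero_imp_zero:
  fixes X :: "complex^'n^'n"
  assumes X: "transpose X = X" and 0: "\<And>w. bdot (w v* X) w = 0"
  shows "X = 0"
proof -
  have "bdot (u v* X) v = 0" for u v
  proof -
    have "bdot (v v* X) u = bdot (u v* X) v"
      using bdot_transpose[of v X u] X bdot_commute by metis
    then show ?thesis
      using 0[of "u + v"] 0[of u] 0[of v]
      by (simp add: bdot_simps linear_add[OF bounded_linear.linear[OF bounded_linear_vec_mat_mult_left]])
  qed
  moreover have "bdot (axis i 1 v* X) (axis j 1) = X $ i $ j" for i j
  proof -
    have "axis i 1 $ k = (if k = i then 1 else 0 :: complex)" for i k :: 'n
      by (simp add: axis_def)
    then show ?thesis
      unfolding bdot_def vector_matrix_mult_def by (simp add: sum_Kronecker)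
  qed
  ultimately show ?thesis
    by (simp add: vec_eq_iff)
qed

section \<open>The quotient \<open>SU(n)/SO(n)\<close>\<close>

lemma real_su_subset_span:
  "(real_su :: (complex^'n^'n) set) \<subseteq> span {matrix_unit a b 1 - matrix_unit b a 1 |a b. a \<noteq> b}"
  (is "_ \<subseteq> span ?G")
proof
  fix X :: "complex^'n^'n" assume X: "X \<in> real_su"
  have T: "transpose X $ j $ i = - (X $ j $ i)" "conj_transpose X $ j $ i = - (X $ j $ i)" for i j
    using X by (simp_all add: real_su_def su_iff del: conj_transpose_nth)
  have skew: "X $ i $ j = - (X $ j $ i)" for i j
    using T(1)[of j i] by (simp add: transpose_def)
  have "cnj (X $ i $ j) = X $ i $ j" for i j
    using T(2)[of j i] skew[of i j] by simp
  then have "X $ i $ j \<in> \<real>" for i j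
    by (simp only: Reals_cnj_iff)
  then have real: "X $ i $ j = of_real (Re (X $ i $ j))" for i j
    by simp
  \<comment> \<open>By skew-symmetry the pairs (a, b) and (b, a) contribute the same matrix, whence
    the factor 1/2.\<close>
  define Y where "Y = (\<Sum>a\<in>UNIV. \<Sum>b\<in>UNIV. (Re (X $ a $ b) / 2) *\<^sub>R (matrix_unit a b 1 - matrix_unit b a 1))"
  have "Y $ i $ j = X $ i $ j" for i j
  proof -
    have "Y $ i $ j = (\<Sum>a\<in>UNIV. \<Sum>b\<in>UNIV. of_real (Re (X $ a $ b) / 2) * (if i = a then 1 else 0) * (if j = b then 1 else 0)
        - of_real (Re (X $ a $ b) / 2) * (if j = a then 1 else 0) * (if i = b then 1 else 0))"
      unfolding Y_def sum_component by (intro sum.cong refl) (simp add: matrix_unit_def scaleR_conv_of_real[where 'a = complex])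
    also have "\<dots> = (\<Sum>a\<in>UNIV. of_real (Re (X $ a $ j) / 2) * (if i = a then 1 else 0)
        - of_real (Re (X $ a $ i) / 2) * (if j = a then 1 else 0))"
      by (simp only: sum_subtractf sum_Kronecker mult_1_right)
    also have "\<dots> = of_real (Re (X $ i $ j) / 2) - of_real (Re (X $ j $ i) / 2)"
      by (simp only: sum_subtractf sum_Kronecker mult_1_right)
    also have "\<dots> = of_real (Re (X $ i $ j))"
      using arg_cong[OF skew[of j i], of Re] by (simp flip: of_real_diff add_divide_distrib)
    finally show ?thesis
      using real by simp
  qed
  then have "X = Y"
    by (simp add: vec_eq_iff)
  moreover have "matrix_unit a b 1 - matrix_unit b a 1 \<in> span ?G" for a b :: 'n
    by (cases "a = b") (auto intro: span_base span_zero)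
  then have "Y \<in> span ?G"
    unfolding Y_def by (intro span_sum span_scale)
  ultimately show "X \<in> span ?G"
    by simp
qed

text \<open>Multiplying z by such a curve stays inside one coset, which is how vertical vectors are
  recognized.\<close>

lemma tangent_curve_SO:
  fixes X :: "complex^'n^'n"
  assumes "X \<in> real_su"
  obtains k :: "real \<Rightarrow> complex^'n^'n" where "\<And>t. k t \<in> SO" "k 0 = mat 1" "(k has_vector_derivative X) (at 0)"
proof -
  let ?G = "{matrix_unit a b 1 - matrix_unit b a 1 |a b :: 'n. a \<noteq> b}"
  have "linear (\<lambda>t::real. t *\<^sub>R X)"
    by (auto intro!: linearI simp: scaleR_add_left)
  moreover have "range (\<lambda>t::real. t *\<^sub>R X) \<subseteq> span ?G"
    using assms real_su_subset_span by (auto intro: span_scale)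
  moreover have "\<exists>K. (\<forall>t. K t \<in> SO) \<and> K 0 = mat 1 \<and> smooth_on K UNIV \<and> (K has_derivative (\<lambda>t::real. t *\<^sub>R N)) (at 0)"
    if "N \<in> ?G" for N
  proof -
    have "N \<in> su_generators"
      using that by (force simp: su_generators_def)
    moreover have "\<forall>i j. N $ i $ j \<in> \<real>"
      using that by (auto simp: matrix_unit_def)
    ultimately show ?thesis
      using su_generator_curve by blast
  qed
  ultimately obtain \<theta> :: "real \<Rightarrow> complex^'n^'n" where "\<forall>x. \<theta> x \<in> SO" "\<theta> 0 = mat 1" "(\<theta> has_derivative (\<lambda>t. t *\<^sub>R X)) (at 0)"
    using subgroup_parametrization[of "\<lambda>t. t *\<^sub>R X" ?G SO] mat_1_in_SO SO_mult by blast
  then show thesis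
    by (intro that[of \<theta>]) (auto simp: has_vector_derivative_def)
qed

lemma proj_mult_SO:
  assumes "z \<in> (SU :: (complex^'n^'n) set)" "x \<in> SO"
  shows "proj (z ** x) = proj z"
proof -
  have inv: "conj_transpose x \<in> SO"
    using assms(2) SU_conj_transpose by (auto simp: SO_def Reals_cnj_iff)
  have xx: "x ** conj_transpose x = mat 1"
    using assms(2) SU_unitary by (auto simp: SO_def)
  show ?thesis
  proof
    show "proj (z ** x) \<subseteq> proj z"
      unfolding proj_def using SO_mult[OF assms(2)] by (auto simp flip: matrix_mul_assoc)
    show "proj z \<subseteq> proj (z ** x)"
    proof
      fix u assume "u \<in> proj z"
      then obtain y where y: "y \<in> SO" "u = z ** y"
        unfolding proj_def by blast
      then have "u = z ** x ** (conj_transpose x ** y)"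
        by (metis matrix_mul_assoc matrix_mul_lid xx)
      then show "u \<in> proj (z ** x)"
        unfolding proj_def using SO_mult[OF inv y(1)] by blast
    qed
  qed
qed

text \<open>\<open>x ** transpose x = mat 1\<close> for x in \<open>SO\<close>, so
  \<open>phi_hat a\<close> takes a single value on the coset, and \<open>the_elem\<close> returns
  it.\<close>

lemma phi_proj:
  assumes "z \<in> (SU :: (complex^'n^'n) set)"
  shows "phi a (proj z) = phi_hat a z"
proof -
  have "phi_hat a (z ** x) = phi_hat a z" if x: "x \<in> SO" for x
  proof -
    have "x ** transpose x = mat 1"
      using SO_transpose[OF x] SU_unitary(1)[of x] x by (simp add: SO_def)
    then have "a v* z v* x v* transpose x = a v* z"
      using vector_matrix_mul_assoc[of "a v* z" x "transpose x"] by (simp only: vector_matrix_mul_rid)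
    then have "bdot (a v* z v* x) (a v* z v* x) = bdot (a v* z) (a v* z)"
      using bdot_transpose[of "a v* z" x "a v* z v* x"] by metis
    then show ?thesis
      by (simp add: phi_hat_eq_bdot vector_matrix_mul_assoc)
  qed
  then have "phi_hat a ` proj z = {phi_hat a z}"
    unfolding proj_def using mat_1_in_SO by (auto simp: image_iff)
  then show ?thesis
    by (simp add: phi_def)
qed

section \<open>Topology of the quotient and compactness of the zero set\<close>

lemma topspace_quotient: "topspace quotient_topology = (SU_mod_SO :: (complex^'n^'n) set set)"
proof -
  have "openin quotient_topology (SU_mod_SO :: (complex^'n^'n) set set)"
  proof -
    have "{z\<in>(SU :: (complex^'n^'n) set). proj z \<in> SU_mod_SO} = SU"
      by (auto simp: SU_mod_SO_def)
    then show ?thesis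
      by (simp add: openin_quotient_topology)
  qed
  then show ?thesis
    by (metis openin_quotient_topology openin_subset openin_topspace subset_antisym)
qed

lemma continuous_map_proj: "continuous_map (top_of_set (SU :: (complex^'n^'n) set)) quotient_topology proj"
  unfolding continuous_map_def topspace_quotient
  by (auto simp: openin_quotient_topology SU_mod_SO_def)

lemma compact_zero_set:
  "compactin quotient_topology {q\<in>SU_mod_SO. phi (a :: complex^'n) q = 0}"
proof -
  let ?Z = "{z \<in> SU. phi_hat a z = 0}"
  have "?Z = SU \<inter> {z. phi_hat a z = 0}"
    by blast
  moreover have "closed {z. phi_hat a z = 0}"
    using smooth_on_continuous_on[OF smooth_on_phi_hat[of a]] by (intro closed_Collect_eq) auto
  ultimately have "compact ?Z"
    using compact_SU compact_Int_closed by metis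
  then have "compactin (top_of_set SU) ?Z"
    by (simp add: compactin_subtopology)
  then have "compactin quotient_topology (proj ` ?Z)"
    using image_compactin continuous_map_proj by blast
  moreover have "proj ` ?Z = {q\<in>SU_mod_SO. phi a q = 0}"
    unfolding SU_mod_SO_def by (auto simp: phi_proj)
  ultimately show ?thesis
    by simp
qed

section \<open>Lifting charts of the quotient to the matrix space\<close>

locale SU_quotient = riemannian_manifold quotient_topology \<A> g
  for \<A> :: "((complex^'n^'n) set, 'e::euclidean_space) chart set"
    and g :: "((complex^'n^'n) set, 'e) metric" +
  assumes submersion: "riemannian_submersion SU tangent_SU metric_SU \<A> g proj"
begin

text \<open>Smooth extensions \<open>F\<close> of \<open>snd C \<circ> proj\<close> to open sets of matrices: ambient derivatives of \<open>F\<close> along tangent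
  directions replace calculus on \<open>SU(n)\<close>.\<close>

definition chart_lift ::
    "((complex^'n^'n) set, 'e) chart \<Rightarrow> (complex^'n^'n) set \<Rightarrow> (complex^'n^'n \<Rightarrow> 'e) \<Rightarrow> bool" where
  "chart_lift C V F \<longleftrightarrow> open V \<and> smooth_on F V \<and> F ` V \<subseteq> chart_image C \<and>
     (\<forall>y\<in>V \<inter> SU. proj y \<in> fst C \<and> F y = snd C (proj y))"

lemma chart_metric: "C \<in> \<A> \<Longrightarrow> chart_metric (g C) (chart_image C)"
  using chart_homeo(2) metric_inner_product metric_smooth by unfold_locales auto

lemmas submersion_unfolded = submersion[unfolded riemannian_submersion_def]

lemma submersion_chart:
  assumes "C \<in> \<A>"
  shows "openin (top_of_set SU) {z\<in>SU. proj z \<in> fst C}"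
    "locally_smooth_extendable_on (snd C \<circ> proj) {z\<in>SU. proj z \<in> fst C}"
  using bspec[OF conjunct2[OF submersion_unfolded] assms] by simp_all

lemma submersion_derivative:
  assumes "C \<in> \<A>" "z \<in> SU" "proj z \<in> fst C"
  obtains D where "((snd C \<circ> proj) has_derivative D) (at z within SU)" "D ` tangent_SU z = UNIV"
    "\<And>X Y. X \<in> horizontal_space (metric_SU z) (tangent_SU z) D \<Longrightarrow>
       Y \<in> horizontal_space (metric_SU z) (tangent_SU z) D \<Longrightarrow>
       g C (snd C (proj z)) (D X) (D Y) = metric_SU z X Y"
proof -
  have *: "\<forall>z\<in>SU. proj z \<in> fst C \<longrightarrow>
     (\<exists>D. ((snd C \<circ> proj) has_derivative D) (at z within SU) \<and> D ` tangent_SU z = UNIV \<and>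
       (\<forall>X\<in>horizontal_space (metric_SU z) (tangent_SU z) D. \<forall>Y\<in>horizontal_space (metric_SU z) (tangent_SU z) D.
          g C (snd C (proj z)) (D X) (D Y) = metric_SU z X Y))"
    using bspec[OF conjunct2[OF submersion_unfolded] assms(1)] by (elim conjE)
  from mp[OF bspec[OF * assms(2)] assms(3)] show thesis
    using that by (elim exE conjE) (simp only: simp_thms ball_simps)
qed

lemma point_lift:
  assumes "C \<in> \<A>" "p \<in> fst C"
  obtains z where "z \<in> SU" "proj z = p"
proof -
  have "p \<in> proj ` SU"
    using assms conjunct1[OF submersion_unfolded] by (simp only: UN_iff) blast
  then show thesis
    using that by blast
qed

lemma chart_lift_exists:
  assumes C: "C \<in> \<A>" and z: "z \<in> SU" "proj z \<in> fst C"
  obtains V F where "chart_lift C V F" "z \<in> V"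
proof -
  have "z \<in> {z\<in>SU. proj z \<in> fst C}"
    using z by simp
  from bspec[OF submersion_chart(2)[OF C, unfolded locally_smooth_extendable_on_def] this]
  obtain V F where V: "open V" "z \<in> V" "smooth_on F V"
    "\<And>y. y \<in> V \<inter> {z\<in>SU. proj z \<in> fst C} \<Longrightarrow> F y = (snd C \<circ> proj) y"
    by (elim exE conjE) (simp only: Ball_def)
  obtain T where T: "open T" "{z\<in>SU. proj z \<in> fst C} = SU \<inter> T"
    using submersion_chart(1)[OF C] unfolding openin_open by blast
  \<comment> \<open>Shrinking makes V' meet \<open>SU\<close> only over the domain of C and keeps
    the values of F inside the chart image, also off \<open>SU\<close>.\<close>
  define V' where "V' = T \<inter> (V \<inter> F -` chart_image C)"
  have "open V'"
    unfolding V'_def using T(1) V(1) smooth_on_continuous_on[OF V(3)] chart_homeo(2)[OF C]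
    by (intro open_Int continuous_open_preimage[of V F, simplified Int_commute]) auto
  moreover have "F z = snd C (proj z)"
    using V(4) z V(2) by auto
  then have "F z \<in> chart_image C"
    using z by (simp add: chart_image_def)
  then have "z \<in> V'"
    using z V(2) T(2) by (auto simp: V'_def)
  moreover have "smooth_on F V'"
    using V(3) by (rule smooth_on_subset) (auto simp: V'_def)
  ultimately show thesis
    using V(4) T(2) by (intro that[of V' F]) (auto simp: chart_lift_def V'_def)
qed

text \<open>D is a derivative within \<open>SU\<close>, the other one is ambient, so they are
  compared on tangent vectors only: along a curve in \<open>SU\<close> with velocity
  \<open>z ** X\<close> the two functions coincide near z.\<close>

lemma lift_derivative_eq:
  assumes L: "chart_lift C V F" and z: "z \<in> V" "z \<in> SU" and X: "X \<in> su"
    and D: "((snd C \<circ> proj) has_derivative D) (at z within SU)"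
  shows "D (z ** X) = fderiv F z (z ** X)"
proof -
  obtain k where k: "\<And>t. k t \<in> SU" "k 0 = z" "(k has_vector_derivative z ** X) (at 0)"
    using tangent_curve_SU[OF z(2) X] by blast
  have Fd: "(F has_derivative fderiv F z) (at z)"
    using L z smooth_onD by (auto simp: chart_lift_def)
  have 1: "((\<lambda>t. F (k t)) has_derivative (\<lambda>t. fderiv F z (t *\<^sub>R (z ** X)))) (at 0)"
    using has_derivative_compose[of k "\<lambda>t. t *\<^sub>R (z ** X)" 0 UNIV F] k(2,3) Fd
    by (simp add: has_vector_derivative_def)
  have "((snd C \<circ> proj) has_derivative D) (at (k 0) within range k)"
    using has_derivative_subset[OF D, of "range k"] k(1,2) by auto
  then have "((\<lambda>t. (snd C \<circ> proj) (k t)) has_derivative (\<lambda>t. D (t *\<^sub>R (z ** X)))) (at 0)"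
    using has_derivative_in_compose[of k "\<lambda>t. t *\<^sub>R (z ** X)" 0 UNIV "snd C \<circ> proj" D] k(3)
    by (simp add: has_vector_derivative_def)
  moreover have "\<forall>\<^sub>F t in at 0. k t \<in> V"
    using k(2,3) z L has_vector_derivative_continuous[OF k(3)]
    by (auto simp: chart_lift_def isCont_def dest: topological_tendstoD)
  then have "\<forall>\<^sub>F t in at 0. (snd C \<circ> proj) (k t) = F (k t)"
    by eventually_elim (use L k(1) in \<open>auto simp: chart_lift_def\<close>)
  moreover have "(snd C \<circ> proj) (k 0) = F (k 0)"
    using L z k(2) by (auto simp: chart_lift_def)
  ultimately have "((\<lambda>t. F (k t)) has_derivative (\<lambda>t. D (t *\<^sub>R (z ** X)))) (at 0)"
    by (rule has_derivative_transform_eventually) simp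
  from fun_cong[OF has_derivative_unique[OF this 1], of 1] show ?thesis
    by simp
qed

lemma lift_surj:
  assumes C: "C \<in> \<A>" and L: "chart_lift C V F" and z: "z \<in> V" "z \<in> SU"
  obtains X where "X \<in> su" "fderiv F z (z ** X) = v"
proof -
  have "proj z \<in> fst C"
    using L z by (auto simp: chart_lift_def)
  then obtain D where D: "((snd C \<circ> proj) has_derivative D) (at z within SU)" "D ` tangent_SU z = UNIV"
    using submersion_derivative[OF C z(2)] by metis
  then have "v \<in> D ` (\<lambda>X. z ** X) ` su"
    by (simp add: tangent_SU_def)
  then obtain X where "X \<in> su" "D (z ** X) = v"
    by blast
  then show thesis
    using that[of X] lift_derivative_eq[OF L z _ D(1), of X] by simp
qed

text \<open>A local section of \<open>proj\<close> reduces the claim to \<open>phi_hat a\<close>.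
  Lifting a basis through the surjective differential gives a map \<open>\<rho>\<close> into
  \<open>SU\<close> for which \<open>F \<circ> \<rho>\<close> has derivative \<open>id\<close> at 0;
  with its local inverse \<open>\<eta>\<close>, the chart expression of \<open>phi a\<close> is
  \<open>phi_hat a \<circ> \<rho> \<circ> \<eta>\<close>.\<close>

lemma smooth_phi: "C \<in> \<A> \<Longrightarrow> smooth_on (phi a \<circ> chart_inv C) (chart_image C)"
proof (rule smooth_on_local)
  fix x0 assume C: "C \<in> \<A>" and "x0 \<in> chart_image C"
  then obtain p where p: "p \<in> fst C" "x0 = snd C p"
    by (auto simp: chart_image_def)
  obtain z where z: "z \<in> SU" "proj z = p"
    using point_lift[OF C p(1)] by blast
  obtain V F where L: "chart_lift C V F" "z \<in> V"
    using chart_lift_exists[OF C z(1)] z p by blast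
  then have V: "open V" "smooth_on F V" "F ` V \<subseteq> chart_image C"
    "\<And>y. y \<in> V \<inter> SU \<Longrightarrow> proj y \<in> fst C \<and> F y = snd C (proj y)"
    by (auto simp: chart_lift_def)
  let ?F' = "fderiv F z"
  have "\<exists>X. X \<in> su \<and> ?F' (z ** X) = b" for b
    using lift_surj[OF C L z(1)] by metis
  then obtain X where X: "\<And>b. X b \<in> su" "\<And>b. ?F' (z ** X b) = b"
    by metis
  define \<Lambda> where "\<Lambda> v = (\<Sum>b\<in>Basis. (v \<bullet> b) *\<^sub>R X b)" for v
  have lin\<Lambda>: "linear \<Lambda>"
    by (rule linearI) (simp_all add: \<Lambda>_def inner_add_left scaleR_add_left sum.distrib scaleR_sum_right)
  moreover have "range \<Lambda> \<subseteq> su"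
    using X(1) subspace_su unfolding \<Lambda>_def by (auto intro!: subspace_sum subspace_scale)
  ultimately obtain \<theta> where \<theta>: "\<forall>x. \<theta> x \<in> SU" "\<theta> 0 = mat 1" "smooth_on \<theta> UNIV" "(\<theta> has_derivative \<Lambda>) (at 0)"
    using SU_parametrization by blast
  define \<rho> where "\<rho> x = z ** \<theta> x" for x
  have \<rho>: "smooth_on \<rho> UNIV" "\<rho> 0 = z" "\<And>x. \<rho> x \<in> SU" "(\<rho> has_derivative (\<lambda>v. z ** \<Lambda> v)) (at 0)"
    unfolding \<rho>_def using \<theta> z SU_mult
    by (auto intro!: smooth_on_bounded_linear_compose[OF open_UNIV bounded_linear_matrix_mult_right]
        bounded_linear.has_derivative[OF bounded_linear_matrix_mult_right])
  define S where "S = \<rho> -` V"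
  have S: "open S" "0 \<in> S"
    unfolding S_def using V(1) L(2) \<rho>(2) smooth_on_continuous_on[OF \<rho>(1)] by (auto intro: open_vimage)
  have Fd: "(F has_derivative ?F') (at z)"
    using smooth_onD[OF V(2) L(2)] .
  have linF: "linear (\<lambda>Y. ?F' (z ** Y))"
    using linear_compose[OF bounded_linear.linear[OF bounded_linear_matrix_mult_right[of z]] has_derivative_linear[OF Fd]]
    by (simp add: comp_def)
  have "?F' (z ** \<Lambda> v) = v" for v
    unfolding \<Lambda>_def by (simp add: linear_sum[OF linF] linear_scale[OF linF] X euclidean_representation)
  then have "((\<lambda>x. F (\<rho> x)) has_derivative id) (at 0)"
    using has_derivative_compose[OF \<rho>(4), of F ?F'] \<rho>(2) Fd by (simp add: id_def)
  moreover have "smooth_on (\<lambda>x. F (\<rho> x)) S"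
    by (rule smooth_on_compose[OF S(1) _ smooth_on_subset[OF \<rho>(1)] V(2)]) (auto simp: S_def)
  ultimately obtain U' V' \<eta> where \<eta>: "open U'" "U' \<subseteq> S" "0 \<in> U'" "open V'" "F (\<rho> 0) \<in> V'"
    "homeomorphism U' V' (\<lambda>x. F (\<rho> x)) \<eta>" "smooth_on \<eta> V'"
    using smooth_inverse_function[OF S(1) _ S(2), of "\<lambda>x. F (\<rho> x)" id] by auto
  have x0: "F (\<rho> 0) = x0"
    using V(4)[of z] L(2) z p \<rho>(2) by auto
  have "smooth_on (\<lambda>y. phi_hat a (\<rho> (\<eta> y))) V'"
    by (intro smooth_on_compose[OF \<eta>(4) _ _ smooth_on_phi_hat] smooth_on_compose[OF \<eta>(4) _ \<eta>(7) \<rho>(1)]) auto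
  moreover have "phi_hat a (\<rho> (\<eta> y)) = (phi a \<circ> chart_inv C) y" if "y \<in> V'" for y
  proof -
    have "\<eta> y \<in> U'" "F (\<rho> (\<eta> y)) = y"
      using \<eta>(6) that by (auto simp: homeomorphism_def)
    then have "\<rho> (\<eta> y) \<in> V \<inter> SU"
      using \<eta>(2) \<rho>(3) by (auto simp: S_def)
    then have "chart_inv C y = proj (\<rho> (\<eta> y))"
      using V(4) chart_inverse[OF C] \<open>F (\<rho> (\<eta> y)) = y\<close> by metis
    then show ?thesis
      by (simp add: phi_proj \<rho>(3))
  qed
  ultimately have "smooth_on (phi a \<circ> chart_inv C) V'"
    by (rule smooth_on_cong[OF \<eta>(4), rotated])
  with \<eta>(4,5) x0 show "\<exists>V. open V \<and> x0 \<in> V \<and> smooth_on (phi a \<circ> chart_inv C) V"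
    by metis
qed

end

section \<open>Geometry of the quotient over one lifted chart\<close>

locale SU_quotient_lift = SU_quotient \<A> g
  for \<A> :: "((complex^'n^'n) set, 'e::euclidean_space) chart set"
    and g :: "((complex^'n^'n) set, 'e) metric" +
  fixes C and V and F
  assumes C: "C \<in> \<A>" and lift: "chart_lift C V F"
begin

lemma lift_simps:
  "open V" "smooth_on F V" "y \<in> V \<Longrightarrow> F y \<in> chart_image C"
  "y \<in> V \<Longrightarrow> y \<in> SU \<Longrightarrow> proj y \<in> fst C" "y \<in> V \<Longrightarrow> y \<in> SU \<Longrightarrow> F y = snd C (proj y)"
  using lift by (auto simp: chart_lift_def)

sublocale chart: chart_metric "g C" "chart_image C"
  using chart_metric[OF C] .

abbreviation phi_chart :: "complex^'n \<Rightarrow> 'e \<Rightarrow> complex" where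
  "phi_chart a \<equiv> phi a \<circ> chart_inv C"

text \<open>For z in \<open>SU\<close>, the image of the left-invariant field X at z in the
  coordinates of C. It is a function of z and not a vector field on the quotient, since in general
  it changes when z moves inside its coset.\<close>

definition field :: "complex^'n^'n \<Rightarrow> complex^'n^'n \<Rightarrow> 'e" where
  "field X z = fderiv F z (z ** X)"

lemma has_derivative_lift: "z \<in> V \<Longrightarrow> (F has_derivative fderiv F z) (at z)"
  using smooth_onD[OF lift_simps(2)] .

lemma linear_field: "z \<in> V \<Longrightarrow> linear (\<lambda>X. field X z)"
  unfolding field_def
  using linear_compose[OF bounded_linear.linear[OF bounded_linear_matrix_mult_right[of z]]
      has_derivative_linear[OF has_derivative_lift]]
  by (simp add: comp_def)

lemma phi_lift:
  assumes "y \<in> V" "y \<in> SU"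
  shows "phi_chart a (F y) = phi_hat a y"
  using assms by (simp add: lift_simps chart_inverse[OF C] phi_proj)

text \<open>The difference of \<open>phi_chart a \<circ> F\<close> and \<open>phi_hat a\<close>
  vanishes on \<open>SU\<close> near z, so its derivative along \<open>z ** X\<close> is
  zero.\<close>

lemma phi_lift_derivative:
  assumes z: "z \<in> V" "z \<in> SU" and X: "X \<in> su"
  shows "fderiv (phi_chart a) (F z) (field X z)
    = fderiv (phi_hat a) z (z ** X)"
proof -
  let ?h = "phi_chart a"
  have h: "(?h has_derivative fderiv ?h (F z)) (at (F z))"
    by (rule smooth_onD[OF smooth_phi[OF C] lift_simps(3)[OF z(1)]])
  have "((\<lambda>y. ?h (F y) - phi_hat a y) has_derivative
      (\<lambda>Z. fderiv ?h (F z) (fderiv F z Z) - fderiv (phi_hat a) z Z)) (at z)"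
    by (intro has_derivative_diff has_derivative_compose[OF has_derivative_lift[OF z(1)] h]
        smooth_onD[OF smooth_on_phi_hat]) simp
  from derivative_vanishes_on_SU[OF this z(2) lift_simps(1) z(1) _ X, of 0] show ?thesis
    using phi_lift by (simp add: field_def)
qed

text \<open>A curve \<open>z ** k t\<close> with \<open>k t\<close> in \<open>SO\<close> stays in
  the coset of z, and F is constant along it.\<close>

lemma field_real_su:
  assumes z: "z \<in> V" "z \<in> SU" and X: "X \<in> real_su"
  shows "field X z = 0"
proof -
  obtain k where k: "\<And>t. k t \<in> SO" "k 0 = mat 1" "(k has_vector_derivative X) (at 0)"
    using tangent_curve_SO[OF X] by blast
  have zk: "((\<lambda>t. z ** k t) has_vector_derivative z ** X) (at 0)"
    using bounded_linear.has_vector_derivative[OF bounded_linear_matrix_mult_right k(3)] .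
  have "\<forall>\<^sub>F t in at 0. z ** k t \<in> V"
    using has_vector_derivative_continuous[OF zk] lift_simps(1) z(1) k(2)
    by (auto simp: isCont_def dest: topological_tendstoD)
  then have "\<forall>\<^sub>F t in at 0. F (z ** k t) = F (z ** k 0)"
  proof eventually_elim
    case (elim t)
    have "z ** k t \<in> SU"
      using k(1)[of t] z(2) by (auto simp: SO_def intro: SU_mult)
    then show ?case
      using elim z k by (simp add: lift_simps proj_mult_SO)
  qed
  then show ?thesis
    unfolding field_def
    using derivative_vanishes_along_curve[of F _ "\<lambda>t. z ** k t", OF _ zk] has_derivative_lift[OF z(1)] k(2) by simp
qed

text \<open>The functions \<open>phi a\<close>, for varying \<open>a\<close>, separate the horizontal directions.\<close>

lemma field_sym_su_inj:
  assumes z: "z \<in> V" "z \<in> SU" and X: "X \<in> sym_su" "field X z = 0"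
  shows "X = 0"
proof (rule bdot_zero_imp_zero[OF sym_suD(2)[OF X(1)]])
  fix w
  define a where "a = w v* conj_transpose z"
  have az: "a v* z = w"
    by (simp add: a_def vector_matrix_mul_assoc SU_unitary[OF z(2)])
  have "linear (fderiv (phi_chart a) (F z))"
    using smooth_onD[OF smooth_phi[OF C] lift_simps(3)[OF z(1)]] has_derivative_linear by blast
  then have "fderiv (phi_hat a) z (z ** X) = 0"
    using phi_lift_derivative[OF z sym_suD(1)[OF X(1)], of a] X(2) by (simp add: linear_0)
  then show "bdot (w v* X) w = 0"
    by (simp add: phi_hat_left_invariant_derivative az)
qed

text \<open>With \<open>field_real_su\<close> this identifies the vertical space at z with
  \<open>real_su\<close>, so that \<open>sym_su\<close>, being orthogonal to it, is
  horizontal.\<close>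

lemma field_su_kernel:
  assumes z: "z \<in> V" "z \<in> SU" and Y: "Y \<in> su" "field Y z = 0"
  shows "Y \<in> real_su"
proof -
  obtain Y1 Y2 where Y12: "Y1 \<in> sym_su" "Y2 \<in> real_su" "Y = Y1 + Y2"
    using su_decompose[OF Y(1)] by blast
  then have "field Y1 z = 0"
    using Y(2) field_real_su[OF z Y12(2)] linear_add[OF linear_field[OF z(1)], of Y1 Y2] by simp
  then show ?thesis
    using field_sym_su_inj[OF z Y12(1)] Y12 by simp
qed

lemma field_isometry:
  assumes z: "z \<in> V" "z \<in> SU" and X: "X \<in> sym_su" "Y \<in> sym_su"
  shows "g C (F z) (field X z) (field Y z) = X \<bullet> Y"
proof -
  have pz: "proj z \<in> fst C" "F z = snd C (proj z)"
    using lift_simps z by auto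
  obtain D where D: "((snd C \<circ> proj) has_derivative D) (at z within SU)"
    "\<And>X Y. X \<in> horizontal_space (metric_SU z) (tangent_SU z) D \<Longrightarrow>
       Y \<in> horizontal_space (metric_SU z) (tangent_SU z) D \<Longrightarrow>
       g C (snd C (proj z)) (D X) (D Y) = metric_SU z X Y"
    using submersion_derivative[OF C z(2) pz(1)] by metis
  have DF: "D (z ** X) = field X z" if "X \<in> su" for X
    unfolding field_def by (rule lift_derivative_eq[OF lift z that D(1)])
  have hor: "z ** X \<in> horizontal_space (metric_SU z) (tangent_SU z) D" if "X \<in> sym_su" for X
  proof -
    have "metric_SU z (z ** X) Y = 0" if "Y \<in> tangent_SU z" "D Y = 0" for Y
    proof -
      obtain Y' where Y': "Y' \<in> su" "Y = z ** Y'"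
        using \<open>Y \<in> tangent_SU z\<close> by (auto simp: tangent_SU_def)
      then have "Y' \<in> real_su"
        using field_su_kernel[OF z] DF \<open>D Y = 0\<close> by metis
      then show ?thesis
        using sym_su_orthogonal_real_su[OF \<open>X \<in> sym_su\<close>]
        by (simp add: metric_SU_eq_inner[OF z(2)] Y' isometry_SU[OF z(2)])
    qed
    then show ?thesis
      using that sym_suD(1) by (auto simp: horizontal_space_def tangent_SU_def)
  qed
  have "g C (F z) (field X z) (field Y z) = metric_SU z (z ** X) (z ** Y)"
    using D(2)[OF hor hor, OF X] DF sym_suD(1)[OF X(1)] sym_suD(1)[OF X(2)] pz(2) by simp
  then show ?thesis
    by (simp add: metric_SU_eq_inner[OF z(2)] isometry_SU[OF z(2)])
qed

lemma field_surj:
  assumes z: "z \<in> V" "z \<in> SU"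
  obtains X where "X \<in> sym_su" "field X z = v"
proof -
  obtain X where X: "X \<in> su" "field X z = v"
    using lift_surj[OF C lift z] unfolding field_def by blast
  obtain X1 X2 where X12: "X1 \<in> sym_su" "X2 \<in> real_su" "X = X1 + X2"
    using su_decompose[OF X(1)] by blast
  then have "field X1 z = v"
    using X(2) field_real_su[OF z X12(2)] linear_add[OF linear_field[OF z(1)], of X1 X2] by simp
  with X12 that show thesis
    by blast
qed

text \<open>The element of interest is \<open>conj_transpose y ** Y ** y\<close>, which need not be
  symmetric. Its vertical part has zero image and is orthogonal to X, so it contributes to neither
  side.\<close>

lemma field_su_inner:
  assumes z: "z \<in> V" "z \<in> SU" and X: "X \<in> sym_su" and Y: "Y \<in> su"
  shows "g C (F z) (field X z) (field Y z) = X \<bullet> Y"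
proof -
  obtain Y1 Y2 where Y12: "Y1 \<in> sym_su" "Y2 \<in> real_su" "Y = Y1 + Y2"
    using su_decompose[OF Y] by blast
  then have "field Y z = field Y1 z"
    using field_real_su[OF z Y12(2)] linear_add[OF linear_field[OF z(1)], of Y1 Y2] by simp
  then show ?thesis
    using field_isometry[OF z X Y12(1)] sym_su_orthogonal_real_su[OF X Y12(2)] Y12(3) by (simp add: inner_add_right)
qed

lemma has_derivative_linear_field:
  assumes z: "z \<in> V" and L: "bounded_linear L"
  shows "((\<lambda>y. fderiv F y (L y)) has_derivative
    (\<lambda>\<zeta>. fderiv (\<lambda>y. fderiv F y (L z)) z \<zeta> + fderiv F z (L \<zeta>))) (at z)"
  using has_derivative_derivative_field[OF lift_simps(1,2) has_derivative_ident z bounded_linear_imp_has_derivative[OF L]] .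

text \<open>The curves \<open>t \<mapsto> proj (z exp (t X))\<close> are geodesics. With \<open>u\<close> the image of the left-invariant field \<open>X\<close>
  and \<open>v\<close> the image of a right-invariant field \<open>Y\<close>, both \<open>g(u, u)\<close> and \<open>g(u, v) = \<langle>X, z\<^sup>* Y z\<rangle>\<close> are known along
  \<open>SU(n)\<close>; since the two fields commute, differentiating the first along \<open>Y\<close> and the second along
  \<open>X\<close> determines \<open>\<Gamma>(u, u)\<close>.\<close>

lemma christoffel_field:
  assumes z: "z \<in> V" "z \<in> SU" and X: "X \<in> sym_su"
  shows "christoffel (g C) (F z) (field X z) (field X z) = - fderiv (field X) z (z ** X)"
proof (rule chart.christoffel_eqI[OF lift_simps(3)[OF z(1)]])
  fix v
  note Fz = lift_simps(3)[OF z(1)]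
  note [simp] = inner_productD[OF chart.ip[OF Fz]]
  obtain Y0 where Y0: "Y0 \<in> su" "field Y0 z = v"
    using field_surj[OF z, of v] sym_suD(1) by metis
  \<comment> \<open>Conjugation by z turns Y0 into the element whose right-invariant field, with
    value \<open>Y ** y\<close> at y, passes through \<open>z ** Y0\<close> at z.\<close>
  define Y where "Y = z ** Y0 ** conj_transpose z"
  have YY0: "conj_transpose z ** Y ** z = Y0" "Y ** z = z ** Y0"
    by (simp_all add: Y_def matrix_mul_assoc SU_unitary[OF z(2)])
      (simp_all add: matrix_mul_assoc[symmetric] SU_unitary[OF z(2)])
  have Y: "Y \<in> su"
    using su_conjugate[OF SU_conj_transpose[OF z(2)] Y0(1)] by (simp add: Y_def)
  let ?R = "\<lambda>y. fderiv F y (Y ** y)"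
  let ?F2 = "\<lambda>\<zeta> \<xi>. fderiv (\<lambda>y. fderiv F y \<zeta>) z \<xi>"
  have dX: "(field X has_derivative (\<lambda>\<zeta>. ?F2 (z ** X) \<zeta> + fderiv F z (\<zeta> ** X))) (at z)"
    unfolding field_def[abs_def] by (rule has_derivative_linear_field[OF z(1) bounded_linear_matrix_mult_left])
  have dR: "(?R has_derivative (\<lambda>\<zeta>. ?F2 (Y ** z) \<zeta> + fderiv F z (Y ** \<zeta>))) (at z)"
    by (rule has_derivative_linear_field[OF z(1) bounded_linear_matrix_mult_right])
  let ?dX = "fderiv (field X) z"
  let ?dR = "fderiv ?R z"
  have dX': "(field X has_derivative ?dX) (at z)" and dR': "(?R has_derivative ?dR) (at z)"
    using dX dR by (simp_all add: fderiv_eq)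
  \<comment> \<open>The first-order terms on both sides are \<open>fderiv F z (Y ** z ** X)\<close>,
    and the second-order terms agree by symmetry of the second derivative.\<close>
  have comm: "?dX (Y ** z) = ?dR (z ** X)"
    unfolding fderiv_eq[OF dX] fderiv_eq[OF dR]
    using symmetric_second_derivative[OF lift_simps(1,2) z(1), of "z ** X" "Y ** z"]
    by (simp add: matrix_mul_assoc)
  have v: "fderiv F z (Y ** z) = v" "fderiv F z (z ** X) = field X z"
    using Y0 YY0 by (simp_all add: field_def)
  have "((\<lambda>y. g C (F y) (field X y) (field X y)) has_derivative
      (\<lambda>\<zeta>. chart.dG (F z) (fderiv F z \<zeta>) (field X z) (field X z)
         + g C (F z) (field X z) (?dX \<zeta>) + g C (F z) (?dX \<zeta>) (field X z))) (at z)"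
    by (rule chart.has_derivative_metric[OF has_derivative_lift[OF z(1)] Fz dX' dX'])
  from derivative_vanishes_on_SU[OF this z(2) lift_simps(1) z(1) _ Y0(1), of "X \<bullet> X"]
  have A: "chart.dG (F z) v (field X z) (field X z) + 2 * g C (F z) (field X z) (?dX (Y ** z)) = 0"
    using field_isometry[OF _ _ X X] v YY0(2) inner_product_commute[OF chart.ip[OF Fz], of "?dX (Y ** z)"] by simp
  have dconj: "((\<lambda>y. X \<bullet> (conj_transpose y ** Y ** y)) has_derivative
      (\<lambda>\<zeta>. X \<bullet> (conj_transpose z ** Y ** \<zeta> + conj_transpose \<zeta> ** Y ** z))) (at z)"
    by (intro has_derivative_inner_right bounded_bilinear.FDERIV[OF bounded_bilinear_matrix_mult]
        bounded_linear_imp_has_derivative[OF bounded_linear_compose[OF bounded_linear_matrix_mult_left bounded_linear_conj_transpose]]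
        has_derivative_ident)
  have d: "((\<lambda>y. g C (F y) (field X y) (?R y) - X \<bullet> (conj_transpose y ** Y ** y)) has_derivative
      (\<lambda>\<zeta>. (chart.dG (F z) (fderiv F z \<zeta>) (field X z) (?R z)
         + g C (F z) (field X z) (?dR \<zeta>) + g C (F z) (?dX \<zeta>) (?R z))
         - X \<bullet> (conj_transpose z ** Y ** \<zeta> + conj_transpose \<zeta> ** Y ** z))) (at z)"
    by (intro has_derivative_diff dconj chart.has_derivative_metric[OF has_derivative_lift[OF z(1)] Fz dX' dR'])
  \<comment> \<open>On \<open>SU\<close> the right-invariant vector \<open>Y ** y\<close> equals
    \<open>y ** (conj_transpose y ** Y ** y)\<close>, a left translate of an element of
    \<open>su\<close>.\<close>
  have 0: "g C (F y) (field X y) (?R y) - X \<bullet> (conj_transpose y ** Y ** y) = 0" if "y \<in> V \<inter> SU" for y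
  proof -
    have "?R y = field (conj_transpose y ** Y ** y) y"
      using that by (simp add: field_def matrix_mul_assoc SU_unitary)
    then show ?thesis
      using field_su_inner[of y X "conj_transpose y ** Y ** y"] X that su_conjugate[OF _ Y] by auto
  qed
  have "(chart.dG (F z) (field X z) (field X z) v
         + g C (F z) (field X z) (?dR (z ** X)) + g C (F z) (?dX (z ** X)) v)
         - X \<bullet> (conj_transpose z ** Y ** (z ** X) + conj_transpose (z ** X) ** Y ** z) = 0"
    using derivative_vanishes_on_SU[OF d z(2) lift_simps(1) z(1) 0 sym_suD(1)[OF X]] by (simp only: v)
  \<comment> \<open>The derivative of \<open>conj_transpose y ** Y ** y\<close> along
    \<open>z ** X\<close> is the commutator of Y0 and X, which is orthogonal to X by invariance of
    the inner product.\<close>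
  moreover have "X \<bullet> (conj_transpose z ** Y ** (z ** X) + conj_transpose (z ** X) ** Y ** z) = 0"
  proof -
    have skew: "conj_transpose X = - X"
      using sym_suD(1)[OF X] by (simp add: su_iff)
    have "conj_transpose z ** Y ** (z ** X) = Y0 ** X" "conj_transpose (z ** X) ** Y ** z = - (X ** Y0)"
      using YY0(1) by (simp_all add: conj_transpose_mult matrix_mul_assoc skew matrix_mult_simps)
        (simp add: matrix_mul_assoc[symmetric])
    then show ?thesis
      using inner_matrix_mult_left[of X X Y0] inner_matrix_mult_right[of X X Y0] skew
      by (simp add: inner_add_right inner_diff_right matrix_mult_simps inner_commute)
  qed
  ultimately have B: "chart.dG (F z) (field X z) (field X z) v + g C (F z) (?dX (z ** X)) v
      + g C (F z) (field X z) (?dX (Y ** z)) = 0"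
    using comm by simp
  have "2 * g C (F z) (- ?dX (z ** X)) v = - 2 * g C (F z) (?dX (z ** X)) v"
    using inner_productD(3)[OF chart.ip[OF Fz], of "-1" "?dX (z ** X)" v] by simp
  \<comment> \<open>Twice B minus A: the terms with \<open>?dX (Y ** z)\<close> cancel.\<close>
  then show "2 * g C (F z) (- ?dX (z ** X)) v = chart.dG (F z) (field X z) (field X z) v
      + chart.dG (F z) (field X z) (field X z) v - chart.dG (F z) v (field X z) (field X z)"
    using A B by linarith
qed

text \<open>Differentiating \<open>phi_lift_derivative\<close> along \<open>z ** X\<close> produces,
  besides the second derivative of the chart expression, the derivative of \<open>field X\<close>;
  by \<open>christoffel_field\<close> this is exactly what the Christoffel term of the Hessian
  contributes.\<close>

lemma hessian_phi:
  assumes z: "z \<in> V" "z \<in> SU" and X: "X \<in> sym_su"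
  shows "hessian (g C) (phi_chart a) (F z) (field X z) (field X z)
    = 4 * bdot (a v* z v* X) (a v* z v* X)"
proof -
  let ?h = "phi_chart a"
  let ?h' = "\<lambda>x. fderiv ?h x"
  let ?dX = "fderiv (field X) z"
  note Fz = lift_simps(3)[OF z(1)]
  have lin: "linear (?h' (F z))"
    using smooth_onD[OF smooth_phi[OF C] Fz] has_derivative_linear by blast
  have "field X differentiable at z"
    unfolding field_def[abs_def] differentiable_def
    using has_derivative_linear_field[OF z(1) bounded_linear_matrix_mult_left] by blast
  then have dX: "(field X has_derivative ?dX) (at z)"
    using frechet_derivative_works by blast
  have "((\<lambda>y. ?h' (F y) (field X y) - fderiv (phi_hat a) y (y ** X)) has_derivative
     (\<lambda>\<zeta>. (fderiv (\<lambda>x. ?h' x (field X z)) (F z) (fderiv F z \<zeta>) + ?h' (F z) (?dX \<zeta>))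
        - (2 * bdot (a v* (\<zeta> ** X)) (a v* z) + 2 * bdot (a v* z v* X) (a v* \<zeta>)))) (at z)"
    by (intro has_derivative_diff phi_hat_left_invariant_second_derivative(1)[OF sym_suD(2)[OF X]]
        has_derivative_derivative_field[OF chart.open_U smooth_phi[OF C] has_derivative_lift[OF z(1)] Fz dX])
  from derivative_vanishes_on_SU[OF this z(2) lift_simps(1) z(1) _ sym_suD(1)[OF X], of 0]
  have "fderiv (\<lambda>x. ?h' x (field X z)) (F z) (field X z) + ?h' (F z) (?dX (z ** X))
     = 4 * bdot (a v* z v* X) (a v* z v* X)"
    using phi_lift_derivative[OF _ _ sym_suD(1)[OF X]]
      phi_hat_left_invariant_second_derivative(2)[OF sym_suD(2)[OF X], of a z]
    by (simp add: field_def[symmetric])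
  then show ?thesis
    unfolding hessian_def christoffel_field[OF z X] by (simp add: linear_neg[OF lin])
qed

text \<open>At z, \<open>field\<close> is an isometry of \<open>sym_su\<close> onto the coordinate
  space, so traces over an arbitrary orthonormal basis of the chart pull back to matrices, where the
  contractions are known.\<close>

lemma field_orthonormal_basis:
  assumes z: "z \<in> V" "z \<in> SU" and E: "orthonormal_basis_of (g C (F z)) UNIV E"
  obtains E' where "orthonormal_basis_of (\<bullet>) sym_su E'" "bij_betw (\<lambda>X. field X z) E' E"
proof -
  let ?L = "\<lambda>X. field X z"
  define E' where "E' = {X\<in>sym_su. ?L X \<in> E}"
  note lin = linear_field[OF z(1)]
  have inj: "X = Y" if "X \<in> sym_su" "Y \<in> sym_su" "?L X = ?L Y" for X Y
    using field_sym_su_inj[OF z subspace_diff[OF subspace_sym_su that(1,2)]] that(3) linear_diff[OF lin, of X Y]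
    by simp
  have bij: "bij_betw ?L E' E"
    unfolding bij_betw_def
  proof
    show "inj_on ?L E'"
      using inj by (auto simp: inj_on_def E'_def)
    show "?L ` E' = E"
    proof
      show "E \<subseteq> ?L ` E'"
      proof
        fix e assume "e \<in> E"
        moreover obtain X where "X \<in> sym_su" "?L X = e"
          using field_surj[OF z] by blast
        ultimately show "e \<in> ?L ` E'"
          by (auto simp: E'_def)
      qed
    qed (auto simp: E'_def)
  qed
  have "finite E'"
    using bij E bij_betw_finite by (auto simp: orthonormal_basis_of_def)
  moreover have "X \<bullet> Y = (if X = Y then 1 else 0)" if "X \<in> E'" "Y \<in> E'" for X Y
  proof -
    have "g C (F z) (?L X) (?L Y) = (if ?L X = ?L Y then 1 else 0)"
      using E that by (auto simp: orthonormal_basis_of_def E'_def)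
    moreover have "X \<in> sym_su" "Y \<in> sym_su"
      using that by (auto simp: E'_def)
    moreover from this have "?L X = ?L Y \<longleftrightarrow> X = Y"
      using inj by blast
    ultimately show ?thesis
      using field_isometry[OF z, of X Y] by simp
  qed
  moreover have "span E' = sym_su"
  proof
    show "span E' \<subseteq> sym_su"
      by (rule span_minimal) (auto simp: E'_def subspace_sym_su)
    show "sym_su \<subseteq> span E'"
    proof
      fix X :: "complex^'n^'n" assume X: "X \<in> sym_su"
      have "?L X \<in> span (?L ` E')"
        using bij E by (simp add: bij_betw_def orthonormal_basis_of_def)
      then obtain Y where Y: "Y \<in> span E'" "?L X = ?L Y"
        unfolding linear_span_image[OF lin] by blast
      then show "X \<in> span E'"
        using inj[OF X, of Y] \<open>span E' \<subseteq> sym_su\<close> by blast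
    qed
  qed
  ultimately have "orthonormal_basis_of (\<bullet>) sym_su E'"
    by (auto simp: orthonormal_basis_of_def E'_def)
  with bij that show thesis
    by blast
qed

lemma trace_hessian_phi:
  assumes z: "z \<in> V" "z \<in> SU" and E: "orthonormal_basis_of (g C (F z)) UNIV E"
  shows "(\<Sum>e\<in>E. hessian (g C) (phi_chart a) (F z) e e)
    = - of_real (4 * (real CARD('n) / 2 + 1 / 2 - 1 / real CARD('n))) * phi_hat a z"
proof -
  obtain E' where E': "orthonormal_basis_of (\<bullet>) sym_su E'" "bij_betw (\<lambda>X. field X z) E' E"
    using field_orthonormal_basis[OF z E] by blast
  have "(\<Sum>e\<in>E. hessian (g C) (phi_chart a) (F z) e e)
      = (\<Sum>X\<in>E'. hessian (g C) (phi_chart a) (F z) (field X z) (field X z))"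
    by (rule sum.reindex_bij_betw[OF E'(2), symmetric])
  also have "\<dots> = (\<Sum>X\<in>E'. 4 * bdot (a v* z v* X) (a v* z v* X))"
  proof (rule sum.cong[OF refl])
    fix X assume "X \<in> E'"
    then have "X \<in> sym_su"
      using E'(1) by (auto simp: orthonormal_basis_of_def)
    then show "hessian (g C) (phi_chart a) (F z) (field X z) (field X z) = 4 * bdot (a v* z v* X) (a v* z v* X)"
      by (rule hessian_phi[OF z])
  qed
  also have "\<dots> = 4 * (\<Sum>X\<in>E'. bdot (a v* z v* X) (a v* z v* X))"
    by (simp add: sum_distrib_left)
  finally show ?thesis
    unfolding trace_bdot_square[OF E'(1)] phi_hat_eq_bdot by (simp add: algebra_simps)
qed

lemma trace_derivative_phi_squared:
  assumes z: "z \<in> V" "z \<in> SU" and E: "orthonormal_basis_of (g C (F z)) UNIV E"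
  shows "(\<Sum>e\<in>E. (fderiv (phi_chart a) (F z) e)\<^sup>2)
    = - of_real (4 * (1 - 1 / real CARD('n))) * (phi_hat a z)\<^sup>2"
proof -
  obtain E' where E': "orthonormal_basis_of (\<bullet>) sym_su E'" "bij_betw (\<lambda>X. field X z) E' E"
    using field_orthonormal_basis[OF z E] by blast
  have "(\<Sum>e\<in>E. (fderiv (phi_chart a) (F z) e)\<^sup>2)
      = (\<Sum>X\<in>E'. (fderiv (phi_chart a) (F z) (field X z))\<^sup>2)"
    by (rule sum.reindex_bij_betw[OF E'(2), symmetric])
  also have "\<dots> = (\<Sum>X\<in>E'. 4 * (bdot (a v* z v* X) (a v* z))\<^sup>2)"
  proof (rule sum.cong[OF refl])
    fix X assume "X \<in> E'"
    then have "X \<in> su"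
      using E'(1) sym_suD(1) by (auto simp: orthonormal_basis_of_def)
    then show "(fderiv (phi_chart a) (F z) (field X z))\<^sup>2 = 4 * (bdot (a v* z v* X) (a v* z))\<^sup>2"
      by (simp add: phi_lift_derivative[OF z] phi_hat_left_invariant_derivative power_mult_distrib)
  qed
  also have "\<dots> = 4 * (\<Sum>X\<in>E'. (bdot (a v* z v* X) (a v* z))\<^sup>2)"
    by (simp add: sum_distrib_left)
  finally show ?thesis
    unfolding trace_bdot_derivative[OF E'(1)] phi_hat_eq_bdot by (simp add: algebra_simps)
qed

end

section \<open>The eigenfunction and its zero set\<close>

context SU_quotient_lift
begin

lemma phi_has_derivative:
  assumes "z \<in> V"
  shows "((phi_chart a) has_derivative fderiv (phi_chart a) (F z)) (at (F z))"
  by (rule smooth_onD[OF smooth_phi[OF C] lift_simps(3)[OF assms]])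

lemma linear_phi_derivative: "z \<in> V \<Longrightarrow> linear (fderiv (phi_chart a) (F z))"
  using phi_has_derivative has_derivative_linear by blast

lemma eigenfunction_lift:
  assumes z: "z \<in> V" "z \<in> SU"
  shows "laplace_beltrami (g C) (phi_chart a) (F z)
      = - of_real (4 * (real CARD('n) / 2 + 1 / 2 - 1 / real CARD('n))) * phi_hat a z"
    "kappa (g C) (phi_chart a) (phi_chart a) (F z)
      = - of_real (4 * (1 - 1 / real CARD('n))) * (phi_hat a z)\<^sup>2"
proof -
  note Fz = lift_simps(3)[OF z(1)]
  obtain E where E: "orthonormal_basis_of (g C (F z)) UNIV E"
    using orthonormal_basis_exists[OF chart.ip[OF Fz] subspace_UNIV] by blast
  show "laplace_beltrami (g C) (phi_chart a) (F z)
      = - of_real (4 * (real CARD('n) / 2 + 1 / 2 - 1 / real CARD('n))) * phi_hat a z"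
    unfolding chart.laplace_beltrami_eq_trace_hessian[OF smooth_phi[OF C] Fz E] by (rule trace_hessian_phi[OF z E])
  show "kappa (g C) (phi_chart a) (phi_chart a) (F z)
      = - of_real (4 * (1 - 1 / real CARD('n))) * (phi_hat a z)\<^sup>2"
    unfolding chart.kappa_eq_sum[OF smooth_phi[OF C] Fz E] by (rule trace_derivative_phi_squared[OF z E])
qed

lemma zero_normal_frame:
  assumes a: "a \<noteq> 0" and z: "z \<in> V" "z \<in> SU" "phi_hat a z = 0"
  obtains n1 n2 r where "g C (F z) n1 n1 = 1" "g C (F z) n2 n2 = 1" "g C (F z) n1 n2 = 0" "g C (F z) n2 n1 = 0" "r > 0"
    "\<And>v. fderiv (phi_chart a) (F z) v
       = of_real r * (\<i> * of_real (g C (F z) v n1) - of_real (g C (F z) v n2))"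
    "hessian (g C) (phi_chart a) (F z) n1 n1 = 0" "hessian (g C) (phi_chart a) (F z) n2 n2 = 0"
proof -
  define w where "w = a v* z"
  have "w v* conj_transpose z = a"
    by (simp add: w_def vector_matrix_mul_assoc SU_unitary[OF z(2)])
  then have "w \<noteq> 0"
    using a by auto
  moreover have "bdot w w = 0"
    using z(3) by (simp add: phi_hat_eq_bdot w_def)
  ultimately obtain X1 X2 :: "complex^'n^'n" and r where X: "X1 \<in> sym_su" "X2 \<in> sym_su"
    "X1 \<bullet> X1 = 1" "X2 \<bullet> X2 = 1" "X1 \<bullet> X2 = 0" and r: "r > 0"
    and d: "\<And>X. X \<in> sym_su \<Longrightarrow> bdot (w v* X) w = of_real r * (\<i> * of_real (X \<bullet> X1) - of_real (X \<bullet> X2))"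
    and h: "bdot (w v* X1) (w v* X1) = 0" "bdot (w v* X2) (w v* X2) = 0"
    using null_vector_normal_frame by metis
  show thesis
  \<comment> \<open>The factor 2 is that of the differential of \<open>phi_hat a\<close>, whose
    value at \<open>z ** X\<close> is \<open>2 * bdot (w v* X) w\<close>.\<close>
  proof (rule that[of "field X1 z" "field X2 z" "2 * r"])
    fix v
    obtain X where Xv: "X \<in> sym_su" "field X z = v"
      using field_surj[OF z(1,2)] by metis
    have "fderiv (phi_chart a) (F z) v = 2 * bdot (w v* X) w"
      using phi_lift_derivative[OF z(1,2) sym_suD(1)[OF Xv(1)], of a]
      by (simp add: Xv(2) phi_hat_left_invariant_derivative w_def)
    then show "fderiv (phi_chart a) (F z) v
       = of_real (2 * r) * (\<i> * of_real (g C (F z) v (field X1 z)) - of_real (g C (F z) v (field X2 z)))"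
      using field_isometry[OF z(1,2) Xv(1) X(1)] field_isometry[OF z(1,2) Xv(1) X(2)]
      by (simp add: d[OF Xv(1)] Xv(2))
  qed (use X r h field_isometry[OF z(1,2)] hessian_phi[OF z(1,2), of _ a] in \<open>simp_all add: w_def inner_commute\<close>)
qed

lemma regular_zero:
  assumes a: "a \<noteq> 0" and z: "z \<in> V" "z \<in> SU" "phi_hat a z = 0"
  shows "surj (fderiv (phi_chart a) (F z))"
proof -
  obtain n1 n2 r where n: "g C (F z) n1 n1 = 1" "g C (F z) n2 n2 = 1" "g C (F z) n1 n2 = 0" "g C (F z) n2 n1 = 0" "r > 0"
    and d: "\<And>v. fderiv (phi_chart a) (F z) v
       = of_real r * (\<i> * of_real (g C (F z) v n1) - of_real (g C (F z) v n2))"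
    using zero_normal_frame[OF a z] by metis
  show ?thesis
  proof (rule surjI)
    fix c :: complex
    \<comment> \<open>On \<open>\<alpha> n1 + \<beta> n2\<close> the differential is
      \<open>r (\<i> \<alpha> - \<beta>)\<close>; solving for c gives the coefficients.\<close>
    show "fderiv (phi_chart a) (F z) ((Im c / r) *\<^sub>R n1 + (- Re c / r) *\<^sub>R n2) = c"
      unfolding d inner_productD[OF chart.ip[OF lift_simps(3)[OF z(1)]]] using n by (simp add: complex_eq_iff)
  qed
qed

lemma mean_curvature_zero_set:
  assumes a: "a \<noteq> 0" and z: "z \<in> V" "z \<in> SU" "phi_hat a z = 0"
    and W: "subspace W" "dim W + 2 = DIM('e)" "F z \<in> W"
    and h0: "\<And>x. x \<in> chart_image C \<inter> W \<Longrightarrow> (phi_chart a) x = 0"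
  shows "mean_curvature (g C) W (F z) = 0"
proof -
  let ?h = "phi_chart a"
  let ?h' = "fderiv ?h (F z)"
  note Fz = lift_simps(3)[OF z(1)]
  obtain n1 n2 r where n: "g C (F z) n1 n1 = 1" "g C (F z) n2 n2 = 1" "g C (F z) n1 n2 = 0" "g C (F z) n2 n1 = 0" "r > 0"
    and d: "\<And>v. ?h' v = of_real r * (\<i> * of_real (g C (F z) v n1) - of_real (g C (F z) v n2))"
    and hess: "hessian (g C) ?h (F z) n1 n1 = 0" "hessian (g C) ?h (F z) n2 n2 = 0"
    using zero_normal_frame[OF a z] by metis
  \<comment> \<open>The slice gives this inclusion at once; equality of dimensions, by surjectivity
    of the differential, makes W its kernel.\<close>
  have "W \<subseteq> {v. ?h' v = 0}"
    using derivative_vanishes_along_subspace[OF chart.open_U W(1) phi_has_derivative[OF z(1)] _ _ h0] Fz W(3) by blast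
  moreover have "dim {v. ?h' v = 0} + 2 = DIM('e)"
    using dim_kernel_surj[OF linear_phi_derivative[OF z(1)] regular_zero[OF a z]] by simp
  ultimately have W_ker: "W = {v. ?h' v = 0}"
    using W(2) subspace_dim_equal[OF W(1) linear_subspace_kernel[OF linear_phi_derivative[OF z(1)]]] by simp
  have "n1 \<noteq> n2"
    using n by auto
  show ?thesis
  proof (rule chart.mean_curvature_zero[OF smooth_phi[OF C] Fz W(3,1) h0, where N = "{n1, n2}"])
    show "v \<in> W" if "?h' v = 0" for v
      using that W_ker by blast
    show "W = {v. \<forall>n\<in>{n1, n2}. g C (F z) v n = 0}"
      unfolding W_ker d using n(5) by (auto simp: complex_eq_iff)
    show "(\<Sum>e\<in>E. hessian (g C) ?h (F z) e e) = 0" if "orthonormal_basis_of (g C (F z)) UNIV E" for E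
      using trace_hessian_phi[OF z(1,2) that] z(3) by simp
  qed (use n \<open>n1 \<noteq> n2\<close> hess in \<open>auto simp: comp_def\<close>)
qed

end

section \<open>Passage from one lifted chart to the whole atlas\<close>

context SU_quotient
begin

text \<open>Every point of every chart lies under a lifted chart, so statements at
  \<open>F z\<close> become statements at \<open>snd C p\<close>.\<close>

lemma point_lift_exists:
  assumes "C \<in> \<A>" "p \<in> fst C"
  obtains z V F where "SU_quotient_lift \<A> g C V F" "z \<in> V" "z \<in> SU" "proj z = p" "F z = snd C p"
proof -
  obtain z where z: "z \<in> SU" "proj z = p"
    using point_lift[OF assms] by blast
  obtain V F where "chart_lift C V F" "z \<in> V"
    using chart_lift_exists[OF assms(1) z(1)] z assms(2) by blast
  moreover from this have "SU_quotient_lift \<A> g C V F"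
    using assms(1) by unfold_locales
  moreover have "F z = snd C p"
    using calculation z by (auto simp: chart_lift_def)
  ultimately show thesis
    using that z by blast
qed

lemma eigenfunction_phi: "eigenfunction \<A> g (phi a)"
  unfolding eigenfunction_def
proof (intro conjI exI ballI)
  show "smooth_function \<A> (phi a)"
    by (simp add: smooth_function_def smooth_phi)
  fix C p assume Cp: "C \<in> \<A>" "p \<in> fst C"
  obtain z V F where L: "SU_quotient_lift \<A> g C V F" and z: "z \<in> V" "z \<in> SU" "proj z = p" "F z = snd C p"
    using point_lift_exists[OF Cp] by blast
  show "laplace_beltrami (g C) (phi a \<circ> chart_inv C) (snd C p)
      = - of_real (4 * (real CARD('n) / 2 + 1 / 2 - 1 / real CARD('n))) * phi a p"
    "kappa (g C) (phi a \<circ> chart_inv C) (phi a \<circ> chart_inv C) (snd C p)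
      = - of_real (4 * (1 - 1 / real CARD('n))) * (phi a p)\<^sup>2"
    using SU_quotient_lift.eigenfunction_lift[OF L z(1,2)] phi_proj[OF z(2)] z(3,4) by metis+
qed

lemma regular_value_phi:
  assumes "a \<noteq> 0"
  shows "regular_value \<A> (phi a) 0"
  unfolding regular_value_def
proof (intro conjI ballI impI)
  show "smooth_function \<A> (phi a)"
    by (simp add: smooth_function_def smooth_phi)
  fix C p assume Cp: "C \<in> \<A>" "p \<in> fst C" and 0: "phi a p = 0"
  obtain z V F where L: "SU_quotient_lift \<A> g C V F" and z: "z \<in> V" "z \<in> SU" "proj z = p" "F z = snd C p"
    using point_lift_exists[OF Cp] by blast
  have "phi_hat a z = 0"
    using 0 z by (simp add: phi_proj[symmetric])
  then show "\<exists>D. ((phi a \<circ> chart_inv C) has_derivative D) (at (snd C p)) \<and> surj D"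
    using SU_quotient_lift.phi_has_derivative[OF L z(1)] SU_quotient_lift.regular_zero[OF L assms z(1,2)] z(4) by metis
qed

lemma minimal_zero_set:
  assumes a: "a \<noteq> 0"
  shows "minimal_submanifold_of_codim \<A> g 2 {q\<in>SU_mod_SO. phi a q = 0}"
  unfolding minimal_submanifold_of_codim_def
proof (intro conjI allI impI ballI)
  show "submanifold_of_codim \<A> 2 {q\<in>SU_mod_SO. phi a q = 0}"
    using regular_level_set_submanifold[OF regular_value_phi[OF a]] by (simp add: topspace_quotient)
  fix C W p
  assume slice: "slice_chart \<A> 2 {q\<in>SU_mod_SO. phi a q = 0} C W" and p: "p \<in> fst C \<inter> {q\<in>SU_mod_SO. phi a q = 0}"
  then have C: "C \<in> \<A>" and W: "subspace W" "dim W + 2 = DIM('e)"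
    and eq: "snd C ` (fst C \<inter> {q\<in>SU_mod_SO. phi a q = 0}) = chart_image C \<inter> W"
    by (auto simp: slice_chart_def)
  obtain z V F where L: "SU_quotient_lift \<A> g C V F" and z: "z \<in> V" "z \<in> SU" "proj z = p" "F z = snd C p"
    using point_lift_exists[OF C, of p] p by blast
  have "phi_hat a z = 0"
    using p z by (simp add: phi_proj[symmetric])
  moreover have "F z \<in> W"
    using eq p z(4) by blast
  moreover have "(phi a \<circ> chart_inv C) x = 0" if x: "x \<in> chart_image C \<inter> W" for x
  proof -
    obtain q where "q \<in> fst C" "phi a q = 0" "x = snd C q"
      using x unfolding eq[symmetric] by blast
    then show ?thesis
      by (simp add: chart_inverse[OF C])
  qed
  ultimately show "mean_curvature (g C) W (snd C p) = 0"
    using SU_quotient_lift.mean_curvature_zero_set[OF L a z(1,2) _ W] z(4) by simp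
qed

end

theorem theorem2p1:
  fixes a :: "complex^'n"
    and \<A> :: "((complex^'n^'n) set, 'e::euclidean_space) chart set"
    and g :: "((complex^'n^'n) set, 'e) metric"
  assumes "CARD('n) \<ge> 2" and "a \<noteq> 0"
    and "riemannian_manifold quotient_topology \<A> g"
    and "riemannian_submersion SU tangent_SU metric_SU \<A> g proj"
  shows "eigenfunction \<A> g (phi a) \<and>
         regular_value \<A> (phi a) 0 \<and>
         compactin quotient_topology {q\<in>SU_mod_SO. phi a q = 0} \<and>
         minimal_submanifold_of_codim \<A> g 2 {q\<in>SU_mod_SO. phi a q = 0}"
proof -
  interpret SU_quotient \<A> g
    using assms(3,4) by (simp add: SU_quotient_def SU_quotient_axioms_def)
  show ?thesis
    using eigenfunction_phi regular_value_phi[OF assms(2)] compact_zero_set minimal_zero_set[OF assms(2)] by blast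
qed

end
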